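(* Let $n$ be a positive integer and let $L$ be a lattice with $|L|=n$. If $|\mathrm{Con}(L)|<2^{n-2}$, then $n\geq 5$ and: (1) $|\mathrm{Con}(L)|\leq 5\cdot 2^{n-5}=2^{n-3}+2^{n-5}$, and $|\mathrm{Con}(L)|=5\cdot 2^{n-5}$ if and only if $L\cong \mathcal{L}_k\dotplus N_5\dotplus \mathcal{L}_{n-k-3}$ for some integer $k$ with $1\leq k\leq n-4$; (2) if $|\mathrm{Con}(L)|<5\cdot 2^{n-5}$, then $|\mathrm{Con}(L)|\leq 2^{n-3}$, and $|\mathrm{Con}(L)|=2^{n-3}$ if and only if one of the following holds: either $n\geq 6$ and $L\cong \mathcal{L}_k\dotplus (\mathcal{L}_2\times \mathcal{L}_3)\dotplus \mathcal{L}_{n-k-4}$ for some integer $k$ with $1\leq k\leq n-5$, or $n\geq 7$ and $L\cong \mathcal{L}_k\dotplus \mathcal{L}_2^2\dotplus \mathcal{L}_m\dotplus \mathcal{L}_2^2\dotplus \mathcal{L}_{n-k-m-4}$ for some positive integers $k,m$ with $k+m\leq n-5$; (3) if $|\mathrm{Con}(L)|<2^{n-3}$, then $|\mathrm{Con}(L)|\leq 7\cdot 2^{n-6}=2^{n-4}+2^{n-5}+2^{n-6}$.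
   Context: For a lattice $L$, $\mathrm{Con}(L)$ denotes the lattice of congruences of $L$, and $\cong$ denotes lattice isomorphism. Powers of $2$ with possibly negative exponents are rational numbers. For a positive integer $m$, $\mathcal{L}_m$ is the $m$-element chain; $\mathcal{L}_2^2=\mathcal{L}_2\times\mathcal{L}_2$ is the four-element Boolean algebra, and $\mathcal{L}_2\times\mathcal{L}_3$ is the direct product of the two-element and three-element chains. $N_5$ is the five-element non-modular lattice (the pentagon), i.e. the lattice $\{0,a,b,c,1\}$ with least element $0$, greatest element $1$, $0<b<c<1$, $0<a<1$, and $a$ incomparable to both $b$ and $c$. Ordinal sum: for a lattice $L$ with greatest element $1_L$ and a lattice $M$ with least element $0_M$, $L\dotplus M$ is the lattice obtained by placing $M$ above $L$ and identifying $1_L$ with $0_M$; that is, with $c=1_L=0_M$ the only common element, the underlying set is the disjoint union of $L\setminus\{c\}$, $\{c\}$ and $M\setminus\{c\}$, and the order is $\leq_L\cup\leq_M\cup\{(x,y)\mid x\in L,\ y\in M\}$. In particular, $|L\dotplus M|=|L|+|M|-1$ for finite $L,M$, and $\mathcal{L}_1\dotplus M\cong M$, $L\dotplus\mathcal{L}_1\cong L$. The ordinal sum of bounded lattices is associative. *)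

theory Defs
  imports Complex_Main "HOL-Algebra.Lattice"
begin

definition lattice_congruence :: "('a, 'r) gorder_scheme \<Rightarrow> ('a \<times> 'a) set \<Rightarrow> bool"
  where "lattice_congruence L \<theta> \<longleftrightarrow>
    equiv (carrier L) \<theta> \<and>
    (\<forall>a b c d. (a, b) \<in> \<theta> \<longrightarrow> (c, d) \<in> \<theta> \<longrightarrow>
      (a \<squnion>\<^bsub>L\<^esub> c, b \<squnion>\<^bsub>L\<^esub> d) \<in> \<theta> \<and> (a \<sqinter>\<^bsub>L\<^esub> c, b \<sqinter>\<^bsub>L\<^esub> d) \<in> \<theta>)"

definition Con :: "('a, 'r) gorder_scheme \<Rightarrow> ('a \<times> 'a) set gorder"
  where "Con L = \<lparr>carrier = {\<theta>. lattice_congruence L \<theta>}, eq = (=), le = (\<subseteq>)\<rparr>"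

text \<open>Both preservation predicates already require the two structures to be lattices.\<close>

definition lattice_isomorphic ::
    "('a, 'r) gorder_scheme \<Rightarrow> ('b, 's) gorder_scheme \<Rightarrow> bool"  (infix \<open>\<cong>\<^sub>L\<close> 50)
  where "L \<cong>\<^sub>L M \<longleftrightarrow>
    (\<exists>f. bij_betw f (carrier L) (carrier M) \<and> join_pres L M f \<and> meet_pres L M f)"

definition chain :: "nat \<Rightarrow> nat gorder"
  where "chain m = \<lparr>carrier = {..<m}, eq = (=), le = (\<le>)\<rparr>"

definition lattice_prod ::
    "('a, 'r) gorder_scheme \<Rightarrow> ('b, 's) gorder_scheme \<Rightarrow> ('a \<times> 'b) gorder"
    (infixr \<open>\<times>\<^sub>L\<close> 80)
  where "L \<times>\<^sub>L M = \<lparr>carrier = carrier L \<times> carrier M, eq = (=),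
    le = (\<lambda>u v. fst u \<sqsubseteq>\<^bsub>L\<^esub> fst v \<and> snd u \<sqsubseteq>\<^bsub>M\<^esub> snd v)\<rparr>"

datatype pentagon = N5_0 | N5_a | N5_b | N5_c | N5_1

definition N5 :: "pentagon gorder"
  where "N5 = \<lparr>carrier = UNIV, eq = (=),
    le = (\<lambda>x y. x = y \<or> x = N5_0 \<or> y = N5_1 \<or> (x = N5_b \<and> y = N5_c))\<rparr>"

text \<open>
  Elements of the ordinal sum are tagged: an element \<open>x\<close> of the lower summand \<open>L\<close>
  becomes \<open>Inl x\<close>, and an element \<open>y\<close> of the upper summand \<open>M\<close> becomes \<open>Inr y\<close>,
  except that the bottom of \<open>M\<close> is identified with the top of \<open>L\<close>, that is,
  represented by \<open>Inl \<top>\<^bsub>L\<^esub>\<close>. The definition is meaningful only when that top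
  and that bottom exist.
\<close>

definition upper_emb ::
    "('a, 'r) gorder_scheme \<Rightarrow> ('b, 's) gorder_scheme \<Rightarrow> 'b \<Rightarrow> 'a + 'b"
  where "upper_emb L M y = (if y = \<bottom>\<^bsub>M\<^esub> then Inl \<top>\<^bsub>L\<^esub> else Inr y)"

definition ordinal_sum ::
    "('a, 'r) gorder_scheme \<Rightarrow> ('b, 's) gorder_scheme \<Rightarrow> ('a + 'b) gorder"
    (infixl \<open>\<^bold>+\<close> 65)
  where "L \<^bold>+ M = \<lparr>carrier = Inl ` carrier L \<union> upper_emb L M ` carrier M, eq = (=),
    le = (\<lambda>u v.
      (\<exists>x\<in>carrier L. \<exists>y\<in>carrier L. u = Inl x \<and> v = Inl y \<and> x \<sqsubseteq>\<^bsub>L\<^esub> y) \<or>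
      (\<exists>x\<in>carrier M. \<exists>y\<in>carrier M.
        u = upper_emb L M x \<and> v = upper_emb L M y \<and> x \<sqsubseteq>\<^bsub>M\<^esub> y) \<or>
      (\<exists>x\<in>carrier L. \<exists>y\<in>carrier M. u = Inl x \<and> v = upper_emb L M y))\<rparr>"

end

theory Submission
  imports Defs
begin

text \<open>
  A congruence of a finite lattice \<open>L\<close> is determined by the set of join-irreducible elements that it
  collapses, that is, identifies with a strictly smaller element (\<open>inj_on_collapsed\<close>). If \<open>L\<close> has
  \<open>m\<close> join-irreducible elements and \<open>d\<close> elements that are proper joins (joins of two elements different from them), then \<open>n = 1 + m + d\<close>, and
  \<open>L\<close> has at most \<open>2 ^ m = 2 ^ (n - 1 - d)\<close> congruences. This value is reached if all join-irreducible
  elements are join-prime (\<open>card_Con_if_all_join_prime\<close>); otherwise the collapse of some element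
  forces the collapse of another one, and at most three quarters of the sets remain
  (\<open>card_Con_le_if_not_join_prime\<close>). What remains is a discussion of \<open>d\<close>.

  \<^item> For \<open>d = 0\<close> the lattice is a chain with \<open>2 ^ (n - 1)\<close> congruences, which is too many, and
    \<open>d \<ge> 3\<close> leaves at most \<open>2 ^ (n - 4)\<close> of them.

  \<^item> For \<open>d = 1\<close> the only proper join \<open>r\<close> is comparable to everything, the elements strictly below
    \<open>r\<close> form a tree growing upwards, and those above \<open>r\<close> a chain. If all join-irreducible elements are
    join-prime there are \<open>2 ^ (n - 2)\<close> congruences, again too many. Otherwise the tree has two branches
    that split at some point with feet \<open>a\<close> and \<open>b\<close>. Collapsing one of the feet
    collapses the branches above the feet completely. With \<open>i\<close> such inner elements this
    leaves a fraction of at most \<open>(2 ^ i + 3) / 2 ^ (i + 2)\<close> of all sets: \<open>5 / 8\<close> for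
    \<open>i = 1\<close>, where \<open>L\<close> is a pentagon between two chains unless there is a third branch, and at most \<open>7 / 16\<close> for \<open>i \<ge> 2\<close>.
    If the only inner element is a third branch, the collapses of the three feet are equivalent,
    which leaves a quarter. This is \<open>not_join_prime_cases\<close>.

  \<^item> For \<open>d = 2\<close> there are \<open>2 ^ (n - 3)\<close> congruences if all join-irreducible elements are join-prime,
    and at most \<open>6 * 2 ^ (n - 6)\<close> otherwise. In the first case let \<open>r\<close> be the smaller of the two
    proper joins. If \<open>r\<close> is comparable to everything, the lattice consists of two squares and three
    chains (\<open>two_squares_if_comparable\<close>). Otherwise join-primeness leaves room for only
    one element incomparable to \<open>r\<close>, and it completes the square below \<open>r\<close> to the product of a
    two-element and a three-element chain (\<open>grid_if_incomparable\<close>).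

  Conversely, the numbers of congruences of the listed lattices follow from those of chains, grids
  and the pentagon, since the congruences of an ordinal sum are the pairs of congruences of the
  summands (\<open>card_Con_sum\<close>).
\<close>

section \<open>Finite lattices and their join-irreducible elements\<close>

locale finite_lattice = lattice L for L (structure) +
  assumes finite_carrier: "finite (carrier L)"
    and carrier_nonempty: "carrier L \<noteq> {}"

context lattice
begin

lemma join_le_iff:
  assumes "x \<in> carrier L" "y \<in> carrier L" "z \<in> carrier L"
  shows "x \<squnion> y \<sqsubseteq> z \<longleftrightarrow> x \<sqsubseteq> z \<and> y \<sqsubseteq> z"
  using assms by (meson join_closed join_le join_left join_right le_trans)

lemma le_meet_iff:
  assumes "x \<in> carrier L" "y \<in> carrier L" "z \<in> carrier L"
  shows "z \<sqsubseteq> x \<sqinter> y \<longleftrightarrow> z \<sqsubseteq> x \<and> z \<sqsubseteq> y"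
  using assms by (meson meet_closed meet_le meet_left meet_right le_trans)

lemma join_absorb_right:
  assumes "x \<sqsubseteq> y" "x \<in> carrier L" "y \<in> carrier L"
  shows "x \<squnion> y = y"
  using assms le_iff_meet by blast

lemma join_absorb_left:
  assumes "y \<sqsubseteq> x" "x \<in> carrier L" "y \<in> carrier L"
  shows "x \<squnion> y = x"
  using assms join_absorb_right join_comm by metis

lemma meet_absorb_left:
  assumes "x \<sqsubseteq> y" "x \<in> carrier L" "y \<in> carrier L"
  shows "x \<sqinter> y = x"
  using assms le_iff_join by metis

lemma meet_absorb_right:
  assumes "y \<sqsubseteq> x" "x \<in> carrier L" "y \<in> carrier L"
  shows "x \<sqinter> y = y"
  using assms meet_absorb_left meet_comm by metis

lemma join_eqI:
  assumes "x \<in> carrier L" "y \<in> carrier L" "s \<in> carrier L" "x \<sqsubseteq> s" "y \<sqsubseteq> s"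
    and "\<And>z. z \<in> carrier L \<Longrightarrow> x \<sqsubseteq> z \<Longrightarrow> y \<sqsubseteq> z \<Longrightarrow> s \<sqsubseteq> z"
  shows "x \<squnion> y = s"
  using assms by (meson join_closed join_le join_left join_right le_antisym)

lemma meet_eqI:
  assumes "x \<in> carrier L" "y \<in> carrier L" "s \<in> carrier L" "s \<sqsubseteq> x" "s \<sqsubseteq> y"
    and "\<And>z. z \<in> carrier L \<Longrightarrow> z \<sqsubseteq> x \<Longrightarrow> z \<sqsubseteq> y \<Longrightarrow> z \<sqsubseteq> s"
  shows "x \<sqinter> y = s"
  using assms by (meson meet_closed meet_le meet_left meet_right le_antisym)

end

definition join_reducibles :: "('a, 'r) gorder_scheme \<Rightarrow> 'a set"
  where "join_reducibles L =
    {r \<in> carrier L. \<exists>u\<in>carrier L. \<exists>v\<in>carrier L. r = u \<squnion>\<^bsub>L\<^esub> v \<and> u \<noteq> r \<and> v \<noteq> r}"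

definition join_irreducibles :: "('a, 'r) gorder_scheme \<Rightarrow> 'a set"
  where "join_irreducibles L = carrier L - join_reducibles L - {\<bottom>\<^bsub>L\<^esub>}"

definition join_prime :: "('a, 'r) gorder_scheme \<Rightarrow> 'a \<Rightarrow> bool"
  where "join_prime L j \<longleftrightarrow> (\<forall>x\<in>carrier L. \<forall>y\<in>carrier L.
    j \<sqsubseteq>\<^bsub>L\<^esub> x \<squnion>\<^bsub>L\<^esub> y \<longrightarrow> j \<sqsubseteq>\<^bsub>L\<^esub> x \<or> j \<sqsubseteq>\<^bsub>L\<^esub> y)"

lemma join_primeD:
  "join_prime L j \<Longrightarrow> j \<sqsubseteq>\<^bsub>L\<^esub> x \<squnion>\<^bsub>L\<^esub> y \<Longrightarrow> x \<in> carrier L \<Longrightarrow> y \<in> carrier L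
    \<Longrightarrow> j \<sqsubseteq>\<^bsub>L\<^esub> x \<or> j \<sqsubseteq>\<^bsub>L\<^esub> y"
  by (auto simp: join_prime_def)

context finite_lattice
begin

lemma minimal_element:
  assumes "S \<subseteq> carrier L" "S \<noteq> {}"
  obtains m where "m \<in> S" "\<And>x. x \<in> S \<Longrightarrow> x \<sqsubseteq> m \<Longrightarrow> x = m"
proof -
  have "finite S" using assms(1) finite_carrier finite_subset by blast
  moreover have "asymp_on S (\<lambda>x y. x \<sqsubseteq> y \<and> x \<noteq> y)"
    using assms(1) by (auto simp: asymp_on_def dest: le_antisym)
  moreover have "transp_on S (\<lambda>x y. x \<sqsubseteq> y \<and> x \<noteq> y)"
  proof (rule transp_onI)
    fix x y z assume *: "x \<in> S" "y \<in> S" "z \<in> S" "x \<sqsubseteq> y \<and> x \<noteq> y" "y \<sqsubseteq> z \<and> y \<noteq> z"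
    then have C: "x \<in> carrier L" "y \<in> carrier L" "z \<in> carrier L" using assms(1) by auto
    then have "x \<sqsubseteq> z" using * le_trans by blast
    moreover have "x \<noteq> z" using * C le_antisym by blast
    ultimately show "x \<sqsubseteq> z \<and> x \<noteq> z" ..
  qed
  ultimately show ?thesis
    using Finite_Set.bex_min_element[of S "\<lambda>x y. x \<sqsubseteq> y \<and> x \<noteq> y"] assms(2) that by blast
qed

lemma finite_lattice_dual: "finite_lattice (inv_gorder L)"
  using dual_lattice finite_carrier carrier_nonempty
  by (simp add: finite_lattice_def finite_lattice_axioms_def)

lemma maximal_element:
  assumes "S \<subseteq> carrier L" "S \<noteq> {}"
  obtains m where "m \<in> S" "\<And>x. x \<in> S \<Longrightarrow> m \<sqsubseteq> x \<Longrightarrow> x = m"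
  using finite_lattice.minimal_element[OF finite_lattice_dual, of S] assms by auto

lemma least_exists: "\<exists>b\<in>carrier L. \<forall>x\<in>carrier L. b \<sqsubseteq> x"
proof -
  obtain b where b: "b \<in> carrier L" "\<And>x. x \<in> carrier L \<Longrightarrow> x \<sqsubseteq> b \<Longrightarrow> x = b"
    using minimal_element[of "carrier L"] carrier_nonempty by blast
  have "b \<sqsubseteq> x" if "x \<in> carrier L" for x
    using b that by (metis meet_closed meet_left meet_right)
  with b show ?thesis by blast
qed

lemma greatest_exists: "\<exists>t\<in>carrier L. \<forall>x\<in>carrier L. x \<sqsubseteq> t"
  using finite_lattice.least_exists[OF finite_lattice_dual] by auto

sublocale bounded_lattice L
proof
  show "\<exists>x. least L x (carrier L)"
    using least_exists by (auto simp: least_def)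
  show "\<exists>x. greatest L x (carrier L)"
    using greatest_exists by (auto simp: greatest_def)
qed

lemma join_reducibleI:
  assumes "u \<in> carrier L" "v \<in> carrier L" "\<not> u \<sqsubseteq> v" "\<not> v \<sqsubseteq> u"
  shows "u \<squnion> v \<in> join_reducibles L"
proof -
  have "u \<noteq> u \<squnion> v" "v \<noteq> u \<squnion> v" using assms join_left join_right by metis+
  then show ?thesis using assms unfolding join_reducibles_def by auto
qed

lemma join_reducibleE:
  assumes "r \<in> join_reducibles L"
  obtains u v where "u \<in> carrier L" "v \<in> carrier L" "r = u \<squnion> v"
    "\<not> u \<sqsubseteq> v" "\<not> v \<sqsubseteq> u" "u \<noteq> r" "v \<noteq> r"
  using assms unfolding join_reducibles_def
  by (smt (verit) join_absorb_left join_absorb_right mem_Collect_eq)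

lemma bottom_not_join_reducible: "\<bottom> \<notin> join_reducibles L"
proof
  assume "\<bottom> \<in> join_reducibles L"
  then obtain u v where "u \<in> carrier L" "v \<in> carrier L" "\<bottom> = u \<squnion> v" "u \<noteq> \<bottom>"
    using join_reducibleE by metis
  then show False using bottom_lower join_left le_antisym bottom_closed by metis
qed

lemma join_irreducible_carrier: "j \<in> join_irreducibles L \<Longrightarrow> j \<in> carrier L"
  by (simp add: join_irreducibles_def)

lemma finite_join_irreducibles: "finite (join_irreducibles L)"
  using finite_carrier by (simp add: join_irreducibles_def)

lemma finite_join_reducibles: "finite (join_reducibles L)"
  using finite_carrier by (simp add: join_reducibles_def)

lemma card_carrier:
  "card (carrier L) = 1 + card (join_irreducibles L) + card (join_reducibles L)"
proof -
  have sub: "join_reducibles L \<subseteq> carrier L" by (auto simp: join_reducibles_def)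
  have "carrier L = insert \<bottom> (join_irreducibles L \<union> join_reducibles L)"
    using sub by (auto simp: join_irreducibles_def)
  moreover have "\<bottom> \<notin> join_irreducibles L \<union> join_reducibles L"
    using bottom_not_join_reducible by (simp add: join_irreducibles_def)
  moreover have "join_irreducibles L \<inter> join_reducibles L = {}"
    by (auto simp: join_irreducibles_def)
  ultimately show ?thesis
    by (simp add: finite_join_irreducibles finite_join_reducibles card_Un_disjoint)
qed

text \<open>A minimal element among those below \<open>y\<close> and not below \<open>x\<close> is join-irreducible, because the
  parts of a proper join decomposition would both lie below \<open>x\<close>. All its strict
  predecessors lie below \<open>x\<close>, which is what turns the collapse of that element by a congruence into
  information about \<open>x\<close>.\<close>

lemma join_irreducible_separator:
  assumes "x \<in> carrier L" "y \<in> carrier L" "\<not> y \<sqsubseteq> x"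
  obtains j where "j \<in> join_irreducibles L" "j \<sqsubseteq> y" "\<not> j \<sqsubseteq> x"
    "\<And>z. z \<in> carrier L \<Longrightarrow> z \<sqsubseteq> j \<Longrightarrow> z \<noteq> j \<Longrightarrow> z \<sqsubseteq> x"
proof -
  let ?S = "{z \<in> carrier L. z \<sqsubseteq> y \<and> \<not> z \<sqsubseteq> x}"
  obtain j where j: "j \<in> ?S" "\<And>z. z \<in> ?S \<Longrightarrow> z \<sqsubseteq> j \<Longrightarrow> z = j"
    using minimal_element[of ?S] assms by blast
  have min: "z \<sqsubseteq> x" if "z \<in> carrier L" "z \<sqsubseteq> j" "z \<noteq> j" for z
    using j that assms(2) le_trans[of z j y] by blast
  have "j \<notin> join_reducibles L"
  proof
    assume "j \<in> join_reducibles L"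
    then obtain u v where "u \<in> carrier L" "v \<in> carrier L" "j = u \<squnion> v" "u \<noteq> j" "v \<noteq> j"
      using join_reducibleE by metis
    moreover from this have "u \<sqsubseteq> x" "v \<sqsubseteq> x" using min join_left join_right by auto
    ultimately show False using j(1) assms(1) by (simp add: join_le)
  qed
  moreover have "j \<noteq> \<bottom>" using j(1) assms(1) bottom_lower by auto
  ultimately have "j \<in> join_irreducibles L" using j(1) by (simp add: join_irreducibles_def)
  with j(1) min that show ?thesis by blast
qed

text \<open>The strict predecessors of a join-irreducible element are closed under joins, so a maximal one is
  the greatest.\<close>

lemma lower_cover:
  assumes "j \<in> join_irreducibles L"
  obtains x where "x \<in> carrier L" "x \<sqsubseteq> j" "x \<noteq> j"
    "\<And>z. z \<in> carrier L \<Longrightarrow> z \<sqsubseteq> j \<Longrightarrow> z \<noteq> j \<Longrightarrow> z \<sqsubseteq> x"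
proof -
  have j: "j \<in> carrier L" "j \<notin> join_reducibles L" "j \<noteq> \<bottom>"
    using assms by (auto simp: join_irreducibles_def)
  let ?S = "{z \<in> carrier L. z \<sqsubseteq> j \<and> z \<noteq> j}"
  have "\<bottom> \<in> ?S" using j by auto
  then obtain x where x: "x \<in> ?S" "\<And>z. z \<in> ?S \<Longrightarrow> x \<sqsubseteq> z \<Longrightarrow> z = x"
    using maximal_element[of ?S] by blast
  have "z \<sqsubseteq> x" if z: "z \<in> carrier L" "z \<sqsubseteq> j" "z \<noteq> j" for z
  proof -
    have "x \<squnion> z \<noteq> j" using j x(1) z by (auto simp: join_reducibles_def)
    then have "x \<squnion> z \<in> ?S" using x(1) z j(1) by (auto simp: join_le_iff)
    then show ?thesis using x z by (metis (no_types, lifting) join_left join_right mem_Collect_eq)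
  qed
  with x(1) that show ?thesis by blast
qed

end

section \<open>A congruence is determined by the join-irreducible elements that it collapses\<close>

context lattice
begin

lemma congruence_carrier:
  assumes "lattice_congruence L \<theta>" "(x, y) \<in> \<theta>"
  shows "x \<in> carrier L" "y \<in> carrier L"
  using assms by (auto simp: lattice_congruence_def equiv_def)

lemma congruence_refl:
  "lattice_congruence L \<theta> \<Longrightarrow> x \<in> carrier L \<Longrightarrow> (x, x) \<in> \<theta>"
  by (auto simp: lattice_congruence_def equiv_def refl_on_def)

lemma congruence_sym:
  "lattice_congruence L \<theta> \<Longrightarrow> (x, y) \<in> \<theta> \<Longrightarrow> (y, x) \<in> \<theta>"
  by (auto simp: lattice_congruence_def equiv_def dest: symD)

lemma congruence_trans:
  "lattice_congruence L \<theta> \<Longrightarrow> (x, y) \<in> \<theta> \<Longrightarrow> (y, z) \<in> \<theta> \<Longrightarrow> (x, z) \<in> \<theta>"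
  by (auto simp: lattice_congruence_def equiv_def dest: transD)

lemma congruence_join:
  "lattice_congruence L \<theta> \<Longrightarrow> (x, y) \<in> \<theta> \<Longrightarrow> z \<in> carrier L \<Longrightarrow> (z \<squnion> x, z \<squnion> y) \<in> \<theta>"
  by (meson congruence_refl lattice_congruence_def)

lemma congruence_meet:
  "lattice_congruence L \<theta> \<Longrightarrow> (x, y) \<in> \<theta> \<Longrightarrow> z \<in> carrier L \<Longrightarrow> (z \<sqinter> x, z \<sqinter> y) \<in> \<theta>"
  by (meson congruence_refl lattice_congruence_def)

lemma lattice_congruenceI:
  assumes "equiv (carrier L) \<theta>"
    and join: "\<And>x y z. (x, y) \<in> \<theta> \<Longrightarrow> z \<in> carrier L \<Longrightarrow> (z \<squnion> x, z \<squnion> y) \<in> \<theta>"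
    and meet: "\<And>x y z. (x, y) \<in> \<theta> \<Longrightarrow> z \<in> carrier L \<Longrightarrow> (z \<sqinter> x, z \<sqinter> y) \<in> \<theta>"
  shows "lattice_congruence L \<theta>"
proof -
  have tr: "(a, b) \<in> \<theta> \<Longrightarrow> (b, c) \<in> \<theta> \<Longrightarrow> (a, c) \<in> \<theta>" for a b c
    using assms(1) by (meson equivE transD)
  have ca: "(a, b) \<in> \<theta> \<Longrightarrow> a \<in> carrier L \<and> b \<in> carrier L" for a b
    using assms(1) by (auto simp: equiv_def)
  have "(a \<squnion> c, b \<squnion> d) \<in> \<theta> \<and> (a \<sqinter> c, b \<sqinter> d) \<in> \<theta>" if "(a, b) \<in> \<theta>" "(c, d) \<in> \<theta>" for a b c d
  proof -
    have C: "a \<in> carrier L" "b \<in> carrier L" "c \<in> carrier L" "d \<in> carrier L"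
      using that ca by auto
    have *: "(c \<squnion> a, c \<squnion> b) \<in> \<theta>" "(b \<squnion> c, b \<squnion> d) \<in> \<theta>"
      "(c \<sqinter> a, c \<sqinter> b) \<in> \<theta>" "(b \<sqinter> c, b \<sqinter> d) \<in> \<theta>"
      using that C join meet by auto
    then have "(a \<squnion> c, b \<squnion> c) \<in> \<theta>" "(a \<sqinter> c, b \<sqinter> c) \<in> \<theta>"
      by (simp_all add: join_comm[of L c] meet_comm[of L c])
    with * show ?thesis using tr by blast
  qed
  then show ?thesis using assms(1) by (auto simp: lattice_congruence_def)
qed

end

abbreviation (input) num_con :: "('a, 'r) gorder_scheme \<Rightarrow> nat"
  where "num_con L \<equiv> card (carrier (Con L))"

text \<open>Congruence classes are convex, so this says that \<open>\<theta>\<close> identifies \<open>j\<close> with its unique lower cover;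
  the existential form saves choosing that cover.\<close>

definition collapsed :: "('a, 'r) gorder_scheme \<Rightarrow> ('a \<times> 'a) set \<Rightarrow> 'a set"
  where "collapsed L \<theta> = {j \<in> join_irreducibles L.
    \<exists>z\<in>carrier L. z \<sqsubseteq>\<^bsub>L\<^esub> j \<and> z \<noteq> j \<and> (z, j) \<in> \<theta>}"

context finite_lattice
begin

text \<open>A congruence pair \<open>x \<sqsubseteq> y\<close> collapses every join-irreducible \<open>j\<close> below \<open>y\<close> but not below \<open>x\<close>,
  since \<open>j\<close> is identified with \<open>j \<sqinter> x\<close>. In turn, these collapses connect \<open>x\<close> to \<open>y\<close> step by step.\<close>

lemma congruence_subset_if_collapsed_subset:
  assumes \<theta>: "lattice_congruence L \<theta>" and \<phi>: "lattice_congruence L \<phi>"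
    and sub: "collapsed L \<theta> \<subseteq> collapsed L \<phi>"
  shows "\<theta> \<subseteq> \<phi>"
proof -
  \<comment> \<open>Climb from \<open>x\<close> to \<open>y\<close>, adding one minimal join-irreducible element below \<open>y\<close> at a time.\<close>
  have le: "(x, y) \<in> \<phi>" if "(x, y) \<in> \<theta>" "x \<sqsubseteq> y" for x y
    using that
  proof (induction "card {z \<in> carrier L. z \<sqsubseteq> y \<and> \<not> z \<sqsubseteq> x}" arbitrary: x rule: less_induct)
    case less
    have C: "x \<in> carrier L" "y \<in> carrier L" using \<theta> less.prems congruence_carrier by auto
    show ?case
    proof (cases "y \<sqsubseteq> x")
      case True
      then show ?thesis using C less.prems(2) congruence_refl[OF \<phi>] le_antisym by metis
    next
      case False
      obtain j where j: "j \<in> join_irreducibles L" "j \<sqsubseteq> y" "\<not> j \<sqsubseteq> x"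
        "\<And>z. z \<in> carrier L \<Longrightarrow> z \<sqsubseteq> j \<Longrightarrow> z \<noteq> j \<Longrightarrow> z \<sqsubseteq> x"
        using join_irreducible_separator[OF C False] by blast
      have jC: "j \<in> carrier L" using j(1) join_irreducible_carrier by blast
      have "(j \<sqinter> x, j) \<in> \<theta>"
        using congruence_meet[OF \<theta> less.prems(1) jC] meet_absorb_left[OF j(2)] jC C by simp
      moreover have "j \<sqinter> x \<noteq> j" using j(3) jC C meet_right by metis
      ultimately have "j \<in> collapsed L \<theta>"
        using j(1) jC C meet_left[of j x] unfolding collapsed_def by (auto intro!: bexI[of _ "j \<sqinter> x"])
      then obtain z where z: "z \<in> carrier L" "z \<sqsubseteq> j" "z \<noteq> j" "(z, j) \<in> \<phi>"
        using sub by (auto simp: collapsed_def)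
      have 1: "(x, x \<squnion> j) \<in> \<phi>"
        using congruence_join[OF \<phi> z(4) C(1)] join_absorb_left[OF j(4)[OF z(1-3)] C(1) z(1)] by simp
      have 2: "(x \<squnion> j, y) \<in> \<theta>"
        using congruence_join[OF \<theta> less.prems(1) jC] join_absorb_right[OF j(2) jC C(2)]
        by (simp add: join_comm)
      have "{z \<in> carrier L. z \<sqsubseteq> y \<and> \<not> z \<sqsubseteq> x \<squnion> j} \<subset> {z \<in> carrier L. z \<sqsubseteq> y \<and> \<not> z \<sqsubseteq> x}"
      proof
        show "{z \<in> carrier L. z \<sqsubseteq> y \<and> \<not> z \<sqsubseteq> x \<squnion> j} \<subseteq> {z \<in> carrier L. z \<sqsubseteq> y \<and> \<not> z \<sqsubseteq> x}"
          using C jC by (auto simp: join_le_iff dest: le_trans[OF _ join_left])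
        have "j \<in> {z \<in> carrier L. z \<sqsubseteq> y \<and> \<not> z \<sqsubseteq> x}" using j jC by blast
        moreover have "j \<notin> {z \<in> carrier L. z \<sqsubseteq> y \<and> \<not> z \<sqsubseteq> x \<squnion> j}"
          using C jC join_right by blast
        ultimately show "{z \<in> carrier L. z \<sqsubseteq> y \<and> \<not> z \<sqsubseteq> x \<squnion> j}
            \<noteq> {z \<in> carrier L. z \<sqsubseteq> y \<and> \<not> z \<sqsubseteq> x}" by blast
      qed
      then have "card {z \<in> carrier L. z \<sqsubseteq> y \<and> \<not> z \<sqsubseteq> x \<squnion> j}
          < card {z \<in> carrier L. z \<sqsubseteq> y \<and> \<not> z \<sqsubseteq> x}"
        using finite_carrier by (intro psubset_card_mono) auto
      moreover have "x \<squnion> j \<sqsubseteq> y" using join_le_iff C jC j less.prems by blast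
      ultimately have "(x \<squnion> j, y) \<in> \<phi>" using less.hyps 2 by blast
      with 1 show ?thesis using congruence_trans[OF \<phi>] by blast
    qed
  qed
  show ?thesis
  proof (rule subrelI)
    fix x y assume xy: "(x, y) \<in> \<theta>"
    have C: "x \<in> carrier L" "y \<in> carrier L" using \<theta> xy congruence_carrier by auto
    have "(x, x \<squnion> y) \<in> \<theta>"
      using congruence_join[OF \<theta> xy C(1)] join_absorb_left[of x x] C by simp
    moreover have "(y, x \<squnion> y) \<in> \<theta>"
      using congruence_join[OF \<theta> congruence_sym[OF \<theta> xy] C(2)] join_absorb_left[of y y] C
      by (simp add: join_comm)
    ultimately have "(x, x \<squnion> y) \<in> \<phi>" "(y, x \<squnion> y) \<in> \<phi>"
      using le C join_left join_right by blast+
    then show "(x, y) \<in> \<phi>" using congruence_trans[OF \<phi>] congruence_sym[OF \<phi>] by blast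
  qed
qed

lemma inj_on_collapsed: "inj_on (collapsed L) (carrier (Con L))"
  by (rule inj_onI) (simp add: Con_def congruence_subset_if_collapsed_subset subset_antisym)

lemma collapsed_subset: "collapsed L \<theta> \<subseteq> join_irreducibles L"
  by (auto simp: collapsed_def)

lemma finite_Con: "finite (carrier (Con L))"
  using inj_on_finite[OF inj_on_collapsed, of "Pow (join_irreducibles L)"]
    collapsed_subset finite_join_irreducibles by blast

text \<open>Inside \<open>K\<close> a set of collapsed elements has at most \<open>g\<close> traces, outside \<open>K\<close> it is arbitrary.\<close>

lemma card_Con_le:
  assumes K: "K \<subseteq> join_irreducibles L" "card K = k" and G: "finite G" "card G \<le> g"
    and trace: "\<And>\<theta>. lattice_congruence L \<theta> \<Longrightarrow> collapsed L \<theta> \<inter> K \<in> G"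
  shows "num_con L \<le> g * 2 ^ (card (join_irreducibles L) - k)"
    and "k \<le> card (join_irreducibles L)"
proof -
  let ?J = "join_irreducibles L"
  let ?f = "\<lambda>\<theta>. (collapsed L \<theta> \<inter> K, collapsed L \<theta> - K)"
  have "inj_on ?f (carrier (Con L))"
  proof (rule inj_onI)
    fix \<theta> \<phi> assume *: "\<theta> \<in> carrier (Con L)" "\<phi> \<in> carrier (Con L)" "?f \<theta> = ?f \<phi>"
    then have "collapsed L \<theta> = collapsed L \<phi>" by blast
    with * show "\<theta> = \<phi>" using inj_on_collapsed by (auto dest: inj_onD)
  qed
  moreover have "?f ` carrier (Con L) \<subseteq> G \<times> Pow (?J - K)"
    using trace collapsed_subset by (auto simp: Con_def)
  ultimately have "num_con L \<le> card (G \<times> Pow (?J - K))"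
    using G(1) finite_join_irreducibles by (intro card_inj_on_le) auto
  also have "\<dots> = card G * 2 ^ (card ?J - k)"
    using finite_join_irreducibles K
    by (simp add: card_cartesian_product card_Pow card_Diff_subset finite_subset)
  also have "\<dots> \<le> g * 2 ^ (card ?J - k)" using G(2) by simp
  finally show "num_con L \<le> g * 2 ^ (card ?J - k)" .
  show "k \<le> card ?J" using card_mono[OF finite_join_irreducibles K(1)] K(2) by simp
qed

end

section \<open>Join-prime elements and the size of the congruence lattice\<close>

text \<open>The kernel of the map \<open>x \<mapsto> {t \<in> T. t \<sqsubseteq> x}\<close>.\<close>

definition indistinguishable :: "('a, 'r) gorder_scheme \<Rightarrow> 'a set \<Rightarrow> ('a \<times> 'a) set"
  where "indistinguishable L T = {(x, y). x \<in> carrier L \<and> y \<in> carrier L \<and>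
    (\<forall>t\<in>T. t \<sqsubseteq>\<^bsub>L\<^esub> x \<longleftrightarrow> t \<sqsubseteq>\<^bsub>L\<^esub> y)}"

context finite_lattice
begin

lemma join_prime_le_join_iff:
  assumes "join_prime L t" "t \<in> carrier L" "x \<in> carrier L" "y \<in> carrier L"
  shows "t \<sqsubseteq> x \<squnion> y \<longleftrightarrow> t \<sqsubseteq> x \<or> t \<sqsubseteq> y"
proof
  assume "t \<sqsubseteq> x \<or> t \<sqsubseteq> y"
  then show "t \<sqsubseteq> x \<squnion> y"
  proof
    assume "t \<sqsubseteq> x" then show ?thesis
      using assms le_trans[OF _ join_left, of t x y] by simp
  next
    assume "t \<sqsubseteq> y" then show ?thesis
      using assms le_trans[OF _ join_right, of t y x] by simp
  qed
next
  assume "t \<sqsubseteq> x \<squnion> y"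
  then show "t \<sqsubseteq> x \<or> t \<sqsubseteq> y" using join_primeD[OF assms(1)] assms(3,4) by simp
qed

text \<open>For a join-prime \<open>t\<close>, the truth value of \<open>t \<sqsubseteq> x\<close> is a homomorphism to the two-element chain.\<close>

lemma indistinguishable_congruence:
  assumes "T \<subseteq> carrier L" "\<And>t. t \<in> T \<Longrightarrow> join_prime L t"
  shows "lattice_congruence L (indistinguishable L T)"
proof (rule lattice_congruenceI)
  show "equiv (carrier L) (indistinguishable L T)"
    by (rule equivI) (auto simp: indistinguishable_def refl_on_def sym_def trans_def)
next
  fix x y z assume *: "(x, y) \<in> indistinguishable L T" "z \<in> carrier L"
  have "t \<sqsubseteq> z \<squnion> w \<longleftrightarrow> t \<sqsubseteq> z \<or> t \<sqsubseteq> w" if "t \<in> T" "w \<in> carrier L" for t w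
    using that assms *(2) by (intro join_prime_le_join_iff) auto
  then show "(z \<squnion> x, z \<squnion> y) \<in> indistinguishable L T"
    using * by (auto simp: indistinguishable_def)
  have "t \<sqsubseteq> z \<sqinter> w \<longleftrightarrow> t \<sqsubseteq> z \<and> t \<sqsubseteq> w" if "t \<in> T" "w \<in> carrier L" for t w
    using that assms *(2) le_meet_iff by auto
  then show "(z \<sqinter> x, z \<sqinter> y) \<in> indistinguishable L T"
    using * by (auto simp: indistinguishable_def)
qed

lemma lower_cover_indistinguishable:
  assumes "j \<in> join_irreducibles L" "T \<subseteq> carrier L" "j \<notin> T"
  obtains x where "x \<in> carrier L" "x \<sqsubseteq> j" "x \<noteq> j" "(x, j) \<in> indistinguishable L T"
proof -
  have j: "j \<in> carrier L" using assms(1) join_irreducible_carrier by blast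
  obtain x where x: "x \<in> carrier L" "x \<sqsubseteq> j" "x \<noteq> j"
    "\<And>z. z \<in> carrier L \<Longrightarrow> z \<sqsubseteq> j \<Longrightarrow> z \<noteq> j \<Longrightarrow> z \<sqsubseteq> x"
    using lower_cover[OF assms(1)] by blast
  have "t \<sqsubseteq> x \<longleftrightarrow> t \<sqsubseteq> j" if "t \<in> T" for t
  proof
    assume "t \<sqsubseteq> x"
    then show "t \<sqsubseteq> j" using le_trans[of t x j] x(1,2) j that assms(2) by auto
  next
    assume "t \<sqsubseteq> j"
    moreover have "t \<in> carrier L" "t \<noteq> j" using that assms(2,3) by auto
    ultimately show "t \<sqsubseteq> x" using x(4) by simp
  qed
  with x j that show ?thesis by (auto simp: indistinguishable_def)
qed

text \<open>Membership of \<open>j\<close> in the set can be read off from the relation: it is the question whether \<open>j\<close>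
  is separated from its lower cover.\<close>

lemma inj_on_indistinguishable: "inj_on (indistinguishable L) (Pow (join_irreducibles L))"
proof (rule inj_onI)
  have le: "S \<subseteq> T" if st: "S \<subseteq> join_irreducibles L" "T \<subseteq> join_irreducibles L"
    "indistinguishable L S = indistinguishable L T" for S T
  proof (rule ccontr)
    assume "\<not> S \<subseteq> T"
    then obtain j where j: "j \<in> S" "j \<notin> T" by blast
    have jJ: "j \<in> join_irreducibles L" using st(1) j(1) by blast
    have jC: "j \<in> carrier L" "T \<subseteq> carrier L"
      using jJ st(2) join_irreducible_carrier by auto
    obtain x where x: "x \<in> carrier L" "x \<sqsubseteq> j" "x \<noteq> j" "(x, j) \<in> indistinguishable L S"
      using lower_cover_indistinguishable[OF jJ jC(2) j(2)] st(3) by metis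
    then have "j \<sqsubseteq> x" using j(1) jC(1) by (auto simp: indistinguishable_def)
    then show False using x jC le_antisym by blast
  qed
  fix S T
  assume "S \<in> Pow (join_irreducibles L)" "T \<in> Pow (join_irreducibles L)"
    "indistinguishable L S = indistinguishable L T"
  then show "S = T" using le[of S T] le[of T S] by auto
qed

lemma card_Con_le_power: "num_con L \<le> 2 ^ card (join_irreducibles L)"
  using card_Con_le(1)[of "{}" 0 "{{}}" 1] by simp

lemma indistinguishable_image:
  assumes P: "P \<subseteq> join_irreducibles L" "\<And>j. j \<in> P \<Longrightarrow> join_prime L j"
  shows "indistinguishable L ` Pow P \<subseteq> carrier (Con L)"
    and "card (indistinguishable L ` Pow P) = 2 ^ card P"
proof -
  show "indistinguishable L ` Pow P \<subseteq> carrier (Con L)"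
  proof (rule image_subsetI)
    fix T assume T: "T \<in> Pow P"
    then have "T \<subseteq> carrier L" using P(1) join_irreducible_carrier by blast
    then show "indistinguishable L T \<in> carrier (Con L)"
      using T P(2) indistinguishable_congruence[of T] by (auto simp: Con_def)
  qed
  have "inj_on (indistinguishable L) (Pow P)"
    using inj_on_indistinguishable P(1) by (meson Pow_mono inj_on_subset)
  then show "card (indistinguishable L ` Pow P) = 2 ^ card P"
    using finite_subset[OF P(1) finite_join_irreducibles] by (simp add: card_image card_Pow)
qed

lemma card_Con_if_all_join_prime:
  assumes "\<And>j. j \<in> join_irreducibles L \<Longrightarrow> join_prime L j"
  shows "num_con L = 2 ^ card (join_irreducibles L)"
proof (rule order.antisym[OF card_Con_le_power])
  show "2 ^ card (join_irreducibles L) \<le> num_con L"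
    using indistinguishable_image[of "join_irreducibles L"] assms
      card_mono[OF finite_Con, of "indistinguishable L ` Pow (join_irreducibles L)"] by simp
qed

text \<open>The congruences coming from subsets of \<open>P\<close> all collapse the remaining join-irreducible
  elements, so the identity congruence is an additional one.\<close>

lemma power_card_join_primes_less_card_Con:
  assumes P: "P \<subset> join_irreducibles L" "\<And>j. j \<in> P \<Longrightarrow> join_prime L j"
  shows "2 ^ card P < num_con L"
proof -
  obtain j where j: "j \<in> join_irreducibles L" "j \<notin> P" using P(1) by blast
  have "Id_on (carrier L) \<notin> indistinguishable L ` Pow P"
  proof
    assume "Id_on (carrier L) \<in> indistinguishable L ` Pow P"
    then obtain T where T: "T \<subseteq> P" "Id_on (carrier L) = indistinguishable L T" by blast
    then have "T \<subseteq> carrier L" "j \<notin> T" using P(1) j(2) join_irreducible_carrier by blast+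
    then obtain x where "x \<noteq> j" "(x, j) \<in> Id_on (carrier L)"
      using lower_cover_indistinguishable[OF j(1)] T(2) by metis
    then show False by auto
  qed
  moreover have "lattice_congruence L (Id_on (carrier L))"
    by (rule lattice_congruenceI) (auto intro!: equivI simp: refl_on_def sym_def trans_def)
  then have "Id_on (carrier L) \<in> carrier (Con L)" by (simp add: Con_def)
  moreover note image = indistinguishable_image[OF psubset_imp_subset[OF P(1)] P(2)]
  ultimately have "indistinguishable L ` Pow P \<subset> carrier (Con L)" by blast
  then show ?thesis using psubset_card_mono[OF finite_Con] image(2) by metis
qed

subsection \<open>How the collapse of one join-irreducible element forces others\<close>

text \<open>Meeting the pair \<open>(y, r)\<close> with \<open>e\<close> identifies \<open>e\<close> with \<open>e \<sqinter> y\<close>, which is strictly smaller.\<close>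

lemma collapsed_below:
  assumes \<theta>: "lattice_congruence L \<theta>" and "(y, r) \<in> \<theta>"
    and "e \<in> join_irreducibles L" "e \<sqsubseteq> r" "\<not> e \<sqsubseteq> y"
  shows "e \<in> collapsed L \<theta>"
proof -
  have C: "e \<in> carrier L" "y \<in> carrier L" "r \<in> carrier L"
    using assms congruence_carrier join_irreducible_carrier by auto
  have "(e \<sqinter> y, e) \<in> \<theta>"
    using congruence_meet[OF \<theta> assms(2) C(1)] meet_absorb_left[OF assms(4)] C by simp
  moreover have "e \<sqinter> y \<noteq> e" using C assms(5) meet_right by metis
  ultimately show ?thesis
    using assms(3) C meet_left[of e y] by (auto simp: collapsed_def intro!: bexI[of _ "e \<sqinter> y"])
qed

text \<open>If \<open>w\<close> is the smaller element that \<open>a\<close> is identified with, joining with \<open>y\<close> and then with \<open>z\<close>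
  moves \<open>w\<close> to \<open>z\<close> and \<open>a\<close> to \<open>y \<squnion> a\<close>.\<close>

lemma collapse_join:
  assumes \<theta>: "lattice_congruence L \<theta>" and "a \<in> collapsed L \<theta>"
    and y: "y \<in> carrier L" and z: "z \<in> carrier L"
    and below: "\<And>w. w \<in> carrier L \<Longrightarrow> w \<sqsubseteq> a \<Longrightarrow> w \<noteq> a \<Longrightarrow> y \<squnion> w \<sqsubseteq> z"
    and "y \<sqsubseteq> z" "z \<sqsubseteq> y \<squnion> a"
  shows "(z, y \<squnion> a) \<in> \<theta>"
proof -
  obtain w where w: "w \<in> carrier L" "w \<sqsubseteq> a" "w \<noteq> a" "(w, a) \<in> \<theta>" "a \<in> carrier L"
    using assms(2) join_irreducible_carrier by (auto simp: collapsed_def)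
  have "(z \<squnion> (y \<squnion> w), z \<squnion> (y \<squnion> a)) \<in> \<theta>"
    using congruence_join[OF \<theta> congruence_join[OF \<theta> w(4) y] z] .
  then show ?thesis
    using below w y z assms(7) join_absorb_left[of "y \<squnion> w" z] join_absorb_right[of z "y \<squnion> a"]
    by simp
qed

text \<open>A join-irreducible element that fails to be join-prime depends on another one: if
  \<open>j \<sqsubseteq> x \<squnion> y\<close> with \<open>x\<close> minimal, then \<open>x\<close> is join-irreducible, and collapsing \<open>x\<close> moves
  \<open>x \<squnion> y\<close> to an element that is no longer above \<open>j\<close>.\<close>

lemma collapse_dependency:
  assumes "j \<in> join_irreducibles L" "\<not> join_prime L j"
  obtains i where "i \<in> join_irreducibles L" "i \<noteq> j"
    "\<And>\<theta>. lattice_congruence L \<theta> \<Longrightarrow> i \<in> collapsed L \<theta> \<Longrightarrow> j \<in> collapsed L \<theta>"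
proof -
  have j: "j \<in> carrier L" using assms(1) join_irreducible_carrier by blast
  define P where "P x y \<longleftrightarrow> y \<in> carrier L \<and> j \<sqsubseteq> x \<squnion> y \<and> \<not> j \<sqsubseteq> x \<and> \<not> j \<sqsubseteq> y" for x y
  define S where "S = {x \<in> carrier L. \<exists>y. P x y}"
  have SI: "z \<in> S" if "P z w" "z \<in> carrier L" for z w using that by (auto simp: S_def)
  have "S \<subseteq> carrier L" "S \<noteq> {}"
    using assms(2) by (auto simp: S_def P_def join_prime_def)
  then obtain x where "x \<in> S" and min: "\<And>z. z \<in> S \<Longrightarrow> z \<sqsubseteq> x \<Longrightarrow> z = x"
    using minimal_element by metis
  then obtain y where x: "x \<in> carrier L" and Pxy: "P x y" unfolding S_def by blast
  have yC: "y \<in> carrier L" and P: "j \<sqsubseteq> x \<squnion> y" "\<not> j \<sqsubseteq> x" "\<not> j \<sqsubseteq> y"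
    using Pxy by (auto simp: P_def)
  have "x \<notin> join_reducibles L"
  proof
    assume "x \<in> join_reducibles L"
    then obtain u v where uv: "u \<in> carrier L" "v \<in> carrier L" "x = u \<squnion> v" "u \<noteq> x" "v \<noteq> x"
      using join_reducibleE by metis
    have le: "u \<sqsubseteq> x" "v \<sqsubseteq> x" using uv join_left join_right by auto
    have nle: "\<not> j \<sqsubseteq> u" "\<not> j \<sqsubseteq> v"
      using le_trans[of j u x] le_trans[of j v x] le P(2) j uv(1,2) x by auto
    have "x \<squnion> y = u \<squnion> (v \<squnion> y)"
      using uv yC weak_join_assoc by (simp add: eq_is_equal)
    then have "j \<sqsubseteq> u \<squnion> (v \<squnion> y)" using P(1) by simp
    moreover have "\<not> P u (v \<squnion> y)" using min[OF SI] le(1) uv(1,4) by blast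
    ultimately have "j \<sqsubseteq> v \<squnion> y" using nle uv yC by (auto simp: P_def)
    then have "P v y" using nle P(3) yC by (simp add: P_def)
    then show False using min[OF SI] le(2) uv(2,5) by blast
  qed
  moreover have "x \<noteq> \<bottom>"
    using P yC join_absorb_right[of \<bottom> y] bottom_lower[OF yC] bottom_closed by auto
  ultimately have xJ: "x \<in> join_irreducibles L" using x by (simp add: join_irreducibles_def)
  have "x \<noteq> j" using P(2) j by auto
  moreover have "j \<in> collapsed L \<theta>" if \<theta>: "lattice_congruence L \<theta>" and c: "x \<in> collapsed L \<theta>" for \<theta>
  proof -
    obtain z where z: "z \<in> carrier L" "z \<sqsubseteq> x" "z \<noteq> x" "(z, x) \<in> \<theta>"
      using c by (auto simp: collapsed_def)
    have "\<not> j \<sqsubseteq> z" using le_trans[of j z x] z x j P by auto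
    moreover have "\<not> P z y" using min[OF SI] z by blast
    ultimately have "\<not> j \<sqsubseteq> z \<squnion> y" using P yC by (simp add: P_def)
    moreover have "(z \<squnion> y, x \<squnion> y) \<in> \<theta>"
      using congruence_join[OF \<theta> z(4) yC] by (simp add: join_comm[of L y])
    ultimately show ?thesis using collapsed_below[OF \<theta> _ assms(1) P(1)] by blast
  qed
  ultimately show ?thesis using that xJ by blast
qed

text \<open>Of the four conceivable traces on the two elements of a dependency, \<open>{i}\<close> does not occur.\<close>

lemma card_Con_le_if_not_join_prime:
  assumes "j \<in> join_irreducibles L" "\<not> join_prime L j"
  shows "num_con L \<le> 3 * 2 ^ (card (join_irreducibles L) - 2)"
    and "2 \<le> card (join_irreducibles L)"
proof -
  obtain i where i: "i \<in> join_irreducibles L" "i \<noteq> j"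
    "\<And>\<theta>. lattice_congruence L \<theta> \<Longrightarrow> i \<in> collapsed L \<theta> \<Longrightarrow> j \<in> collapsed L \<theta>"
    using collapse_dependency[OF assms] by blast
  have trace: "collapsed L \<theta> \<inter> {i, j} \<in> {{}, {j}, {i, j}}" if "lattice_congruence L \<theta>" for \<theta>
    using i(3)[OF that] by auto
  have "{i, j} \<subseteq> join_irreducibles L" "card {i, j} = 2" "card {{}, {j}, {i, j}} \<le> 3"
    using i assms by auto
  then show "num_con L \<le> 3 * 2 ^ (card (join_irreducibles L) - 2)"
    and "2 \<le> card (join_irreducibles L)"
    using card_Con_le[of "{i, j}" 2 "{{}, {j}, {i, j}}" 3] trace by auto
qed

end

section \<open>Lattices with exactly one join-reducible element\<close>

definition down :: "('a, 'r) gorder_scheme \<Rightarrow> 'a \<Rightarrow> 'a set"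
  where "down L p = {x \<in> carrier L. x \<sqsubseteq>\<^bsub>L\<^esub> p}"

definition up :: "('a, 'r) gorder_scheme \<Rightarrow> 'a \<Rightarrow> 'a set"
  where "up L p = {x \<in> carrier L. p \<sqsubseteq>\<^bsub>L\<^esub> x}"

definition totally_ordered :: "('a, 'r) gorder_scheme \<Rightarrow> 'a set \<Rightarrow> bool"
  where "totally_ordered L S \<longleftrightarrow> (\<forall>x\<in>S. \<forall>y\<in>S. x \<sqsubseteq>\<^bsub>L\<^esub> y \<or> y \<sqsubseteq>\<^bsub>L\<^esub> x)"

text \<open>The pentagon is \<open>p < y < z < r\<close> and \<open>p < x < r\<close>. The two negated relations make \<open>x\<close>
  incomparable to \<open>y\<close> and \<open>z\<close> and force the remaining inequalities, except for \<open>y \<noteq> z\<close>, to be strict.\<close>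

definition pentagon_between_chains ::
    "('a, 'r) gorder_scheme \<Rightarrow> 'a \<Rightarrow> 'a \<Rightarrow> 'a \<Rightarrow> 'a \<Rightarrow> 'a \<Rightarrow> bool"
  where "pentagon_between_chains L p x y z r \<longleftrightarrow>
    {p, x, y, z, r} \<subseteq> carrier L \<and> p \<sqsubseteq>\<^bsub>L\<^esub> x \<and> p \<sqsubseteq>\<^bsub>L\<^esub> y \<and> y \<sqsubseteq>\<^bsub>L\<^esub> z \<and> x \<sqsubseteq>\<^bsub>L\<^esub> r \<and> z \<sqsubseteq>\<^bsub>L\<^esub> r \<and>
    \<not> x \<sqsubseteq>\<^bsub>L\<^esub> z \<and> \<not> y \<sqsubseteq>\<^bsub>L\<^esub> x \<and> y \<noteq> z \<and>
    carrier L = down L p \<union> {x, y, z} \<union> up L r \<and>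
    totally_ordered L (down L p) \<and> totally_ordered L (up L r)"

locale one_join_reducible = finite_lattice +
  fixes r
  assumes join_reducibles_eq: "join_reducibles L = {r}"
begin

lemma r_carrier: "r \<in> carrier L"
  using join_reducibles_eq by (auto simp: join_reducibles_def)

lemma incomparable_join:
  assumes "x \<in> carrier L" "y \<in> carrier L" "\<not> x \<sqsubseteq> y" "\<not> y \<sqsubseteq> x"
  shows "x \<squnion> y = r"
  using join_reducibleI[OF assms] join_reducibles_eq by blast

lemma incomparable_below:
  assumes "x \<in> carrier L" "y \<in> carrier L" "\<not> x \<sqsubseteq> y" "\<not> y \<sqsubseteq> x"
  shows "x \<sqsubseteq> r" "x \<noteq> r" "y \<sqsubseteq> r" "y \<noteq> r"
  using incomparable_join[OF assms] join_left[of x y] join_right[of x y] assms by auto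

text \<open>The elements strictly below \<open>r\<close> form a tree growing upwards: two incomparable elements have
  join \<open>r\<close> and hence no common upper bound among them.\<close>

lemma comparable_below:
  assumes "z \<sqsubseteq> r" "z \<noteq> r" "x \<sqsubseteq> z" "y \<sqsubseteq> z" "x \<in> carrier L" "y \<in> carrier L" "z \<in> carrier L"
  shows "x \<sqsubseteq> y \<or> y \<sqsubseteq> x"
proof (rule ccontr)
  assume "\<not> ?thesis"
  then have "x \<squnion> y = r" using incomparable_join assms by blast
  then have "r \<sqsubseteq> z" using join_le assms by metis
  then show False using assms r_carrier le_antisym by blast
qed

lemma comparable_r: "x \<in> carrier L \<Longrightarrow> x \<sqsubseteq> r \<or> r \<sqsubseteq> x"
  using incomparable_below r_carrier by blast

lemma totally_ordered_up: "totally_ordered L (up L r)"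
  unfolding totally_ordered_def up_def
  using incomparable_below r_carrier le_antisym by blast

lemma join_irreducible_not_r: "j \<in> join_irreducibles L \<Longrightarrow> j \<noteq> r"
  using join_reducibles_eq by (auto simp: join_irreducibles_def)

text \<open>Two incomparable elements with the same strict predecessors: the feet of the two branches
  that meet again in \<open>r\<close>.\<close>

definition fork :: "'a \<Rightarrow> 'a \<Rightarrow> bool"
  where "fork a b \<longleftrightarrow> a \<in> join_irreducibles L \<and> b \<in> join_irreducibles L \<and>
    \<not> a \<sqsubseteq> b \<and> \<not> b \<sqsubseteq> a \<and>
    (\<forall>z\<in>carrier L. z \<sqsubseteq> a \<longrightarrow> z \<noteq> a \<longrightarrow> z \<sqsubseteq> b) \<and>
    (\<forall>z\<in>carrier L. z \<sqsubseteq> b \<longrightarrow> z \<noteq> b \<longrightarrow> z \<sqsubseteq> a)"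

definition inner :: "'a \<Rightarrow> 'a \<Rightarrow> 'a set"
  where "inner a b = {e \<in> join_irreducibles L. e \<sqsubseteq> r \<and> \<not> e \<sqsubseteq> a \<and> \<not> e \<sqsubseteq> b}"

lemma fork_sym: "fork a b \<Longrightarrow> fork b a"
  by (auto simp: fork_def)

lemma inner_sym: "inner a b = inner b a"
  by (auto simp: inner_def)

text \<open>Starting from incomparable \<open>x\<close> and \<open>y\<close>, take \<open>a\<close> minimal below \<open>x\<close> and not below \<open>y\<close>, and then \<open>b\<close>
  minimal below \<open>y\<close> and not below \<open>a\<close>. The tree property shows that all predecessors of \<open>a\<close>
  are below \<open>b\<close>.\<close>

lemma fork_exists: obtains a b where "fork a b"
proof -
  obtain x y where xy: "x \<in> carrier L" "y \<in> carrier L" "r = x \<squnion> y"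
    "\<not> x \<sqsubseteq> y" "\<not> y \<sqsubseteq> x" "x \<noteq> r" "y \<noteq> r"
    using join_reducibleE[of r] join_reducibles_eq by blast
  have yr: "y \<sqsubseteq> r" using xy join_right by simp
  obtain a where a: "a \<in> join_irreducibles L" "a \<sqsubseteq> x" "\<not> a \<sqsubseteq> y"
    "\<And>z. z \<in> carrier L \<Longrightarrow> z \<sqsubseteq> a \<Longrightarrow> z \<noteq> a \<Longrightarrow> z \<sqsubseteq> y"
    using join_irreducible_separator[OF xy(2,1,4)] by metis
  have aC: "a \<in> carrier L" using a(1) join_irreducible_carrier by simp
  have "\<not> y \<sqsubseteq> a" using le_trans[of y a x] a(2) aC xy by auto
  then obtain b where b: "b \<in> join_irreducibles L" "b \<sqsubseteq> y" "\<not> b \<sqsubseteq> a"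
    "\<And>z. z \<in> carrier L \<Longrightarrow> z \<sqsubseteq> b \<Longrightarrow> z \<noteq> b \<Longrightarrow> z \<sqsubseteq> a"
    using join_irreducible_separator[OF aC xy(2)] by metis
  have bC: "b \<in> carrier L" using b(1) join_irreducible_carrier by simp
  have "\<not> a \<sqsubseteq> b" using le_trans[of a b y] a(3) b(2) aC bC xy by auto
  moreover have "z \<sqsubseteq> b" if z: "z \<in> carrier L" "z \<sqsubseteq> a" "z \<noteq> a" for z
  proof -
    have "z \<sqsubseteq> b \<or> b \<sqsubseteq> z"
      using comparable_below[of y z b] a(4)[OF z] b(2) yr xy(2,7) z(1) bC by blast
    then show ?thesis using le_trans[of b z a] z aC bC b(3) by auto
  qed
  ultimately have "fork a b" using a(1) b(1,3,4) by (auto simp: fork_def)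
  with that show ?thesis .
qed

context
  fixes a b
  assumes fork: "fork a b"
begin

lemma fork_carrier: "a \<in> carrier L" "b \<in> carrier L"
  using fork join_irreducible_carrier by (auto simp: fork_def)

lemma fork_join: "a \<squnion> b = r"
  using fork fork_carrier incomparable_join by (auto simp: fork_def)

lemma fork_below: "a \<sqsubseteq> r" "a \<noteq> r" "b \<sqsubseteq> r" "b \<noteq> r"
  using fork fork_carrier incomparable_below[of a b] by (auto simp: fork_def)

text \<open>Everything strictly below \<open>a\<close> is absorbed by \<open>b\<close>, whereas \<open>b \<squnion> a = r\<close>.\<close>

lemma fork_collapse:
  assumes \<theta>: "lattice_congruence L \<theta>" and "a \<in> collapsed L \<theta>"
  shows "(b, r) \<in> \<theta>"
proof -
  have "(b, b \<squnion> a) \<in> \<theta>"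
    using \<theta> assms(2)
  proof (rule collapse_join)
    fix w assume "w \<in> carrier L" "w \<sqsubseteq> a" "w \<noteq> a"
    then show "b \<squnion> w \<sqsubseteq> b" using fork fork_carrier by (simp add: fork_def join_le_iff)
  qed (use fork_carrier join_left in auto)
  then show ?thesis using fork_join by (simp add: join_comm)
qed

lemma fork_collapse_inner:
  assumes "lattice_congruence L \<theta>" "a \<in> collapsed L \<theta>" "e \<in> inner a b"
  shows "e \<in> collapsed L \<theta>"
  using collapsed_below[OF assms(1) fork_collapse[OF assms(1,2)]] assms(3)
  by (simp add: inner_def)

lemma below_r_cases:
  assumes "z \<in> carrier L" "z \<sqsubseteq> r" "z \<noteq> r"
  shows "z \<sqsubseteq> a \<or> z \<sqsubseteq> b \<or> z \<in> inner a b"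
proof (cases "z = \<bottom>")
  case True
  then show ?thesis using fork_carrier bottom_lower by simp
next
  case False
  then have "z \<in> join_irreducibles L"
    using assms join_reducibles_eq by (simp add: join_irreducibles_def)
  then show ?thesis using assms by (auto simp: inner_def)
qed

end

text \<open>Without inner elements everything strictly below \<open>r\<close> lies below one of the feet. As the feet have
  the same strict predecessors, they are the only two incomparable elements, and whatever is strictly
  below their join lies below one of them.\<close>

lemma join_prime_if_inner_empty:
  assumes fork: "fork a b" and empty: "inner a b = {}" and j: "j \<in> join_irreducibles L"
  shows "join_prime L j"
proof (rule ccontr)
  assume "\<not> join_prime L j"
  then obtain u v where uv: "u \<in> carrier L" "v \<in> carrier L" "j \<sqsubseteq> u \<squnion> v" "\<not> j \<sqsubseteq> u" "\<not> j \<sqsubseteq> v"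
    by (auto simp: join_prime_def)
  have jC: "j \<in> carrier L" using j join_irreducible_carrier by simp
  note C = fork_carrier[OF fork] and below = fork_below[OF fork]
  have inc: "\<not> u \<sqsubseteq> v" "\<not> v \<sqsubseteq> u"
    using uv join_absorb_left join_absorb_right by metis+
  have jr: "j \<sqsubseteq> r" "j \<noteq> r"
    using uv(3) incomparable_join[OF uv(1,2) inc] join_irreducible_not_r[OF j] by auto
  \<comment> \<open>If \<open>j\<close> lies below the foot \<open>a'\<close>, then an element not above \<open>j\<close> that lies below \<open>a'\<close> does so
    strictly and hence lies below \<open>b'\<close> as well; so both \<open>u'\<close> and \<open>v'\<close> lie below \<open>b'\<close>.\<close>
  have absurd: False
    if f: "fork a' b'" and E: "inner a' b' = {}" and ja: "j \<sqsubseteq> a'"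
      and u': "u' \<in> carrier L" "\<not> j \<sqsubseteq> u'" "u' \<sqsubseteq> r" "u' \<noteq> r"
      and v': "v' \<in> carrier L" "\<not> j \<sqsubseteq> v'" "v' \<sqsubseteq> r" "v' \<noteq> r"
      and i: "\<not> u' \<sqsubseteq> v'" "\<not> v' \<sqsubseteq> u'" for a' b' u' v'
  proof -
    note C' = fork_carrier[OF f] and below' = fork_below[OF f]
    have strict: "w \<sqsubseteq> b'" if w: "w \<in> carrier L" "w \<sqsubseteq> a'" "\<not> j \<sqsubseteq> w" for w
      using f w ja by (auto simp: fork_def)
    have "u' \<sqsubseteq> a' \<or> u' \<sqsubseteq> b'" "v' \<sqsubseteq> a' \<or> v' \<sqsubseteq> b'"
      using below_r_cases[OF f u'(1,3,4)] below_r_cases[OF f v'(1,3,4)] E by auto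
    then have "u' \<sqsubseteq> b'" "v' \<sqsubseteq> b'"
      using strict[OF u'(1) _ u'(2)] strict[OF v'(1) _ v'(2)] by auto
    then show False
      using comparable_below[OF below'(3,4) _ _ u'(1) v'(1) C'(2)] i by auto
  qed
  have empty': "inner b a = {}" using empty by (simp add: inner_sym[of b a])
  note uvr = incomparable_below[OF uv(1,2) inc]
  have "j \<sqsubseteq> a \<or> j \<sqsubseteq> b" using below_r_cases[OF fork jC jr] empty by auto
  then show False
    using absurd[OF fork empty _ uv(1,4) uvr(1,2) uv(2,5) uvr(3,4) inc]
      absurd[OF fork_sym[OF fork] empty' _ uv(1,4) uvr(1,2) uv(2,5) uvr(3,4) inc] by auto
qed

text \<open>As each of the feet forces both inner elements, the possible traces on the four elements are
  the four subsets of \<open>{c, d}\<close> and three sets containing \<open>{c, d}\<close>.\<close>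

lemma card_Con_le_two_inner:
  assumes fork: "fork a b" and c: "c \<in> inner a b" and d: "d \<in> inner a b" "c \<noteq> d"
  shows "num_con L \<le> 7 * 2 ^ (card (join_irreducibles L) - 4)"
    and "4 \<le> card (join_irreducibles L)"
proof -
  let ?G = "{{}, {c}, {d}, {c, d}, {c, d, a}, {c, d, b}, {c, d, a, b}}"
  have mem: "{c, d, a, b} \<subseteq> join_irreducibles L"
    using fork c d by (auto simp: fork_def inner_def)
  have "a \<noteq> b" "c \<noteq> a" "c \<noteq> b" "d \<noteq> a" "d \<noteq> b"
    using fork c d fork_carrier[OF fork] by (auto simp: fork_def inner_def)
  then have card: "card {c, d, a, b} = 4" using d(2) by auto
  have trace: "collapsed L \<theta> \<inter> {c, d, a, b} \<in> ?G" if \<theta>: "lattice_congruence L \<theta>" for \<theta>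
  proof -
    have "a \<in> collapsed L \<theta> \<longrightarrow> c \<in> collapsed L \<theta> \<and> d \<in> collapsed L \<theta>"
      "b \<in> collapsed L \<theta> \<longrightarrow> c \<in> collapsed L \<theta> \<and> d \<in> collapsed L \<theta>"
      using fork_collapse_inner[OF fork \<theta> _ c] fork_collapse_inner[OF fork \<theta> _ d(1)]
        fork_collapse_inner[OF fork_sym[OF fork] \<theta> _ c[unfolded inner_sym[of a b]]]
        fork_collapse_inner[OF fork_sym[OF fork] \<theta> _ d(1)[unfolded inner_sym[of a b]]] by auto
    then show ?thesis
      by (cases "a \<in> collapsed L \<theta>"; cases "b \<in> collapsed L \<theta>";
          cases "c \<in> collapsed L \<theta>"; cases "d \<in> collapsed L \<theta>") simp_all
  qed
  have "card ?G \<le> 7" by (intro card_insert_le_m1) simp_all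
  from card_Con_le[OF mem card _ this trace]
  show "num_con L \<le> 7 * 2 ^ (card (join_irreducibles L) - 4)"
    and "4 \<le> card (join_irreducibles L)" by simp_all
qed

text \<open>The same count with one inner element: two subsets of \<open>{c}\<close> and three sets containing \<open>c\<close>.\<close>

lemma card_Con_le_one_inner:
  assumes fork: "fork a b" and c: "c \<in> inner a b"
  shows "num_con L \<le> 5 * 2 ^ (card (join_irreducibles L) - 3)"
    and "3 \<le> card (join_irreducibles L)"
proof -
  let ?G = "{{}, {c}, {c, a}, {c, b}, {c, a, b}}"
  have mem: "{c, a, b} \<subseteq> join_irreducibles L"
    using fork c by (auto simp: fork_def inner_def)
  have "a \<noteq> b" "c \<noteq> a" "c \<noteq> b"
    using fork c fork_carrier[OF fork] by (auto simp: fork_def inner_def)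
  then have card: "card {c, a, b} = 3" by auto
  have trace: "collapsed L \<theta> \<inter> {c, a, b} \<in> ?G" if \<theta>: "lattice_congruence L \<theta>" for \<theta>
  proof -
    have "a \<in> collapsed L \<theta> \<longrightarrow> c \<in> collapsed L \<theta>" "b \<in> collapsed L \<theta> \<longrightarrow> c \<in> collapsed L \<theta>"
      using fork_collapse_inner[OF fork \<theta> _ c]
        fork_collapse_inner[OF fork_sym[OF fork] \<theta> _ c[unfolded inner_sym[of a b]]] by auto
    then show ?thesis
      by (cases "a \<in> collapsed L \<theta>"; cases "b \<in> collapsed L \<theta>";
          cases "c \<in> collapsed L \<theta>") simp_all
  qed
  have "card ?G \<le> 5" by (intro card_insert_le_m1) simp_all
  from card_Con_le[OF mem card _ this trace]
  show "num_con L \<le> 5 * 2 ^ (card (join_irreducibles L) - 3)"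
    and "3 \<le> card (join_irreducibles L)" by simp_all
qed

text \<open>A third branch glues the three feet together: collapsing any of them collapses all.\<close>

lemma card_Con_le_antichain:
  assumes fork: "fork a b" and e: "inner a b = {e}" and inc: "\<not> a \<sqsubseteq> e" "\<not> b \<sqsubseteq> e"
  shows "num_con L \<le> 2 * 2 ^ (card (join_irreducibles L) - 3)"
proof -
  have "e \<in> inner a b" using e by simp
  then have eI: "e \<in> inner a b" "e \<in> join_irreducibles L" "e \<sqsubseteq> r" "\<not> e \<sqsubseteq> a" "\<not> e \<sqsubseteq> b"
    by (simp_all add: inner_def)
  have eC: "e \<in> carrier L" using eI join_irreducible_carrier by blast
  note C = fork_carrier[OF fork] and below = fork_below[OF fork]
  have pred: "z \<sqsubseteq> a \<and> z \<sqsubseteq> b" if z: "z \<in> carrier L" "z \<sqsubseteq> e" "z \<noteq> e" for z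
  proof -
    have zr: "z \<sqsubseteq> r" using le_trans[of z e r] z eC eI r_carrier by simp
    have "z \<noteq> r" using z eI(3) eC r_carrier le_antisym by blast
    then have "z \<sqsubseteq> a \<or> z \<sqsubseteq> b" using below_r_cases[OF fork z(1) zr] e z(3) by auto
    moreover have "z \<noteq> a" "z \<noteq> b" using z inc by auto
    ultimately show ?thesis using fork z(1) by (auto simp: fork_def)
  qed
  let ?G = "{{}, {e, a, b}}"
  have mem: "{e, a, b} \<subseteq> join_irreducibles L"
    using fork eI by (auto simp: fork_def)
  have "a \<noteq> b" "e \<noteq> a" "e \<noteq> b" using fork eI C by (auto simp: fork_def)
  then have card: "card {e, a, b} = 3" "card ?G \<le> 2" by auto
  have trace: "collapsed L \<theta> \<inter> {e, a, b} \<in> ?G" if \<theta>: "lattice_congruence L \<theta>" for \<theta>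
  proof -
    have 1: "a \<in> collapsed L \<theta> \<longrightarrow> e \<in> collapsed L \<theta>" "b \<in> collapsed L \<theta> \<longrightarrow> e \<in> collapsed L \<theta>"
      using fork_collapse_inner[OF fork \<theta> _ eI(1)]
        fork_collapse_inner[OF fork_sym[OF fork] \<theta> _ eI(1)[unfolded inner_sym[of a b]]] by auto
    have 2: "a \<in> collapsed L \<theta> \<and> b \<in> collapsed L \<theta>" if ec: "e \<in> collapsed L \<theta>"
    proof -
      have "(a, a \<squnion> e) \<in> \<theta>" "(b, b \<squnion> e) \<in> \<theta>"
        by (rule collapse_join[OF \<theta> ec]; use pred C eC in \<open>simp add: join_le_iff join_left\<close>)+
      then have "(a, r) \<in> \<theta>" "(b, r) \<in> \<theta>"
        using incomparable_join[OF C(1) eC] incomparable_join[OF C(2) eC] inc eI by auto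
      then show ?thesis
        using collapsed_below[OF \<theta>, of b r a] collapsed_below[OF \<theta>, of a r b] below fork
        unfolding fork_def by blast
    qed
    show ?thesis
      using 1 2 by (cases "e \<in> collapsed L \<theta>") auto
  qed
  from card_Con_le(1)[OF mem card(1) _ card(2) trace] show ?thesis by simp
qed

text \<open>The inner element \<open>e\<close> continues the branch of \<open>a\<close>, so the branches have two elements and one.\<close>

lemma pentagon_if_one_inner:
  assumes fork: "fork a b" and e: "inner a b = {e}" and ae: "a \<sqsubseteq> e"
  shows "pentagon_between_chains L (a \<sqinter> b) b a e r"
proof -
  have "e \<in> inner a b" using e by simp
  then have eI: "e \<in> join_irreducibles L" "e \<sqsubseteq> r" "\<not> e \<sqsubseteq> a" "\<not> e \<sqsubseteq> b"
    by (simp_all add: inner_def)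
  have eC: "e \<in> carrier L" using eI join_irreducible_carrier by blast
  note C = fork_carrier[OF fork] and below = fork_below[OF fork]
  have inc: "\<not> a \<sqsubseteq> b" "\<not> b \<sqsubseteq> a" using fork by (auto simp: fork_def)
  have pC: "a \<sqinter> b \<in> carrier L" using C by simp
  have "\<not> b \<sqsubseteq> e"
  proof
    assume "b \<sqsubseteq> e"
    then have "r \<sqsubseteq> e" using join_le[OF ae _ C eC] fork_join[OF fork] by simp
    then show False using eI eC r_carrier join_irreducible_not_r le_antisym by blast
  qed
  moreover have "a \<noteq> e" using eI(3) eC by auto
  moreover have "carrier L = down L (a \<sqinter> b) \<union> {b, a, e} \<union> up L r"
  proof
    show "carrier L \<subseteq> down L (a \<sqinter> b) \<union> {b, a, e} \<union> up L r"
    proof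
      fix z assume z: "z \<in> carrier L"
      show "z \<in> down L (a \<sqinter> b) \<union> {b, a, e} \<union> up L r"
      proof (cases "r \<sqsubseteq> z")
        case True
        then show ?thesis using z by (simp add: up_def)
      next
        case False
        then have "z \<sqsubseteq> r" "z \<noteq> r" using comparable_r[OF z] r_carrier by auto
        then have "z \<sqsubseteq> a \<or> z \<sqsubseteq> b \<or> z = e" using below_r_cases[OF fork z] e by blast
        then have "z = a \<or> z = b \<or> z = e \<or> z \<sqsubseteq> a \<and> z \<sqsubseteq> b"
          using fork z by (auto simp: fork_def)
        then show ?thesis using z C by (auto simp: down_def le_meet_iff)
      qed
    qed
  qed (use C eC in \<open>auto simp: down_def up_def\<close>)
  moreover have "totally_ordered L (down L (a \<sqinter> b))"
  proof -
    have "u \<sqsubseteq> v \<or> v \<sqsubseteq> u" if "u \<in> down L (a \<sqinter> b)" "v \<in> down L (a \<sqinter> b)" for u v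
      using comparable_below[OF below(1,2), of u v] that C by (auto simp: down_def le_meet_iff)
    then show ?thesis by (simp add: totally_ordered_def)
  qed
  ultimately show ?thesis
    using C eC r_carrier pC ae below eI inc totally_ordered_up meet_left[OF C] meet_right[OF C]
    by (simp add: pentagon_between_chains_def)
qed

text \<open>If some join-irreducible element is not join-prime, then there are inner elements; two of them,
  or a third branch, leave at most \<open>7 / 16\<close> of all sets of join-irreducible elements, and what
  remains is a pentagon between two chains.\<close>

lemma not_join_prime_cases:
  assumes j: "j \<in> join_irreducibles L" "\<not> join_prime L j"
  shows "(num_con L \<le> 7 * 2 ^ (card (join_irreducibles L) - 4) \<and>
      4 \<le> card (join_irreducibles L)) \<or>
    (num_con L \<le> 2 * 2 ^ (card (join_irreducibles L) - 3) \<and>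
      3 \<le> card (join_irreducibles L)) \<or>
    ((\<exists>p x y z. pentagon_between_chains L p x y z r) \<and>
      num_con L \<le> 5 * 2 ^ (card (join_irreducibles L) - 3) \<and>
      3 \<le> card (join_irreducibles L))"
proof -
  obtain a b where fork: "fork a b" using fork_exists .
  have "inner a b \<noteq> {}" using join_prime_if_inner_empty[OF fork _ j(1)] j(2) by auto
  then obtain e where e: "e \<in> inner a b" by blast
  note five = card_Con_le_one_inner[OF fork e]
  show ?thesis
  proof (cases "inner a b = {e}")
    case False
    then obtain d where "d \<in> inner a b" "e \<noteq> d" using e by blast
    then show ?thesis using card_Con_le_two_inner[OF fork e] by blast
  next
    case True
    then have True': "inner b a = {e}" using inner_sym by blast
    show ?thesis
      using card_Con_le_antichain[OF fork True] five pentagon_if_one_inner[OF fork True]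
        pentagon_if_one_inner[OF fork_sym[OF fork] True'] by blast
  qed
qed

end

section \<open>Distributive lattices with exactly two join-reducible elements\<close>

text \<open>The grid has the chains \<open>p < x < w\<close> and \<open>y < r < s\<close> as its two long rows.\<close>

definition grid_between_chains ::
    "('a, 'r) gorder_scheme \<Rightarrow> 'a \<Rightarrow> 'a \<Rightarrow> 'a \<Rightarrow> 'a \<Rightarrow> 'a \<Rightarrow> 'a \<Rightarrow> bool"
  where "grid_between_chains L p x w y r s \<longleftrightarrow>
    {p, x, w, y, r, s} \<subseteq> carrier L \<and> p \<sqsubseteq>\<^bsub>L\<^esub> x \<and> x \<sqsubseteq>\<^bsub>L\<^esub> w \<and> w \<sqsubseteq>\<^bsub>L\<^esub> s \<and>
    p \<sqsubseteq>\<^bsub>L\<^esub> y \<and> y \<sqsubseteq>\<^bsub>L\<^esub> r \<and> r \<sqsubseteq>\<^bsub>L\<^esub> s \<and> x \<sqsubseteq>\<^bsub>L\<^esub> r \<and> \<not> w \<sqsubseteq>\<^bsub>L\<^esub> r \<and> \<not> x \<sqsubseteq>\<^bsub>L\<^esub> y \<and> \<not> y \<sqsubseteq>\<^bsub>L\<^esub> w \<and>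
    carrier L = down L p \<union> {x, w, y, r} \<union> up L s \<and>
    totally_ordered L (down L p) \<and> totally_ordered L (up L s)"

definition two_squares_between_chains ::
    "('a, 'r) gorder_scheme \<Rightarrow> 'a \<Rightarrow> 'a \<Rightarrow> 'a \<Rightarrow> 'a \<Rightarrow> 'a \<Rightarrow> 'a \<Rightarrow> 'a \<Rightarrow> 'a \<Rightarrow> bool"
  where "two_squares_between_chains L p x y r q u v s \<longleftrightarrow>
    {p, x, y, r, q, u, v, s} \<subseteq> carrier L \<and> p \<sqsubseteq>\<^bsub>L\<^esub> x \<and> p \<sqsubseteq>\<^bsub>L\<^esub> y \<and> x \<sqsubseteq>\<^bsub>L\<^esub> r \<and> y \<sqsubseteq>\<^bsub>L\<^esub> r \<and>
    \<not> x \<sqsubseteq>\<^bsub>L\<^esub> y \<and> \<not> y \<sqsubseteq>\<^bsub>L\<^esub> x \<and> r \<sqsubseteq>\<^bsub>L\<^esub> q \<and> q \<sqsubseteq>\<^bsub>L\<^esub> u \<and> q \<sqsubseteq>\<^bsub>L\<^esub> v \<and> u \<sqsubseteq>\<^bsub>L\<^esub> s \<and> v \<sqsubseteq>\<^bsub>L\<^esub> s \<and>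
    \<not> u \<sqsubseteq>\<^bsub>L\<^esub> v \<and> \<not> v \<sqsubseteq>\<^bsub>L\<^esub> u \<and>
    carrier L = down L p \<union> {x, y} \<union> (up L r \<inter> down L q) \<union> {u, v} \<union> up L s \<and>
    totally_ordered L (down L p) \<and> totally_ordered L (up L r \<inter> down L q) \<and>
    totally_ordered L (up L s)"

locale two_join_reducibles = finite_lattice +
  fixes r s
  assumes join_reducibles_eq: "join_reducibles L = {r, s}"
    and r_neq_s: "r \<noteq> s" and r_le_s: "r \<sqsubseteq> s"
    and prime: "\<And>j. j \<in> join_irreducibles L \<Longrightarrow> join_prime L j"
begin

lemma rs_carrier: "r \<in> carrier L" "s \<in> carrier L"
  using join_reducibles_eq by (auto simp: join_reducibles_def)

lemma not_s_le_r: "\<not> s \<sqsubseteq> r"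
  using r_neq_s r_le_s rs_carrier le_antisym by blast

lemma prime_unless_rs:
  assumes "t \<in> carrier L" "t \<noteq> r" "t \<noteq> s"
  shows "join_prime L t"
proof (cases "t = \<bottom>")
  case True then show ?thesis using bottom_lower by (simp add: join_prime_def)
next
  case False then show ?thesis
    using assms join_reducibles_eq by (intro prime) (auto simp: join_irreducibles_def)
qed

lemma prime_le_join:
  assumes "t \<in> carrier L" "t \<noteq> r" "t \<noteq> s" "t \<sqsubseteq> x \<squnion> y" "x \<in> carrier L" "y \<in> carrier L"
  shows "t \<sqsubseteq> x \<or> t \<sqsubseteq> y"
  using join_primeD[OF prime_unless_rs[OF assms(1-3)] assms(4-6)] .

lemma incomparable_join:
  assumes "x \<in> carrier L" "y \<in> carrier L" "\<not> x \<sqsubseteq> y" "\<not> y \<sqsubseteq> x"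
  shows "x \<squnion> y = r \<or> x \<squnion> y = s"
  using join_reducibleI[OF assms] join_reducibles_eq by blast

lemma incomparable_below:
  assumes "x \<in> carrier L" "y \<in> carrier L" "\<not> x \<sqsubseteq> y" "\<not> y \<sqsubseteq> x"
  shows "x \<sqsubseteq> s"
proof -
  have "x \<sqsubseteq> r \<or> x \<sqsubseteq> s"
    using incomparable_join[OF assms] join_left[OF assms(1,2)] by auto
  then show ?thesis using le_trans[OF _ r_le_s] assms rs_carrier by blast
qed

lemma comparable_s: "x \<in> carrier L \<Longrightarrow> x \<sqsubseteq> s \<or> s \<sqsubseteq> x"
  using incomparable_below[of x s] rs_carrier by blast

lemma totally_ordered_up: "totally_ordered L (up L s)"
proof -
  have "x \<sqsubseteq> y \<or> y \<sqsubseteq> x" if xy: "x \<in> carrier L" "y \<in> carrier L" "s \<sqsubseteq> x" "s \<sqsubseteq> y" for x y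
  proof (rule ccontr)
    assume n: "\<not> ?thesis"
    then have "x \<sqsubseteq> s" using incomparable_below[of x y] xy by simp
    then have "x = s" using le_antisym[of x s] xy rs_carrier by simp
    then show False using xy n by simp
  qed
  then show ?thesis by (auto simp: totally_ordered_def up_def)
qed

text \<open>Incomparable elements with join \<open>t\<close> are the only maximal ones below \<open>t\<close>, and what is
  strictly below one of them is below both, by join-primeness.\<close>

lemma below_join_cases:
  assumes C: "x \<in> carrier L" "y \<in> carrier L" "z \<in> carrier L" and t: "x \<squnion> y = t"
    and xy: "x \<noteq> r" "x \<noteq> s" "y \<noteq> r" "y \<noteq> s" "\<not> x \<sqsubseteq> y" "\<not> y \<sqsubseteq> x"
    and z: "z \<noteq> r" "z \<noteq> s" "z \<sqsubseteq> t"
    and joins: "\<And>w. w \<in> carrier L \<Longrightarrow> w \<sqsubseteq> t \<Longrightarrow> \<not> w \<sqsubseteq> z \<Longrightarrow> \<not> z \<sqsubseteq> w \<Longrightarrow> z \<squnion> w = t"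
  shows "z = x \<or> z = y \<or> z \<sqsubseteq> x \<sqinter> y"
proof -
  have le: "x \<sqsubseteq> t" "y \<sqsubseteq> t" using C t join_left join_right by auto
  have *: "z \<sqsubseteq> y'" if z': "z \<sqsubseteq> x'" "z \<noteq> x'"
    and x': "x' \<in> carrier L" "x' \<noteq> r" "x' \<noteq> s" "x' \<sqsubseteq> t" "\<not> x' \<sqsubseteq> y'"
    and y': "y' \<in> carrier L" "y' \<sqsubseteq> t" "\<not> y' \<sqsubseteq> x'" for x' y'
  proof (rule ccontr)
    assume n: "\<not> z \<sqsubseteq> y'"
    have "\<not> y' \<sqsubseteq> z" using le_trans[of y' z x'] z'(1) x'(1) y' C(3) by auto
    then have "z \<squnion> y' = t" using joins[of y'] y' n by blast
    then have "x' \<sqsubseteq> z \<or> x' \<sqsubseteq> y'" using prime_le_join[of x' z y'] x' y' C(3) by simp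
    then show False using x' z' C(3) le_antisym by blast
  qed
  have "z \<sqsubseteq> x \<or> z \<sqsubseteq> y" using prime_le_join[of z x y] z t C by simp
  moreover have "z \<sqsubseteq> x \<Longrightarrow> z = x \<or> z \<sqsubseteq> y" using *[of x y] C xy le by blast
  moreover have "z \<sqsubseteq> y \<Longrightarrow> z = y \<or> z \<sqsubseteq> x" using *[of y x] C xy le by blast
  ultimately show ?thesis using C by (auto simp: le_meet_iff)
qed

lemma lower_square:
  obtains x y where "x \<in> carrier L" "y \<in> carrier L" "x \<squnion> y = r" "\<not> x \<sqsubseteq> y" "\<not> y \<sqsubseteq> x"
    "x \<noteq> r" "x \<noteq> s" "y \<noteq> r" "y \<noteq> s"
    "\<And>z. z \<in> carrier L \<Longrightarrow> z \<sqsubseteq> r \<Longrightarrow> z = r \<or> z = x \<or> z = y \<or> z \<sqsubseteq> x \<sqinter> y"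
    "totally_ordered L (down L (x \<sqinter> y))"
proof -
  obtain x y where xy: "x \<in> carrier L" "y \<in> carrier L" "r = x \<squnion> y"
    "\<not> x \<sqsubseteq> y" "\<not> y \<sqsubseteq> x" "x \<noteq> r" "y \<noteq> r"
    using join_reducibleE[of r] join_reducibles_eq by blast
  have le: "x \<sqsubseteq> r" "y \<sqsubseteq> r" using xy join_left join_right by auto
  have ns: "x \<noteq> s" "y \<noteq> s" using le not_s_le_r by auto
  have join_r: "u \<squnion> v = r"
    if uv: "u \<in> carrier L" "v \<in> carrier L" "u \<sqsubseteq> r" "v \<sqsubseteq> r" "\<not> u \<sqsubseteq> v" "\<not> v \<sqsubseteq> u" for u v
    using incomparable_join[OF uv(1,2,5,6)] join_le[OF uv(3,4,1,2) rs_carrier(1)] not_s_le_r by auto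
  have cases: "z = r \<or> z = x \<or> z = y \<or> z \<sqsubseteq> x \<sqinter> y" if z: "z \<in> carrier L" "z \<sqsubseteq> r" for z
  proof (cases "z = r")
    case False
    have "z \<noteq> s" using z not_s_le_r by auto
    then show ?thesis
      using below_join_cases[OF xy(1,2) z(1) xy(3)[symmetric] xy(6) ns(1) xy(7) ns(2) xy(4,5) False]
        join_r z by blast
  qed simp
  have "totally_ordered L (down L (x \<sqinter> y))"
  proof -
    have chain: "u \<sqsubseteq> v \<or> v \<sqsubseteq> u"
      if uv: "u \<in> carrier L" "v \<in> carrier L" "u \<sqsubseteq> x" "v \<sqsubseteq> x" for u v
    proof (rule ccontr)
      assume "\<not> ?thesis"
      then have "u \<squnion> v = r" using join_r uv le_trans[OF _ le(1)] xy(1) rs_carrier(1) by blast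
      then have "r \<sqsubseteq> x" using join_le[OF uv(3,4,1,2) xy(1)] by simp
      then show False using xy le rs_carrier le_antisym by blast
    qed
    have "u \<sqsubseteq> v \<or> v \<sqsubseteq> u" if "u \<in> down L (x \<sqinter> y)" "v \<in> down L (x \<sqinter> y)" for u v
      using chain[of u v] that xy(1,2) by (auto simp: down_def le_meet_iff)
    then show ?thesis by (simp add: totally_ordered_def)
  qed
  with that xy cases ns show ?thesis by metis
qed

text \<open>Let \<open>x, y\<close> be the middle elements of the square below \<open>r\<close>. An element \<open>w\<close> incomparable to \<open>r\<close> has
  join \<open>s\<close> with \<open>r\<close> and, by join-primeness, lies above exactly one of \<open>x\<close> and \<open>y\<close>. Any other element
  strictly below \<open>s\<close> and not below \<open>r\<close> would be join-prime and below \<open>w \<squnion> r\<close>, hence below \<open>w\<close>, and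
  by symmetry it equals \<open>w\<close>.\<close>

lemma grid_if_incomparable:
  assumes w: "w \<in> carrier L" "\<not> w \<sqsubseteq> r" "\<not> r \<sqsubseteq> w"
  shows "\<exists>p x w y. grid_between_chains L p x w y r s"
proof -
  obtain x y where xy: "x \<in> carrier L" "y \<in> carrier L" "x \<squnion> y = r" "\<not> x \<sqsubseteq> y" "\<not> y \<sqsubseteq> x"
    and ne: "x \<noteq> r" "x \<noteq> s" "y \<noteq> r" "y \<noteq> s"
    and low: "\<And>z. z \<in> carrier L \<Longrightarrow> z \<sqsubseteq> r \<Longrightarrow> z = r \<or> z = x \<or> z = y \<or> z \<sqsubseteq> x \<sqinter> y"
    and total: "totally_ordered L (down L (x \<sqinter> y))"
    using lower_square by metis
  note R = rs_carrier
  have le: "x \<sqsubseteq> r" "y \<sqsubseteq> r" using xy join_left join_right by metis+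
  have join_s: "z \<squnion> v = s"
    if "z \<in> carrier L" "v \<in> carrier L" "\<not> z \<sqsubseteq> v" "\<not> v \<sqsubseteq> z" "\<not> z \<sqsubseteq> r" for z v
    using incomparable_join[OF that(1-4)] join_left[OF that(1,2)] that(5) by auto
  have ws: "w \<squnion> r = s" using join_s[OF w(1) R(1) w(2,3) w(2)] .
  have wne: "w \<noteq> r" "w \<noteq> s" using w R r_le_s by auto
  \<comment> \<open>Join-primeness of \<open>y\<close> puts one of the two middle elements of the lower square below \<open>w\<close>.\<close>
  have some: "x \<sqsubseteq> w \<or> y \<sqsubseteq> w"
  proof (rule ccontr)
    assume n: "\<not> ?thesis"
    have "\<not> w \<sqsubseteq> x" using le_trans[of w x r] le w xy R by auto
    then have "w \<squnion> x = s" using join_s w xy n by blast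
    then have "y \<sqsubseteq> w \<squnion> x" using le_trans[OF le(2) r_le_s] xy R by simp
    then show False using prime_le_join[OF xy(2) ne(3,4)] w(1) xy(1,5) n by blast
  qed
  have not_both: "\<not> (x \<sqsubseteq> w \<and> y \<sqsubseteq> w)" using join_le[of x w y] xy w by auto
  have only: "z = w" if z: "z \<in> carrier L" "\<not> z \<sqsubseteq> r" "z \<sqsubseteq> s" "z \<noteq> s" for z
  proof -
    have zne: "z \<noteq> r" using z R by auto
    have zw: "z \<sqsubseteq> w" using prime_le_join[OF z(1) zne z(4), of w r] z ws w(1) R(1) by simp
    have "\<not> r \<sqsubseteq> z" using le_trans[of r z w] zw z(1) w R by auto
    then have "z \<squnion> r = s" using join_s[OF z(1) R(1) z(2) _ z(2)] by simp
    moreover have "w \<sqsubseteq> s" using ws join_left[OF w(1) R(1)] by simp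
    ultimately have "w \<sqsubseteq> z" using prime_le_join[OF w(1) wne, of z r] z(1) w(2) R by simp
    with zw show ?thesis using le_antisym[of z w] z w by simp
  qed
  have result: "grid_between_chains L (x' \<sqinter> y') x' w y' r s"
    if x': "x' \<in> carrier L" "x' \<sqsubseteq> r" "\<not> x' \<sqsubseteq> y'" "x' \<sqsubseteq> w"
      and y': "y' \<in> carrier L" "y' \<sqsubseteq> r" "\<not> y' \<sqsubseteq> w"
      and low': "\<And>z. z \<in> carrier L \<Longrightarrow> z \<sqsubseteq> r \<Longrightarrow> z = r \<or> z = x' \<or> z = y' \<or> z \<sqsubseteq> x' \<sqinter> y'"
      and total': "totally_ordered L (down L (x' \<sqinter> y'))" for x' y'
  proof -
    have "carrier L = down L (x' \<sqinter> y') \<union> {x', w, y', r} \<union> up L s"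
    proof
      show "carrier L \<subseteq> down L (x' \<sqinter> y') \<union> {x', w, y', r} \<union> up L s"
      proof
        fix z assume z: "z \<in> carrier L"
        consider "s \<sqsubseteq> z" | "z \<sqsubseteq> r" | "\<not> z \<sqsubseteq> r" "z \<sqsubseteq> s" "z \<noteq> s"
          using comparable_s[OF z] R by auto
        then show "z \<in> down L (x' \<sqinter> y') \<union> {x', w, y', r} \<union> up L s"
          using z low'[OF z] only[OF z] by cases (auto simp: down_def up_def)
      qed
    qed (use x' y' w R in \<open>auto simp: down_def up_def\<close>)
    moreover have "w \<sqsubseteq> s" using ws join_left[OF w(1) R(1)] by simp
    moreover have "x' \<sqinter> y' \<in> carrier L" using x' y' by simp
    ultimately show ?thesis
      using x' y' w R r_le_s total' totally_ordered_up meet_left[OF x'(1) y'(1)]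
        meet_right[OF x'(1) y'(1)]
      by (simp add: grid_between_chains_def)
  qed
  show ?thesis
  proof (cases "x \<sqsubseteq> w")
    case True
    then have "\<not> y \<sqsubseteq> w" using not_both by blast
    from result[OF xy(1) le(1) xy(4) True xy(2) le(2) this low total]
    show ?thesis by blast
  next
    case False
    then have yw: "y \<sqsubseteq> w" using some by blast
    have low': "z = r \<or> z = y \<or> z = x \<or> z \<sqsubseteq> y \<sqinter> x" if "z \<in> carrier L" "z \<sqsubseteq> r" for z
      using low[OF that] by (auto simp: meet_comm[of L y x])
    from result[OF xy(2) le(2) xy(5) yw xy(1) le(1) False low' total[unfolded meet_comm[of L x y]]]
    show ?thesis by blast
  qed
qed

text \<open>If everything is comparable to \<open>r\<close>, then \<open>s\<close> is the only proper join strictly above \<open>r\<close>, and the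
  interval from \<open>r\<close> to \<open>s\<close> ends in a square for the same reason as the part below \<open>r\<close>.\<close>

lemma two_squares_if_comparable:
  assumes comp: "\<And>w. w \<in> carrier L \<Longrightarrow> w \<sqsubseteq> r \<or> r \<sqsubseteq> w"
  shows "\<exists>p x y q u v. two_squares_between_chains L p x y r q u v s"
proof -
  obtain x y where xy: "x \<in> carrier L" "y \<in> carrier L" "x \<squnion> y = r" "\<not> x \<sqsubseteq> y" "\<not> y \<sqsubseteq> x"
    and ne: "x \<noteq> r" "x \<noteq> s" "y \<noteq> r" "y \<noteq> s"
    and low: "\<And>z. z \<in> carrier L \<Longrightarrow> z \<sqsubseteq> r \<Longrightarrow> z = r \<or> z = x \<or> z = y \<or> z \<sqsubseteq> x \<sqinter> y"
    and total: "totally_ordered L (down L (x \<sqinter> y))"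
    using lower_square by metis
  note R = rs_carrier
  have le: "x \<sqsubseteq> r" "y \<sqsubseteq> r" using xy join_left join_right by metis+
  obtain u v where uv: "u \<in> carrier L" "v \<in> carrier L" "s = u \<squnion> v"
    "\<not> u \<sqsubseteq> v" "\<not> v \<sqsubseteq> u" "u \<noteq> s" "v \<noteq> s"
    using join_reducibleE[of s] join_reducibles_eq by blast
  have les: "u \<sqsubseteq> s" "v \<sqsubseteq> s" using uv join_left join_right by auto
  have "\<not> (u \<sqsubseteq> r \<and> v \<sqsubseteq> r)" using join_le[of u r v] uv R not_s_le_r by auto
  moreover have "\<not> (u \<sqsubseteq> r \<and> r \<sqsubseteq> v)" "\<not> (v \<sqsubseteq> r \<and> r \<sqsubseteq> u)"
    using le_trans[of u r v] le_trans[of v r u] uv R by auto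
  ultimately have ru: "r \<sqsubseteq> u" "r \<sqsubseteq> v" using comp[OF uv(1)] comp[OF uv(2)] by auto
  have ner: "u \<noteq> r" "v \<noteq> r" using ru uv by auto
  define q where "q = u \<sqinter> v"
  have qC: "q \<in> carrier L" and q: "q \<sqsubseteq> u" "q \<sqsubseteq> v" "r \<sqsubseteq> q"
    using uv ru R by (auto simp: q_def le_meet_iff meet_left meet_right)
  have join_s: "z \<squnion> w = s"
    if z: "z \<in> carrier L" "r \<sqsubseteq> z" "z \<noteq> r" and w: "w \<in> carrier L" "\<not> w \<sqsubseteq> z" "\<not> z \<sqsubseteq> w" for z w
  proof -
    have "z \<squnion> w \<noteq> r" using join_left[OF z(1) w(1)] z R le_antisym by metis
    then show ?thesis using incomparable_join[OF z(1) w(1,3,2)] by blast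
  qed
  have up: "z = u \<or> z = v \<or> z \<sqsubseteq> q" if z: "z \<in> carrier L" "r \<sqsubseteq> z" "z \<sqsubseteq> s" "z \<noteq> s" for z
  proof (cases "z = r")
    case True then show ?thesis using q by simp
  next
    case False
    show ?thesis
      unfolding q_def
      using below_join_cases[OF uv(1,2) z(1) uv(3)[symmetric] ner(1) uv(6) ner(2) uv(7,4,5) False z(4,3)]
        join_s[OF z(1,2) False] by blast
  qed
  have "carrier L = down L (x \<sqinter> y) \<union> {x, y} \<union> (up L r \<inter> down L q) \<union> {u, v} \<union> up L s"
  proof
    show "carrier L \<subseteq> down L (x \<sqinter> y) \<union> {x, y} \<union> (up L r \<inter> down L q) \<union> {u, v} \<union> up L s"
    proof
      fix z assume z: "z \<in> carrier L"
      consider "s \<sqsubseteq> z" | "z \<sqsubseteq> r" | "r \<sqsubseteq> z" "z \<sqsubseteq> s" "z \<noteq> s"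
        using comparable_s[OF z] comp[OF z] R by auto
      then show "z \<in> down L (x \<sqinter> y) \<union> {x, y} \<union> (up L r \<inter> down L q) \<union> {u, v} \<union> up L s"
      proof cases
        case 2
        then show ?thesis using z low[OF z] q R by (auto simp: down_def up_def)
      qed (use z up[OF z] in \<open>auto simp: down_def up_def\<close>)
    qed
  qed (use xy uv in \<open>auto simp: down_def up_def\<close>)
  moreover have "totally_ordered L (up L r \<inter> down L q)"
  proof -
    have "z \<sqsubseteq> w \<or> w \<sqsubseteq> z"
      if zw: "z \<in> carrier L" "w \<in> carrier L" "r \<sqsubseteq> z" "r \<sqsubseteq> w" "z \<sqsubseteq> q" "w \<sqsubseteq> q" for z w
    proof (rule ccontr)
      assume n: "\<not> ?thesis"
      have "z \<noteq> r" using n zw by auto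
      then have "z \<squnion> w = s" using join_s zw n by blast
      then have "s \<sqsubseteq> q" using join_le[OF zw(5,6,1,2) qC] by simp
      then have "s \<sqsubseteq> u" using le_trans[OF _ q(1)] R qC uv by blast
      then show False using uv les R le_antisym by blast
    qed
    then show ?thesis by (auto simp: totally_ordered_def up_def down_def)
  qed
  moreover have "x \<sqinter> y \<in> carrier L" "x \<sqinter> y \<sqsubseteq> x" "x \<sqinter> y \<sqsubseteq> y"
    using xy meet_left meet_right by auto
  ultimately have "two_squares_between_chains L (x \<sqinter> y) x y r q u v s"
    using xy le uv les R qC q total totally_ordered_up
    by (simp add: two_squares_between_chains_def)
  then show ?thesis by blast
qed

end

section \<open>Isomorphisms, sublattices and ordinal sums\<close>

lemma order_isomorphic_join:
  assumes L: "lattice L" and f: "bij_betw f (carrier L) (carrier M)"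
    and le: "\<And>x y. x \<in> carrier L \<Longrightarrow> y \<in> carrier L \<Longrightarrow> x \<sqsubseteq>\<^bsub>L\<^esub> y \<longleftrightarrow> f x \<sqsubseteq>\<^bsub>M\<^esub> f y"
    and xy: "x \<in> carrier L" "y \<in> carrier L"
  shows "least M (f (x \<squnion>\<^bsub>L\<^esub> y)) (Upper M {f x, f y})"
proof (rule least_UpperI)
  interpret L: lattice L by fact
  have im: "carrier M = f ` carrier L" using f by (simp add: bij_betw_def)
  show "{f x, f y} \<subseteq> carrier M" "f (x \<squnion>\<^bsub>L\<^esub> y) \<in> carrier M" using xy im by auto
  show "t \<sqsubseteq>\<^bsub>M\<^esub> f (x \<squnion>\<^bsub>L\<^esub> y)" if "t \<in> {f x, f y}" for t
    using that xy le[of x "x \<squnion>\<^bsub>L\<^esub> y"] le[of y "x \<squnion>\<^bsub>L\<^esub> y"] L.join_left[of x y] L.join_right[of x y] by auto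
  fix t assume t: "t \<in> Upper M {f x, f y}"
  then have "t \<in> carrier M" by (simp add: Upper_def)
  then obtain z where z: "z \<in> carrier L" "t = f z" using im by blast
  have "f x \<sqsubseteq>\<^bsub>M\<^esub> t" "f y \<sqsubseteq>\<^bsub>M\<^esub> t" using t xy im by (auto simp: Upper_def)
  then show "f (x \<squnion>\<^bsub>L\<^esub> y) \<sqsubseteq>\<^bsub>M\<^esub> t"
    using xy z le[of x z] le[of y z] le[of "x \<squnion>\<^bsub>L\<^esub> y" z] L.join_le[of x z y] by simp
qed

lemma order_isomorphic_meet:
  assumes L: "lattice L" and f: "bij_betw f (carrier L) (carrier M)"
    and le: "\<And>x y. x \<in> carrier L \<Longrightarrow> y \<in> carrier L \<Longrightarrow> x \<sqsubseteq>\<^bsub>L\<^esub> y \<longleftrightarrow> f x \<sqsubseteq>\<^bsub>M\<^esub> f y"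
    and xy: "x \<in> carrier L" "y \<in> carrier L"
  shows "greatest M (f (x \<sqinter>\<^bsub>L\<^esub> y)) (Lower M {f x, f y})"
  using order_isomorphic_join[OF lattice.dual_lattice[OF L], of f "inv_gorder M" x y] f le xy by simp

lemma isomorphic_if_order_isomorphic:
  assumes L: "lattice L" and f: "bij_betw f (carrier L) (carrier M)" and eq: "(.=\<^bsub>M\<^esub>) = (=)"
    and le: "\<And>x y. x \<in> carrier L \<Longrightarrow> y \<in> carrier L \<Longrightarrow> x \<sqsubseteq>\<^bsub>L\<^esub> y \<longleftrightarrow> f x \<sqsubseteq>\<^bsub>M\<^esub> f y"
  shows "L \<cong>\<^sub>L M"
proof -
  interpret L: lattice L by fact
  have pre: "\<exists>x\<in>carrier L. u = f x" if "u \<in> carrier M" for u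
    using that f by (auto simp: bij_betw_def)
  interpret P: partial_order M
  proof
    fix u v w assume "u \<in> carrier M" "v \<in> carrier M" "w \<in> carrier M"
    then obtain x y z where xyz: "x \<in> carrier L" "u = f x" "y \<in> carrier L" "v = f y" "z \<in> carrier L" "w = f z"
      using pre by metis
    show "u \<sqsubseteq>\<^bsub>M\<^esub> v \<Longrightarrow> v \<sqsubseteq>\<^bsub>M\<^esub> w \<Longrightarrow> u \<sqsubseteq>\<^bsub>M\<^esub> w"
      using xyz le[of x y] le[of y z] le[of x z] L.le_trans[of x y z] by simp
  next
    fix u v assume "u \<in> carrier M" "v \<in> carrier M"
    then obtain x y where xy: "x \<in> carrier L" "u = f x" "y \<in> carrier L" "v = f y"
      using pre by metis
    show "u \<sqsubseteq>\<^bsub>M\<^esub> v \<Longrightarrow> v \<sqsubseteq>\<^bsub>M\<^esub> u \<Longrightarrow> u .=\<^bsub>M\<^esub> v"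
      using xy le[of x y] le[of y x] L.le_antisym[of x y] eq by simp
  next
    fix u assume "u \<in> carrier M"
    then obtain x where "x \<in> carrier L" "u = f x" using pre by metis
    then show "u \<sqsubseteq>\<^bsub>M\<^esub> u" using le[of x x] by simp
  qed (simp_all add: eq)
  have "lattice M"
  proof
    fix u v assume "u \<in> carrier M" "v \<in> carrier M"
    then obtain x y where "x \<in> carrier L" "u = f x" "y \<in> carrier L" "v = f y"
      using pre by metis
    then show "\<exists>s. least M s (Upper M {u, v})" "\<exists>s. greatest M s (Lower M {u, v})"
      using order_isomorphic_join[OF L f le, of x y] order_isomorphic_meet[OF L f le, of x y] by auto
  qed
  then interpret M: lattice M .
  have fC: "f x \<in> carrier M" if "x \<in> carrier L" for x using f that by (auto simp: bij_betw_def)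
  have "f (x \<squnion>\<^bsub>L\<^esub> y) = f x \<squnion>\<^bsub>M\<^esub> f y \<and> f (x \<sqinter>\<^bsub>L\<^esub> y) = f x \<sqinter>\<^bsub>M\<^esub> f y"
    if xy: "x \<in> carrier L" "y \<in> carrier L" for x y
  proof -
    note fxy = fC[OF xy(1)] fC[OF xy(2)]
    show ?thesis
      using P.weak_least_unique[OF order_isomorphic_join[OF L f le xy] M.sup_of_two_least[OF fxy]]
        P.weak_greatest_unique[OF order_isomorphic_meet[OF L f le xy] M.inf_of_two_greatest[OF fxy]]
      by (simp add: eq join_def meet_def)
  qed
  then show ?thesis
    using f L.lattice_axioms M.lattice_axioms
    by (auto simp: lattice_isomorphic_def join_pres_def meet_pres_def)
qed

lemma isomorphicE:
  assumes "L \<cong>\<^sub>L M"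
  obtains f where "lattice L" "lattice M" "bij_betw f (carrier L) (carrier M)"
    "\<And>x y. x \<in> carrier L \<Longrightarrow> y \<in> carrier L \<Longrightarrow> f (x \<squnion>\<^bsub>L\<^esub> y) = f x \<squnion>\<^bsub>M\<^esub> f y"
    "\<And>x y. x \<in> carrier L \<Longrightarrow> y \<in> carrier L \<Longrightarrow> f (x \<sqinter>\<^bsub>L\<^esub> y) = f x \<sqinter>\<^bsub>M\<^esub> f y"
    "\<And>x y. x \<in> carrier L \<Longrightarrow> y \<in> carrier L \<Longrightarrow> x \<sqsubseteq>\<^bsub>L\<^esub> y \<longleftrightarrow> f x \<sqsubseteq>\<^bsub>M\<^esub> f y"
proof -
  obtain f where f: "bij_betw f (carrier L) (carrier M)" "lattice L" "lattice M"
    and j: "\<And>x y. x \<in> carrier L \<Longrightarrow> y \<in> carrier L \<Longrightarrow> f (x \<squnion>\<^bsub>L\<^esub> y) = f x \<squnion>\<^bsub>M\<^esub> f y"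
    and m: "\<And>x y. x \<in> carrier L \<Longrightarrow> y \<in> carrier L \<Longrightarrow> f (x \<sqinter>\<^bsub>L\<^esub> y) = f x \<sqinter>\<^bsub>M\<^esub> f y"
    using assms by (auto simp: lattice_isomorphic_def join_pres_def meet_pres_def)
  interpret L: lattice L by fact
  interpret M: lattice M by fact
  have "x \<sqsubseteq>\<^bsub>L\<^esub> y \<longleftrightarrow> f x \<sqsubseteq>\<^bsub>M\<^esub> f y" if xy: "x \<in> carrier L" "y \<in> carrier L" for x y
  proof -
    have "x \<sqsubseteq>\<^bsub>L\<^esub> y \<longleftrightarrow> x \<squnion>\<^bsub>L\<^esub> y = y" using L.le_iff_meet xy by simp
    also have "\<dots> \<longleftrightarrow> f (x \<squnion>\<^bsub>L\<^esub> y) = f y"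
      using f(1) xy by (auto simp: bij_betw_def dest: inj_onD)
    also have "\<dots> \<longleftrightarrow> f x \<sqsubseteq>\<^bsub>M\<^esub> f y"
      using M.le_iff_meet[of "f x" "f y"] bij_betwE[OF f(1)] xy j[OF xy] by simp
    finally show ?thesis .
  qed
  with f j m that show ?thesis by blast
qed

lemma isomorphic_sym:
  assumes "L \<cong>\<^sub>L M"
  shows "M \<cong>\<^sub>L L"
proof -
  obtain f where f: "lattice L" "lattice M" "bij_betw f (carrier L) (carrier M)"
    "\<And>x y. x \<in> carrier L \<Longrightarrow> y \<in> carrier L \<Longrightarrow> x \<sqsubseteq>\<^bsub>L\<^esub> y \<longleftrightarrow> f x \<sqsubseteq>\<^bsub>M\<^esub> f y"
    using isomorphicE[OF assms] by metis
  interpret L: lattice L by fact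
  let ?g = "inv_into (carrier L) f"
  have g: "bij_betw ?g (carrier M) (carrier L)" using f(3) by (rule bij_betw_inv_into)
  show ?thesis
  proof (rule isomorphic_if_order_isomorphic[OF f(2) g L.eq_is_equal])
    fix u v assume "u \<in> carrier M" "v \<in> carrier M"
    then show "u \<sqsubseteq>\<^bsub>M\<^esub> v \<longleftrightarrow> ?g u \<sqsubseteq>\<^bsub>L\<^esub> ?g v"
      using f(4)[of "?g u" "?g v"] bij_betw_inv_into_right[OF f(3)] bij_betwE[OF g] by simp
  qed
qed

lemma finite_lattice_isomorphic:
  assumes "finite_lattice L" "L \<cong>\<^sub>L M"
  shows "finite_lattice M"
proof -
  obtain f where "lattice M" "bij_betw f (carrier L) (carrier M)"
    using isomorphicE[OF assms(2)] by metis
  then show ?thesis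
    using assms(1) bij_betw_finite[of f "carrier L" "carrier M"]
    by (auto simp: finite_lattice_def finite_lattice_axioms_def bij_betw_def)
qed

lemma card_Con_le_isomorphic:
  assumes M: "finite_lattice M" and iso: "M \<cong>\<^sub>L L"
  shows "num_con L \<le> num_con M"
proof -
  obtain g where lat: "lattice L" and g: "bij_betw g (carrier M) (carrier L)"
    and jm: "\<And>x y. x \<in> carrier M \<Longrightarrow> y \<in> carrier M \<Longrightarrow> g (x \<squnion>\<^bsub>M\<^esub> y) = g x \<squnion>\<^bsub>L\<^esub> g y"
      "\<And>x y. x \<in> carrier M \<Longrightarrow> y \<in> carrier M \<Longrightarrow> g (x \<sqinter>\<^bsub>M\<^esub> y) = g x \<sqinter>\<^bsub>L\<^esub> g y"
    using isomorphicE[OF iso] by metis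
  interpret L: lattice L by fact
  interpret M: finite_lattice M by fact
  have im: "carrier L = g ` carrier M" using g by (simp add: bij_betw_def)
  define pull where "pull \<theta> = {(u, v). u \<in> carrier M \<and> v \<in> carrier M \<and> (g u, g v) \<in> \<theta>}" for \<theta>
  have "pull \<theta> \<in> carrier (Con M)" if "\<theta> \<in> carrier (Con L)" for \<theta>
  proof -
    have \<theta>: "lattice_congruence L \<theta>" using that by (simp add: Con_def)
    have "lattice_congruence M (pull \<theta>)"
    proof (rule M.lattice_congruenceI)
      show "equiv (carrier M) (pull \<theta>)"
      proof (rule equivI)
        show "refl_on (carrier M) (pull \<theta>)"
          using L.congruence_refl[OF \<theta>] im by (auto simp: pull_def refl_on_def)
        show "sym (pull \<theta>)" using L.congruence_sym[OF \<theta>] by (auto simp: pull_def sym_def)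
        show "trans (pull \<theta>)"
          using L.congruence_trans[OF \<theta>] unfolding pull_def trans_def by blast
      qed (auto simp: pull_def)
      fix x y z assume "(x, y) \<in> pull \<theta>" "z \<in> carrier M"
      then have *: "x \<in> carrier M" "y \<in> carrier M" "(g x, g y) \<in> \<theta>" "z \<in> carrier M" "g z \<in> carrier L"
        by (simp_all add: pull_def im)
      show "(z \<squnion>\<^bsub>M\<^esub> x, z \<squnion>\<^bsub>M\<^esub> y) \<in> pull \<theta>" "(z \<sqinter>\<^bsub>M\<^esub> x, z \<sqinter>\<^bsub>M\<^esub> y) \<in> pull \<theta>"
        using * L.congruence_join[OF \<theta> *(3,5)] L.congruence_meet[OF \<theta> *(3,5)]
        by (simp_all add: pull_def jm)
    qed
    then show ?thesis by (simp add: Con_def)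
  qed
  moreover have "inj_on pull (carrier (Con L))"
  proof (rule inj_onI)
    have sub: "\<theta> \<subseteq> \<phi>" if "\<theta> \<in> carrier (Con L)" and eq: "pull \<theta> = pull \<phi>" for \<theta> \<phi>
    proof (rule subrelI)
      fix a b assume ab: "(a, b) \<in> \<theta>"
      then have "a \<in> carrier L" "b \<in> carrier L"
        using L.congruence_carrier[of \<theta> a b] that(1) by (simp_all add: Con_def)
      then obtain u v where uv: "u \<in> carrier M" "a = g u" "v \<in> carrier M" "b = g v"
        unfolding im by blast
      then have "(u, v) \<in> pull \<theta>" using ab by (simp add: pull_def)
      then show "(a, b) \<in> \<phi>" unfolding eq using uv by (simp add: pull_def)
    qed
    fix \<theta> \<phi> assume "\<theta> \<in> carrier (Con L)" "\<phi> \<in> carrier (Con L)" "pull \<theta> = pull \<phi>"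
    then show "\<theta> = \<phi>" using sub[of \<theta> \<phi>] sub[of \<phi> \<theta>] by simp
  qed
  ultimately show ?thesis
    using M.finite_Con by (intro card_inj_on_le[of pull]) auto
qed

lemma card_Con_isomorphic:
  assumes "finite_lattice L" "L \<cong>\<^sub>L M"
  shows "num_con L = num_con M"
  using card_Con_le_isomorphic[OF assms]
    card_Con_le_isomorphic[OF finite_lattice_isomorphic[OF assms] isomorphic_sym[OF assms(2)]] by simp

subsection \<open>Sublattices\<close>

lemma (in lattice) sublattice:
  assumes S: "S \<subseteq> carrier L"
    and closed: "\<And>x y. x \<in> S \<Longrightarrow> y \<in> S \<Longrightarrow> x \<squnion> y \<in> S"
      "\<And>x y. x \<in> S \<Longrightarrow> y \<in> S \<Longrightarrow> x \<sqinter> y \<in> S"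
  shows "lattice (L\<lparr>carrier := S\<rparr>)"
    and "\<And>x y. x \<in> S \<Longrightarrow> y \<in> S \<Longrightarrow> x \<squnion>\<^bsub>L\<lparr>carrier := S\<rparr>\<^esub> y = x \<squnion> y"
    and "\<And>x y. x \<in> S \<Longrightarrow> y \<in> S \<Longrightarrow> x \<sqinter>\<^bsub>L\<lparr>carrier := S\<rparr>\<^esub> y = x \<sqinter> y"
proof -
  let ?S = "L\<lparr>carrier := S\<rparr>"
  have po: "partial_order ?S"
    using weak_partial_order_subset[OF weak_partial_order_axioms S] eq_is_equal
    by (simp add: partial_order_def partial_order_axioms_def)
  interpret S: partial_order ?S by (rule po)
  show lat: "lattice ?S"
  proof
    fix x y assume "x \<in> carrier ?S" "y \<in> carrier ?S"
    then have xy: "x \<in> S" "y \<in> S" "x \<in> carrier L" "y \<in> carrier L" using S by auto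
    have "least ?S (x \<squnion> y) (Upper ?S {x, y})"
    proof (rule least_UpperI)
      fix t assume t: "t \<in> Upper ?S {x, y}"
      then have "t \<in> carrier L" "x \<sqsubseteq> t" "y \<sqsubseteq> t" using xy S by (auto simp: Upper_def)
      then show "x \<squnion> y \<sqsubseteq>\<^bsub>?S\<^esub> t" using join_le[of x t y] xy by simp
    qed (use xy closed(1)[of x y] join_left[of x y] join_right[of x y] in auto)
    then show "\<exists>s. least ?S s (Upper ?S {x, y})" ..
    have "greatest ?S (x \<sqinter> y) (Lower ?S {x, y})"
    proof (rule greatest_LowerI)
      fix t assume t: "t \<in> Lower ?S {x, y}"
      then have "t \<in> carrier L" "t \<sqsubseteq> x" "t \<sqsubseteq> y" using xy S by (auto simp: Lower_def)
      then show "t \<sqsubseteq>\<^bsub>?S\<^esub> x \<sqinter> y" using meet_le[of t x y] xy by simp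
    qed (use xy closed(2)[of x y] meet_left[of x y] meet_right[of x y] in auto)
    then show "\<exists>s. greatest ?S s (Lower ?S {x, y})" ..
  qed
  interpret S: lattice ?S by (rule lat)
  fix x y assume xy: "x \<in> S" "y \<in> S"
  then have C: "x \<in> carrier L" "y \<in> carrier L" using S by auto
  show "x \<squnion>\<^bsub>?S\<^esub> y = x \<squnion> y"
  proof (rule S.join_eqI)
    fix t assume "t \<in> carrier ?S" "x \<sqsubseteq>\<^bsub>?S\<^esub> t" "y \<sqsubseteq>\<^bsub>?S\<^esub> t"
    moreover from this have "t \<in> carrier L" using S by auto
    ultimately show "x \<squnion> y \<sqsubseteq>\<^bsub>?S\<^esub> t" using join_le[of x t y] C by simp
  qed (use xy C closed(1)[OF xy] join_left[of x y] join_right[of x y] in auto)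
  show "x \<sqinter>\<^bsub>?S\<^esub> y = x \<sqinter> y"
  proof (rule S.meet_eqI)
    fix t assume "t \<in> carrier ?S" "t \<sqsubseteq>\<^bsub>?S\<^esub> x" "t \<sqsubseteq>\<^bsub>?S\<^esub> y"
    moreover from this have "t \<in> carrier L" using S by auto
    ultimately show "t \<sqsubseteq>\<^bsub>?S\<^esub> x \<sqinter> y" using meet_le[of t x y] C by simp
  qed (use xy C closed(2)[OF xy] meet_left[of x y] meet_right[of x y] in auto)
qed

lemma (in lattice) congruence_restrict:
  assumes S: "S \<subseteq> carrier L"
    and closed: "\<And>x y. x \<in> S \<Longrightarrow> y \<in> S \<Longrightarrow> x \<squnion> y \<in> S"
      "\<And>x y. x \<in> S \<Longrightarrow> y \<in> S \<Longrightarrow> x \<sqinter> y \<in> S"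
    and \<theta>: "lattice_congruence L \<theta>"
  shows "lattice_congruence (L\<lparr>carrier := S\<rparr>) (\<theta> \<inter> S \<times> S)"
proof -
  have eqv: "equiv S (\<theta> \<inter> S \<times> S)"
  proof (rule equivI)
    show "refl_on S (\<theta> \<inter> S \<times> S)" using congruence_refl[OF \<theta>] S by (auto simp: refl_on_def)
    show "sym (\<theta> \<inter> S \<times> S)" using congruence_sym[OF \<theta>] by (auto simp: sym_def)
    show "trans (\<theta> \<inter> S \<times> S)" using congruence_trans[OF \<theta>] unfolding trans_def by blast
  qed auto
  have comp: "(x \<squnion>\<^bsub>L\<lparr>carrier := S\<rparr>\<^esub> z, y \<squnion>\<^bsub>L\<lparr>carrier := S\<rparr>\<^esub> w) \<in> \<theta> \<inter> S \<times> S \<and>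
      (x \<sqinter>\<^bsub>L\<lparr>carrier := S\<rparr>\<^esub> z, y \<sqinter>\<^bsub>L\<lparr>carrier := S\<rparr>\<^esub> w) \<in> \<theta> \<inter> S \<times> S"
    if "(x, y) \<in> \<theta> \<inter> S \<times> S" "(z, w) \<in> \<theta> \<inter> S \<times> S" for x y z w
  proof -
    have "x \<in> S" "y \<in> S" "z \<in> S" "w \<in> S" using that by auto
    moreover have "(x \<squnion> z, y \<squnion> w) \<in> \<theta>" "(x \<sqinter> z, y \<sqinter> w) \<in> \<theta>"
      using \<theta> that unfolding lattice_congruence_def by blast+
    ultimately show ?thesis by (simp add: closed sublattice(2,3)[OF S closed])
  qed
  show ?thesis
    unfolding lattice_congruence_def
  proof (intro conjI allI impI)
    show "equiv (carrier (L\<lparr>carrier := S\<rparr>)) (\<theta> \<inter> S \<times> S)" using eqv by simp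
  qed (rule comp[THEN conjunct1] comp[THEN conjunct2]; assumption)+
qed

subsection \<open>Cutting a lattice at an element comparable to all others\<close>

locale cut_lattice = finite_lattice +
  fixes c
  assumes cut_carrier: "c \<in> carrier L"
    and cut_comparable: "\<And>x. x \<in> carrier L \<Longrightarrow> x \<sqsubseteq> c \<or> c \<sqsubseteq> x"
begin

abbreviation "lower \<equiv> L\<lparr>carrier := down L c\<rparr>"
abbreviation "upper \<equiv> L\<lparr>carrier := up L c\<rparr>"

lemma down_sublattice: "down L c \<subseteq> carrier L"
  "\<And>x y. x \<in> down L c \<Longrightarrow> y \<in> down L c \<Longrightarrow> x \<squnion> y \<in> down L c"
  "\<And>x y. x \<in> down L c \<Longrightarrow> y \<in> down L c \<Longrightarrow> x \<sqinter> y \<in> down L c"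
proof -
  fix x y assume xy: "x \<in> down L c" "y \<in> down L c"
  then show "x \<squnion> y \<in> down L c" using cut_carrier by (auto simp: down_def join_le_iff)
  show "x \<sqinter> y \<in> down L c"
    using xy cut_carrier meet_left[of x y] le_trans[of "x \<sqinter> y" x c] by (auto simp: down_def)
qed (auto simp: down_def)

lemma up_sublattice: "up L c \<subseteq> carrier L"
  "\<And>x y. x \<in> up L c \<Longrightarrow> y \<in> up L c \<Longrightarrow> x \<squnion> y \<in> up L c"
  "\<And>x y. x \<in> up L c \<Longrightarrow> y \<in> up L c \<Longrightarrow> x \<sqinter> y \<in> up L c"
proof -
  fix x y assume xy: "x \<in> up L c" "y \<in> up L c"
  then show "x \<sqinter> y \<in> up L c" using cut_carrier by (auto simp: up_def le_meet_iff)
  show "x \<squnion> y \<in> up L c"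
    using xy cut_carrier join_left[of x y] le_trans[of c x "x \<squnion> y"] by (auto simp: up_def)
qed (auto simp: up_def)

lemma cut_mem: "c \<in> down L c" "c \<in> up L c"
  using cut_carrier by (auto simp: down_def up_def)

lemma finite_lattice_lower: "finite_lattice lower"
  using sublattice(1)[OF down_sublattice] cut_mem
    finite_subset[OF down_sublattice(1) finite_carrier]
  by (auto simp: finite_lattice_def finite_lattice_axioms_def)

lemma finite_lattice_upper: "finite_lattice upper"
  using sublattice(1)[OF up_sublattice] cut_mem
    finite_subset[OF up_sublattice(1) finite_carrier]
  by (auto simp: finite_lattice_def finite_lattice_axioms_def)

lemma carrier_eq: "carrier L = down L c \<union> up L c"
  using cut_comparable by (auto simp: down_def up_def)

lemma meet_cut: "x \<in> down L c \<Longrightarrow> x \<sqinter> c = x" "x \<in> up L c \<Longrightarrow> x \<sqinter> c = c"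
  using cut_carrier meet_absorb_left meet_absorb_right by (auto simp: down_def up_def)

lemma join_cut: "x \<in> down L c \<Longrightarrow> x \<squnion> c = c" "x \<in> up L c \<Longrightarrow> x \<squnion> c = x"
  using cut_carrier join_absorb_left join_absorb_right by (auto simp: down_def up_def)

lemma down_le_up: "x \<in> down L c \<Longrightarrow> y \<in> up L c \<Longrightarrow> x \<sqsubseteq> y"
  using cut_carrier le_trans[of x c y] by (auto simp: down_def up_def)

lemma cut_join_mixed: "x \<in> down L c \<Longrightarrow> y \<in> up L c \<Longrightarrow> x \<squnion> y = y"
  "x \<in> down L c \<Longrightarrow> y \<in> up L c \<Longrightarrow> y \<squnion> x = y"
  using down_le_up[of x y] join_absorb_right[of x y] join_absorb_left[of x y] carrier_eq
  by (auto intro: join_absorb_left)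

lemma cut_meet_mixed: "x \<in> down L c \<Longrightarrow> y \<in> up L c \<Longrightarrow> x \<sqinter> y = x"
  "x \<in> down L c \<Longrightarrow> y \<in> up L c \<Longrightarrow> y \<sqinter> x = x"
  using down_le_up[of x y] meet_absorb_left[of x y] carrier_eq
  by (auto intro: meet_absorb_right)

text \<open>Meeting and joining with \<open>c\<close> are lattice homomorphisms onto the two parts.\<close>

lemma cut_homomorphisms:
  assumes "x \<in> carrier L" "y \<in> carrier L"
  shows "(x \<squnion> y) \<sqinter> c = (x \<sqinter> c) \<squnion> (y \<sqinter> c)" "(x \<sqinter> y) \<sqinter> c = (x \<sqinter> c) \<sqinter> (y \<sqinter> c)"
    "(x \<squnion> y) \<squnion> c = (x \<squnion> c) \<squnion> (y \<squnion> c)" "(x \<sqinter> y) \<squnion> c = (x \<squnion> c) \<sqinter> (y \<squnion> c)"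
proof -
  note simps = meet_cut join_cut cut_join_mixed cut_meet_mixed down_sublattice(2,3)
    up_sublattice(2,3) cut_mem
  have "x \<in> down L c \<or> x \<in> up L c" "y \<in> down L c \<or> y \<in> up L c"
    using assms carrier_eq by auto
  then show "(x \<squnion> y) \<sqinter> c = (x \<sqinter> c) \<squnion> (y \<sqinter> c)" "(x \<sqinter> y) \<sqinter> c = (x \<sqinter> c) \<sqinter> (y \<sqinter> c)"
    "(x \<squnion> y) \<squnion> c = (x \<squnion> c) \<squnion> (y \<squnion> c)" "(x \<sqinter> y) \<squnion> c = (x \<squnion> c) \<sqinter> (y \<squnion> c)"
    by (elim disjE; simp add: simps)+
qed

lemma cut_parts: "x \<in> carrier L \<Longrightarrow> x \<sqinter> c \<in> down L c" "x \<in> carrier L \<Longrightarrow> x \<squnion> c \<in> up L c"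
  using cut_carrier meet_right join_right by (auto simp: down_def up_def)

lemma congruence_glue:
  assumes \<alpha>: "lattice_congruence lower \<alpha>" and \<beta>: "lattice_congruence upper \<beta>"
  shows "lattice_congruence L
    {(x, y). x \<in> carrier L \<and> y \<in> carrier L \<and> (x \<sqinter> c, y \<sqinter> c) \<in> \<alpha> \<and> (x \<squnion> c, y \<squnion> c) \<in> \<beta>}"
    (is "lattice_congruence L ?\<theta>")
proof -
  interpret A: finite_lattice lower by (rule finite_lattice_lower)
  interpret B: finite_lattice upper by (rule finite_lattice_upper)
  have jm: "x \<squnion>\<^bsub>lower\<^esub> y = x \<squnion> y" "x \<sqinter>\<^bsub>lower\<^esub> y = x \<sqinter> y"
    if "x \<in> down L c" "y \<in> down L c" for x y
    using sublattice(2,3)[OF down_sublattice] that by auto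
  have jm': "x \<squnion>\<^bsub>upper\<^esub> y = x \<squnion> y" "x \<sqinter>\<^bsub>upper\<^esub> y = x \<sqinter> y"
    if "x \<in> up L c" "y \<in> up L c" for x y
    using sublattice(2,3)[OF up_sublattice] that by auto
  show ?thesis
  proof (rule lattice_congruenceI)
    show "equiv (carrier L) ?\<theta>"
    proof (rule equivI)
      show "refl_on (carrier L) ?\<theta>"
        using A.congruence_refl[OF \<alpha>] B.congruence_refl[OF \<beta>] cut_parts by (auto simp: refl_on_def)
      show "sym ?\<theta>"
        using A.congruence_sym[OF \<alpha>] B.congruence_sym[OF \<beta>] by (auto simp: sym_def)
      show "trans ?\<theta>"
        by (rule transI) (auto intro: A.congruence_trans[OF \<alpha>] B.congruence_trans[OF \<beta>])
    qed auto
  next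
    fix x y z assume xy: "(x, y) \<in> ?\<theta>" and z: "z \<in> carrier L"
    then have C: "x \<in> carrier L" "y \<in> carrier L"
      and a: "(x \<sqinter> c, y \<sqinter> c) \<in> \<alpha>" and b: "(x \<squnion> c, y \<squnion> c) \<in> \<beta>" by auto
    note P = cut_parts[OF C(1)] cut_parts[OF C(2)] cut_parts[OF z]
    show "(z \<squnion> x, z \<squnion> y) \<in> ?\<theta>"
      using A.congruence_join[OF \<alpha> a, of "z \<sqinter> c"] B.congruence_join[OF \<beta> b, of "z \<squnion> c"]
        P C z by (simp add: cut_homomorphisms jm jm')
    show "(z \<sqinter> x, z \<sqinter> y) \<in> ?\<theta>"
      using A.congruence_meet[OF \<alpha> a, of "z \<sqinter> c"] B.congruence_meet[OF \<beta> b, of "z \<squnion> c"]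
        P C z by (simp add: cut_homomorphisms jm jm')
  qed
qed

text \<open>If \<open>c\<close> lies between \<open>x\<close> and \<open>y\<close>, the two conditions say that both are identified with \<open>c\<close>.\<close>

lemma congruence_cut_iff:
  assumes \<theta>: "lattice_congruence L \<theta>" and C: "x \<in> carrier L" "y \<in> carrier L"
  shows "(x, y) \<in> \<theta> \<longleftrightarrow> (x \<sqinter> c, y \<sqinter> c) \<in> \<theta> \<and> (x \<squnion> c, y \<squnion> c) \<in> \<theta>"
proof
  assume xy: "(x, y) \<in> \<theta>"
  show "(x \<sqinter> c, y \<sqinter> c) \<in> \<theta> \<and> (x \<squnion> c, y \<squnion> c) \<in> \<theta>"
    using congruence_meet[OF \<theta> xy cut_carrier] congruence_join[OF \<theta> xy cut_carrier]
    by (simp add: meet_comm[of L c] join_comm[of L c])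
next
  assume *: "(x \<sqinter> c, y \<sqinter> c) \<in> \<theta> \<and> (x \<squnion> c, y \<squnion> c) \<in> \<theta>"
  consider "x \<in> down L c" "y \<in> down L c" | "x \<in> up L c" "y \<in> up L c"
    | "x \<in> down L c" "y \<in> up L c" | "x \<in> up L c" "y \<in> down L c"
    using C carrier_eq by auto
  then show "(x, y) \<in> \<theta>"
  proof cases
    case 3
    then show ?thesis using * congruence_trans[OF \<theta>, of x c y] by (simp add: meet_cut join_cut)
  next
    case 4
    then show ?thesis using * congruence_trans[OF \<theta>, of x c y] by (simp add: meet_cut join_cut)
  qed (use * in \<open>simp_all add: meet_cut join_cut\<close>)
qed

text \<open>Restriction to the two parts is a bijection: it is injective because a congruence is recovered from
  its restrictions as in \<open>congruence_cut_iff\<close>, and \<open>congruence_glue\<close> provides preimages.\<close>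

lemma card_Con_cut: "num_con L = num_con lower * num_con upper"
proof -
  let ?D = "down L c" and ?U = "up L c"
  let ?F = "\<lambda>\<theta>. (\<theta> \<inter> ?D \<times> ?D, \<theta> \<inter> ?U \<times> ?U)"
  have "bij_betw ?F (carrier (Con L)) (carrier (Con lower) \<times> carrier (Con upper))"
  proof (rule bij_betw_imageI)
    have sub: "\<theta> \<subseteq> \<phi>" if \<theta>: "lattice_congruence L \<theta>" and \<phi>: "lattice_congruence L \<phi>" and F: "?F \<theta> = ?F \<phi>"
      for \<theta> \<phi>
    proof (rule subrelI)
      fix x y assume xy: "(x, y) \<in> \<theta>"
      note C = congruence_carrier[OF \<theta> xy]
      have "(x \<sqinter> c, y \<sqinter> c) \<in> \<theta> \<inter> ?D \<times> ?D" "(x \<squnion> c, y \<squnion> c) \<in> \<theta> \<inter> ?U \<times> ?U"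
        using congruence_cut_iff[OF \<theta> C] xy cut_parts[OF C(1)] cut_parts[OF C(2)] by auto
      then have "(x \<sqinter> c, y \<sqinter> c) \<in> \<phi>" "(x \<squnion> c, y \<squnion> c) \<in> \<phi>" using F by auto
      then show "(x, y) \<in> \<phi>" using congruence_cut_iff[OF \<phi> C] by simp
    qed
    show "inj_on ?F (carrier (Con L))"
      by (rule inj_onI, rule subset_antisym; rule sub) (auto simp: Con_def)
  next
    show "?F ` carrier (Con L) = carrier (Con lower) \<times> carrier (Con upper)"
    proof
      show "?F ` carrier (Con L) \<subseteq> carrier (Con lower) \<times> carrier (Con upper)"
        using congruence_restrict[OF down_sublattice] congruence_restrict[OF up_sublattice]
        by (auto simp: Con_def)
      show "carrier (Con lower) \<times> carrier (Con upper) \<subseteq> ?F ` carrier (Con L)"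
      proof
        fix p assume "p \<in> carrier (Con lower) \<times> carrier (Con upper)"
        then obtain \<alpha> \<beta> where p: "p = (\<alpha>, \<beta>)"
          and \<alpha>: "lattice_congruence lower \<alpha>" and \<beta>: "lattice_congruence upper \<beta>"
          by (auto simp: Con_def)
        let ?\<theta> = "{(x, y). x \<in> carrier L \<and> y \<in> carrier L \<and> (x \<sqinter> c, y \<sqinter> c) \<in> \<alpha> \<and> (x \<squnion> c, y \<squnion> c) \<in> \<beta>}"
        interpret A: finite_lattice lower by (rule finite_lattice_lower)
        interpret B: finite_lattice upper by (rule finite_lattice_upper)
        have "(c, c) \<in> \<alpha>" "(c, c) \<in> \<beta>"
          using A.congruence_refl[OF \<alpha>] B.congruence_refl[OF \<beta>] cut_mem by auto
        moreover have "\<alpha> \<subseteq> ?D \<times> ?D" "\<beta> \<subseteq> ?U \<times> ?U"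
          using A.congruence_carrier[OF \<alpha>] B.congruence_carrier[OF \<beta>] by auto
        ultimately have "?F ?\<theta> = p"
          using down_sublattice(1) up_sublattice(1)
          by (auto simp: p meet_cut join_cut)
        then show "p \<in> ?F ` carrier (Con L)"
          using congruence_glue[OF \<alpha> \<beta>] by (auto simp: Con_def intro!: image_eqI[of _ _ ?\<theta>])
      qed
    qed
  qed
  then show ?thesis by (simp add: bij_betw_same_card card_cartesian_product)
qed

end

subsection \<open>Ordinal sums\<close>

locale two_finite_lattices = A: finite_lattice A + B: finite_lattice B
  for A :: "('a, 'r) gorder_scheme" and B :: "('b, 's) gorder_scheme"
begin

abbreviation "AB \<equiv> A \<^bold>+ B"
abbreviation "emb \<equiv> upper_emb A B"

lemma emb_eq_iff: "emb x = emb y \<longleftrightarrow> x = y"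
  by (auto simp: upper_emb_def)

lemma Inl_eq_emb_iff: "Inl x = emb y \<longleftrightarrow> x = \<top>\<^bsub>A\<^esub> \<and> y = \<bottom>\<^bsub>B\<^esub>"
  by (auto simp: upper_emb_def)

lemma sum_carrier: "carrier AB = Inl ` carrier A \<union> emb ` carrier B"
  by (simp add: ordinal_sum_def)

lemma sum_eq: "(.=\<^bsub>AB\<^esub>) = (=)"
  by (simp add: ordinal_sum_def)

lemma sum_le_Inl:
  "x \<in> carrier A \<Longrightarrow> y \<in> carrier A \<Longrightarrow> Inl x \<sqsubseteq>\<^bsub>AB\<^esub> Inl y \<longleftrightarrow> x \<sqsubseteq>\<^bsub>A\<^esub> y"
  by (auto simp: ordinal_sum_def Inl_eq_emb_iff)

lemma sum_le_emb:
  "x \<in> carrier B \<Longrightarrow> y \<in> carrier B \<Longrightarrow> emb x \<sqsubseteq>\<^bsub>AB\<^esub> emb y \<longleftrightarrow> x \<sqsubseteq>\<^bsub>B\<^esub> y"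
  by (auto simp: ordinal_sum_def emb_eq_iff Inl_eq_emb_iff eq_commute[of "upper_emb A B _" "Inl _"])

lemma sum_le_Inl_emb:
  "x \<in> carrier A \<Longrightarrow> y \<in> carrier B \<Longrightarrow> Inl x \<sqsubseteq>\<^bsub>AB\<^esub> emb y"
  by (auto simp: ordinal_sum_def)

lemma sum_le_emb_Inl:
  assumes "x \<in> carrier A" "y \<in> carrier B"
  shows "emb y \<sqsubseteq>\<^bsub>AB\<^esub> Inl x \<longleftrightarrow> x = \<top>\<^bsub>A\<^esub> \<and> y = \<bottom>\<^bsub>B\<^esub>"
proof
  assume "x = \<top>\<^bsub>A\<^esub> \<and> y = \<bottom>\<^bsub>B\<^esub>"
  then show "emb y \<sqsubseteq>\<^bsub>AB\<^esub> Inl x" using sum_le_Inl[of x x] assms by (simp add: upper_emb_def)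
next
  assume "emb y \<sqsubseteq>\<^bsub>AB\<^esub> Inl x"
  then show "x = \<top>\<^bsub>A\<^esub> \<and> y = \<bottom>\<^bsub>B\<^esub>"
    using assms A.top_eq[of x] B.bottom_eq[of y]
    by (auto simp: ordinal_sum_def emb_eq_iff Inl_eq_emb_iff eq_commute[of "upper_emb A B _" "Inl _"]
        intro!: A.le_antisym B.le_antisym)
qed

lemmas sum_le = sum_le_Inl sum_le_emb sum_le_Inl_emb sum_le_emb_Inl

lemma sum_cases:
  assumes "u \<in> carrier AB"
  obtains x where "x \<in> carrier A" "u = Inl x" | y where "y \<in> carrier B" "u = emb y"
  using assms by (auto simp: sum_carrier)

text \<open>The order of the ordinal sum is induced from the product \<open>A \<times> B\<close>: the lower summand is
  embedded as \<open>A \<times> {\<bottom>}\<close> and the upper one as \<open>{\<top>} \<times> B\<close>.\<close>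

definition lo :: "'a + 'b \<Rightarrow> 'a" where "lo u = (case u of Inl x \<Rightarrow> x | Inr y \<Rightarrow> \<top>\<^bsub>A\<^esub>)"
definition hi :: "'a + 'b \<Rightarrow> 'b" where "hi u = (case u of Inl x \<Rightarrow> \<bottom>\<^bsub>B\<^esub> | Inr y \<Rightarrow> y)"

lemma lo_hi: "lo (Inl x) = x" "hi (Inl x) = \<bottom>\<^bsub>B\<^esub>" "lo (emb y) = \<top>\<^bsub>A\<^esub>" "hi (emb y) = y"
  by (auto simp: lo_def hi_def upper_emb_def)

lemma lo_hi_closed:
  assumes "u \<in> carrier AB"
  shows "lo u \<in> carrier A" "hi u \<in> carrier B"
proof -
  consider x where "x \<in> carrier A" "u = Inl x" | y where "y \<in> carrier B" "u = emb y"
    using sum_cases[OF assms] by metis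
  then have "lo u \<in> carrier A \<and> hi u \<in> carrier B"
  proof cases
    case 1
    then show ?thesis using B.bottom_closed by (simp only: lo_hi simp_thms)
  next
    case 2
    then show ?thesis using A.top_closed by (simp only: lo_hi simp_thms)
  qed
  then show "lo u \<in> carrier A" "hi u \<in> carrier B" by simp_all
qed

lemma lo_hi_inject:
  assumes "u \<in> carrier AB" "v \<in> carrier AB" "lo u = lo v" "hi u = hi v"
  shows "u = v"
  using assms by (auto simp: sum_carrier lo_def hi_def upper_emb_def split: if_splits)

lemma sum_le_iff:
  assumes "u \<in> carrier AB" "v \<in> carrier AB"
  shows "u \<sqsubseteq>\<^bsub>AB\<^esub> v \<longleftrightarrow> lo u \<sqsubseteq>\<^bsub>A\<^esub> lo v \<and> hi u \<sqsubseteq>\<^bsub>B\<^esub> hi v"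
proof -
  have "\<top>\<^bsub>A\<^esub> \<sqsubseteq>\<^bsub>A\<^esub> x \<longleftrightarrow> x = \<top>\<^bsub>A\<^esub>" if "x \<in> carrier A" for x
    using that A.le_antisym[of x "\<top>\<^bsub>A\<^esub>"] A.top_higher by auto
  moreover have "y \<sqsubseteq>\<^bsub>B\<^esub> \<bottom>\<^bsub>B\<^esub> \<longleftrightarrow> y = \<bottom>\<^bsub>B\<^esub>" if "y \<in> carrier B" for y
    using that B.le_antisym[of y "\<bottom>\<^bsub>B\<^esub>"] B.bottom_lower by auto
  ultimately show ?thesis
    by (cases rule: sum_cases[OF assms(1)]; cases rule: sum_cases[OF assms(2)])
      (simp_all add: sum_le lo_hi A.top_higher B.bottom_lower)
qed

lemma partial_order_sum: "partial_order AB"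
proof
  fix u v w
  assume C: "u \<in> carrier AB" "v \<in> carrier AB" "w \<in> carrier AB"
    and le: "u \<sqsubseteq>\<^bsub>AB\<^esub> v" "v \<sqsubseteq>\<^bsub>AB\<^esub> w"
  show "u \<sqsubseteq>\<^bsub>AB\<^esub> w"
    using C le A.le_trans[of "lo u" "lo v" "lo w"] B.le_trans[of "hi u" "hi v" "hi w"]
    by (simp add: sum_le_iff lo_hi_closed)
next
  fix u v
  assume C: "u \<in> carrier AB" "v \<in> carrier AB"
    and le: "u \<sqsubseteq>\<^bsub>AB\<^esub> v" "v \<sqsubseteq>\<^bsub>AB\<^esub> u"
  show "u .=\<^bsub>AB\<^esub> v"
    using C le A.le_antisym[of "lo u" "lo v"] B.le_antisym[of "hi u" "hi v"]
    by (simp add: sum_eq sum_le_iff lo_hi_closed lo_hi_inject)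
qed (simp_all add: sum_eq sum_le_iff lo_hi_closed)

lemma lo_hi_dichotomy: "u \<in> carrier AB \<Longrightarrow> hi u = \<bottom>\<^bsub>B\<^esub> \<or> lo u = \<top>\<^bsub>A\<^esub>"
  by (elim sum_cases) (simp_all add: lo_hi)

text \<open>The image of the embedding consists of the pairs with \<open>\<bottom>\<close> in the second or \<open>\<top>\<close> in the first
  component; it is closed under componentwise joins and meets.\<close>

lemma lo_hi_exists:
  assumes "a \<in> carrier A" "b \<in> carrier B" "b = \<bottom>\<^bsub>B\<^esub> \<or> a = \<top>\<^bsub>A\<^esub>"
  obtains w where "w \<in> carrier AB" "lo w = a" "hi w = b"
proof (cases "b = \<bottom>\<^bsub>B\<^esub>")
  case True
  have "Inl a \<in> carrier AB" using assms(1) by (simp add: sum_carrier)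
  then show ?thesis using that lo_hi(1,2) True by metis
next
  case False
  have "emb b \<in> carrier AB" using assms(2) by (simp add: sum_carrier)
  then show ?thesis using that lo_hi(3,4) assms(3) False by metis
qed

lemma lattice_sum: "lattice AB"
proof -
  interpret S: partial_order "AB" by (rule partial_order_sum)
  show ?thesis
  proof
    fix u v assume C: "u \<in> carrier AB" "v \<in> carrier AB"
    note c = lo_hi_closed[OF C(1)] lo_hi_closed[OF C(2)]
    note d = lo_hi_dichotomy[OF C(1)] lo_hi_dichotomy[OF C(2)]
    have "hi u \<squnion>\<^bsub>B\<^esub> hi v = \<bottom>\<^bsub>B\<^esub> \<or> lo u \<squnion>\<^bsub>A\<^esub> lo v = \<top>\<^bsub>A\<^esub>"
      using d c B.join_absorb_left[of "hi u" "hi u"] A.join_absorb_left[OF A.top_higher, of "lo v"]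
        A.join_absorb_right[OF A.top_higher, of "lo u"] by auto
    then obtain w where w: "w \<in> carrier AB" "lo w = lo u \<squnion>\<^bsub>A\<^esub> lo v" "hi w = hi u \<squnion>\<^bsub>B\<^esub> hi v"
      using lo_hi_exists[of "lo u \<squnion>\<^bsub>A\<^esub> lo v" "hi u \<squnion>\<^bsub>B\<^esub> hi v"] c by auto
    have iff: "w \<sqsubseteq>\<^bsub>AB\<^esub> t \<longleftrightarrow> u \<sqsubseteq>\<^bsub>AB\<^esub> t \<and> v \<sqsubseteq>\<^bsub>AB\<^esub> t" if "t \<in> carrier AB" for t
      using that w C c lo_hi_closed[OF that] by (auto simp: sum_le_iff A.join_le_iff B.join_le_iff)
    then have "least AB w (Upper AB {u, v})"
      using w(1) C iff iff[OF w(1)] S.le_refl[OF w(1)] by (auto simp: least_def Upper_def)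
    then show "\<exists>s. least AB s (Upper AB {u, v})" ..
    have "hi u \<sqinter>\<^bsub>B\<^esub> hi v = \<bottom>\<^bsub>B\<^esub> \<or> lo u \<sqinter>\<^bsub>A\<^esub> lo v = \<top>\<^bsub>A\<^esub>"
      using d c A.meet_absorb_left[of "lo u" "lo u"] B.meet_absorb_left[OF B.bottom_lower, of "hi v"]
        B.meet_absorb_right[OF B.bottom_lower, of "hi u"] by auto
    then obtain w where w: "w \<in> carrier AB" "lo w = lo u \<sqinter>\<^bsub>A\<^esub> lo v" "hi w = hi u \<sqinter>\<^bsub>B\<^esub> hi v"
      using lo_hi_exists[of "lo u \<sqinter>\<^bsub>A\<^esub> lo v" "hi u \<sqinter>\<^bsub>B\<^esub> hi v"] c by auto
    have iff: "t \<sqsubseteq>\<^bsub>AB\<^esub> w \<longleftrightarrow> t \<sqsubseteq>\<^bsub>AB\<^esub> u \<and> t \<sqsubseteq>\<^bsub>AB\<^esub> v" if "t \<in> carrier AB" for t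
      using that w C c lo_hi_closed[OF that] by (auto simp: sum_le_iff A.le_meet_iff B.le_meet_iff)
    then have "greatest AB w (Lower AB {u, v})"
      using w(1) C iff iff[OF w(1)] S.le_refl[OF w(1)] by (auto simp: greatest_def Lower_def)
    then show "\<exists>s. greatest AB s (Lower AB {u, v})" ..
  qed
qed

lemma finite_lattice_sum: "finite_lattice AB"
  using lattice_sum A.finite_carrier B.finite_carrier A.carrier_nonempty
  by (simp add: finite_lattice_def finite_lattice_axioms_def sum_carrier)

lemma cut_lattice_sum: "cut_lattice AB (Inl \<top>\<^bsub>A\<^esub>)"
proof -
  have "x \<sqsubseteq>\<^bsub>AB\<^esub> Inl \<top>\<^bsub>A\<^esub> \<or> Inl \<top>\<^bsub>A\<^esub> \<sqsubseteq>\<^bsub>AB\<^esub> x" if "x \<in> carrier AB" for x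
    using that by (elim sum_cases) (auto simp: sum_le A.top_higher)
  then show ?thesis
    using finite_lattice_sum by (simp add: cut_lattice_def cut_lattice_axioms_def sum_carrier)
qed

lemma down_sum: "down AB (Inl \<top>\<^bsub>A\<^esub>) = Inl ` carrier A"
proof
  show "down AB (Inl \<top>\<^bsub>A\<^esub>) \<subseteq> Inl ` carrier A"
  proof
    fix u assume u: "u \<in> down AB (Inl \<top>\<^bsub>A\<^esub>)"
    then have "u \<in> carrier AB" by (simp add: down_def)
    then show "u \<in> Inl ` carrier A"
    proof (cases rule: sum_cases)
      case (2 y)
      then have "y = \<bottom>\<^bsub>B\<^esub>"
        using u sum_le_emb_Inl[OF A.top_closed 2(1)] by (simp only: down_def mem_Collect_eq simp_thms)
      then have "u = Inl \<top>\<^bsub>A\<^esub>" using 2(2) by (simp only: upper_emb_def if_True simp_thms)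
      then show ?thesis using A.top_closed by blast
    qed simp
  qed
  show "Inl ` carrier A \<subseteq> down AB (Inl \<top>\<^bsub>A\<^esub>)"
  proof (rule image_subsetI)
    fix x assume x: "x \<in> carrier A"
    then show "Inl x \<in> down AB (Inl \<top>\<^bsub>A\<^esub>)"
      using sum_le_Inl[OF x A.top_closed] A.top_higher[OF x]
      by (simp add: down_def sum_carrier)
  qed
qed

lemma up_sum: "up AB (Inl \<top>\<^bsub>A\<^esub>) = emb ` carrier B"
proof
  show "up AB (Inl \<top>\<^bsub>A\<^esub>) \<subseteq> emb ` carrier B"
  proof
    fix u assume u: "u \<in> up AB (Inl \<top>\<^bsub>A\<^esub>)"
    then have "u \<in> carrier AB" by (simp add: up_def)
    then show "u \<in> emb ` carrier B"
    proof (cases rule: sum_cases)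
      case (1 x)
      then have "\<top>\<^bsub>A\<^esub> \<sqsubseteq>\<^bsub>A\<^esub> x"
        using u sum_le_Inl[OF A.top_closed 1(1)] by (simp only: up_def mem_Collect_eq simp_thms)
      then have "x = \<top>\<^bsub>A\<^esub>" using A.le_antisym[OF A.top_higher] 1(1) A.top_closed by metis
      then have "u = emb \<bottom>\<^bsub>B\<^esub>" using 1(2) by (simp only: upper_emb_def if_True simp_thms)
      then show ?thesis using B.bottom_closed by blast
    qed simp
  qed
  show "emb ` carrier B \<subseteq> up AB (Inl \<top>\<^bsub>A\<^esub>)"
  proof (rule image_subsetI)
    fix y assume y: "y \<in> carrier B"
    then show "emb y \<in> up AB (Inl \<top>\<^bsub>A\<^esub>)"
      using sum_le_Inl_emb[OF A.top_closed y] by (simp add: up_def sum_carrier)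
  qed
qed

text \<open>The sum is cut at the common element into copies of its summands.\<close>

lemma card_Con_sum: "num_con AB = num_con A * num_con B"
proof -
  interpret S: cut_lattice "AB" "Inl \<top>\<^bsub>A\<^esub>" by (rule cut_lattice_sum)
  have A: "A \<cong>\<^sub>L S.lower"
  proof (rule isomorphic_if_order_isomorphic[OF A.lattice_axioms])
    show "bij_betw Inl (carrier A) (carrier S.lower)"
      unfolding bij_betw_def by (simp add: down_sum)
    show "(.=\<^bsub>S.lower\<^esub>) = (=)" using sum_eq by simp
    show "x \<sqsubseteq>\<^bsub>A\<^esub> y \<longleftrightarrow> Inl x \<sqsubseteq>\<^bsub>S.lower\<^esub> Inl y" if "x \<in> carrier A" "y \<in> carrier A" for x y
      using sum_le_Inl[OF that] by simp
  qed
  have B: "B \<cong>\<^sub>L S.upper"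
  proof (rule isomorphic_if_order_isomorphic[OF B.lattice_axioms])
    show "bij_betw emb (carrier B) (carrier S.upper)"
      unfolding bij_betw_def using emb_eq_iff by (simp add: up_sum inj_on_def)
    show "(.=\<^bsub>S.upper\<^esub>) = (=)" using sum_eq by simp
    show "x \<sqsubseteq>\<^bsub>B\<^esub> y \<longleftrightarrow> emb x \<sqsubseteq>\<^bsub>S.upper\<^esub> emb y" if "x \<in> carrier B" "y \<in> carrier B" for x y
      using sum_le_emb[OF that] by simp
  qed
  show ?thesis
    using S.card_Con_cut card_Con_isomorphic[OF A.finite_lattice_axioms A]
      card_Con_isomorphic[OF B.finite_lattice_axioms B] by simp
qed

end

text \<open>The cutting element \<open>c\<close> is the top of the lower and the bottom of the upper part, which are the
  two elements identified in the ordinal sum.\<close>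

lemma (in cut_lattice) ordinal_sum_if_parts_isomorphic:
  assumes A: "lower \<cong>\<^sub>L A" and B: "upper \<cong>\<^sub>L B"
  shows "L \<cong>\<^sub>L A \<^bold>+ B"
proof -
  interpret A: finite_lattice A using finite_lattice_isomorphic[OF finite_lattice_lower A] .
  interpret B: finite_lattice B using finite_lattice_isomorphic[OF finite_lattice_upper B] .
  obtain f where f: "bij_betw f (down L c) (carrier A)"
    and f_le: "\<And>x y. x \<in> down L c \<Longrightarrow> y \<in> down L c \<Longrightarrow> x \<sqsubseteq> y \<longleftrightarrow> f x \<sqsubseteq>\<^bsub>A\<^esub> f y"
    using isomorphicE[OF A] by simp metis
  obtain g where g: "bij_betw g (up L c) (carrier B)"
    and g_le: "\<And>x y. x \<in> up L c \<Longrightarrow> y \<in> up L c \<Longrightarrow> x \<sqsubseteq> y \<longleftrightarrow> g x \<sqsubseteq>\<^bsub>B\<^esub> g y"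
    using isomorphicE[OF B] by simp metis
  have fim: "f ` down L c = carrier A" and gim: "g ` up L c = carrier B"
    and finj: "inj_on f (down L c)" and ginj: "inj_on g (up L c)"
    using f g by (auto simp: bij_betw_def)
  have fc: "f c = \<top>\<^bsub>A\<^esub>"
  proof (rule A.top_eq)
    show "f c \<in> carrier A" using fim cut_mem by blast
    fix a assume "a \<in> carrier A"
    then obtain x where "x \<in> down L c" "a = f x" using fim by blast
    then show "a \<sqsubseteq>\<^bsub>A\<^esub> f c" using f_le[of x c] cut_mem by (simp add: down_def)
  qed
  have gc: "g c = \<bottom>\<^bsub>B\<^esub>"
  proof (rule B.bottom_eq)
    show "g c \<in> carrier B" using gim cut_mem by blast
    fix b assume "b \<in> carrier B"
    then obtain x where "x \<in> up L c" "b = g x" using gim by blast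
    then show "g c \<sqsubseteq>\<^bsub>B\<^esub> b" using g_le[of c x] cut_mem by (simp add: up_def)
  qed
  define h where "h x = (if x \<sqsubseteq> c then Inl (f x) else Inr (g x))" for x
  have h_down: "h x = Inl (f x)" if "x \<in> down L c" for x
    using that by (simp add: h_def down_def)
  have h_up: "h x = upper_emb A B (g x)" if x: "x \<in> up L c" for x
  proof (cases "x = c")
    case True
    then show ?thesis using cut_carrier by (simp add: h_def upper_emb_def fc gc)
  next
    case False
    then have "\<not> x \<sqsubseteq> c" using x cut_carrier le_antisym by (auto simp: up_def)
    moreover have "g x \<noteq> \<bottom>\<^bsub>B\<^esub>" using False x ginj gc cut_mem by (metis inj_onD)
    ultimately show ?thesis by (simp add: h_def upper_emb_def)
  qed
  have inj: "inj_on h (carrier L)"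
  proof (rule inj_onI)
    fix x y assume *: "x \<in> carrier L" "y \<in> carrier L" "h x = h y"
    show "x = y"
    proof (cases "x \<sqsubseteq> c")
      case True
      then have "y \<sqsubseteq> c" "f x = f y" using *(3) by (auto simp: h_def split: if_splits)
      then show ?thesis using True * inj_onD[OF finj, of x y] by (simp add: down_def)
    next
      case False
      then have "\<not> y \<sqsubseteq> c" "g x = g y" using *(3) by (auto simp: h_def split: if_splits)
      then show ?thesis
        using False * inj_onD[OF ginj, of x y] cut_comparable[of x] cut_comparable[of y]
        by (simp add: up_def)
    qed
  qed
  interpret AB: two_finite_lattices A B ..
  have "h ` down L c = Inl ` carrier A"
    using h_down fim by (auto simp: image_iff)
  moreover have "h ` up L c = upper_emb A B ` carrier B"
    unfolding gim[symmetric] image_image by (rule image_cong) (simp_all add: h_up)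
  ultimately have bij: "bij_betw h (carrier L) (carrier (A \<^bold>+ B))"
    using inj carrier_eq by (simp add: bij_betw_def AB.sum_carrier image_Un)
  show ?thesis
  proof (rule isomorphic_if_order_isomorphic[OF lattice_axioms bij AB.sum_eq])
    fix x y assume C: "x \<in> carrier L" "y \<in> carrier L"
    consider (dd) "x \<in> down L c" "y \<in> down L c" | (uu) "x \<in> up L c" "y \<in> up L c"
      | (du) "x \<in> down L c" "y \<in> up L c"
      | (ud) "\<not> x \<sqsubseteq> c" "x \<in> up L c" "y \<in> down L c"
      using C cut_comparable[of x] cut_comparable[of y] by (auto simp: down_def up_def)
    then show "x \<sqsubseteq> y \<longleftrightarrow> h x \<sqsubseteq>\<^bsub>A \<^bold>+ B\<^esub> h y"
    proof cases
      case dd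
      then have "f x \<in> carrier A" "f y \<in> carrier A" using fim by auto
      then show ?thesis using dd by (simp add: h_down AB.sum_le_Inl f_le)
    next
      case uu
      then have "g x \<in> carrier B" "g y \<in> carrier B" using gim by auto
      then show ?thesis using uu by (simp add: h_up AB.sum_le_emb g_le)
    next
      case du
      then have "f x \<in> carrier A" "g y \<in> carrier B" using fim gim by auto
      then show ?thesis using du by (simp add: h_down h_up AB.sum_le_Inl_emb down_le_up)
    next
      case ud
      then have "f y \<in> carrier A" "g x \<in> carrier B" using fim gim by auto
      moreover have "\<not> x \<sqsubseteq> y"
        using ud C cut_carrier le_trans[of x y c] by (auto simp: down_def)
      moreover have "x \<noteq> c" using ud(1) cut_carrier by auto
      then have "g x \<noteq> \<bottom>\<^bsub>B\<^esub>" using inj_onD[OF ginj, of x c] ud(2) cut_mem gc by auto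
      ultimately show ?thesis using ud(2,3) by (simp add: h_down h_up AB.sum_le_emb_Inl)
    qed
  qed
qed

section \<open>Chains, grids and the pentagon\<close>

lemma (in finite_lattice) join_primeI:
  assumes "j \<in> carrier L"
    and chain: "\<And>x y. x \<in> carrier L \<Longrightarrow> y \<in> carrier L \<Longrightarrow> \<not> j \<sqsubseteq> x \<Longrightarrow> \<not> j \<sqsubseteq> y \<Longrightarrow> x \<sqsubseteq> y \<or> y \<sqsubseteq> x"
  shows "join_prime L j"
  unfolding join_prime_def
proof (intro ballI impI)
  fix x y assume C: "x \<in> carrier L" "y \<in> carrier L" and le: "j \<sqsubseteq> x \<squnion> y"
  show "j \<sqsubseteq> x \<or> j \<sqsubseteq> y"
  proof (rule ccontr)
    assume n: "\<not> ?thesis"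
    then have "x \<sqsubseteq> y \<or> y \<sqsubseteq> x" using chain[OF C] by simp
    then have "x \<squnion> y = y \<or> x \<squnion> y = x"
      using join_absorb_left[of y x] join_absorb_right[of x y] C by blast
    then show False using n le by auto
  qed
qed

lemma (in finite_lattice) card_Con_totally_ordered:
  assumes "totally_ordered L (carrier L)"
  shows "num_con L = 2 ^ (card (carrier L) - 1)"
proof -
  have total: "x \<sqsubseteq> y \<or> y \<sqsubseteq> x" if "x \<in> carrier L" "y \<in> carrier L" for x y
    using assms that by (simp add: totally_ordered_def)
  have "join_reducibles L = {}"
  proof (rule equals0I)
    fix r assume "r \<in> join_reducibles L"
    then show False using total by (elim join_reducibleE) blast
  qed
  then have "card (join_irreducibles L) = card (carrier L) - 1" using card_carrier by simp
  moreover have "join_prime L j" if "j \<in> join_irreducibles L" for j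
    using join_primeI[OF join_irreducible_carrier[OF that] total] by blast
  ultimately show ?thesis using card_Con_if_all_join_prime by simp
qed

lemma carrier_chain: "carrier (chain m) = {..<m}"
  and le_chain: "x \<sqsubseteq>\<^bsub>chain m\<^esub> y \<longleftrightarrow> x \<le> y"
  and eq_chain: "(.=\<^bsub>chain m\<^esub>) = (=)"
  by (simp_all add: chain_def)

lemma lattice_chain: "lattice (chain m)"
proof -
  interpret partial_order "chain m"
    by unfold_locales (auto simp: chain_def)
  interpret total_order "chain m"
    by (rule total_orderI) (auto simp: chain_def)
  show ?thesis by unfold_locales
qed

lemma finite_lattice_chain: "m \<ge> 1 \<Longrightarrow> finite_lattice (chain m)"
  using lattice_chain
  by (auto simp: finite_lattice_def finite_lattice_axioms_def carrier_chain lessThan_empty_iff)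

lemma card_Con_chain: "m \<ge> 1 \<Longrightarrow> num_con (chain m) = 2 ^ (m - 1)"
proof -
  assume m: "m \<ge> 1"
  have "totally_ordered (chain m) (carrier (chain m))"
    by (auto simp: totally_ordered_def le_chain)
  from finite_lattice.card_Con_totally_ordered[OF finite_lattice_chain[OF m] this]
  show ?thesis by (simp add: carrier_chain)
qed

lemma (in lattice) sublattice_totally_ordered:
  assumes "S \<subseteq> carrier L" "totally_ordered L S"
  shows "lattice (L\<lparr>carrier := S\<rparr>)"
proof (rule sublattice(1)[OF assms(1)])
  fix x y assume xy: "x \<in> S" "y \<in> S"
  then have cmp: "x \<sqsubseteq> y \<or> y \<sqsubseteq> x" and C: "x \<in> carrier L" "y \<in> carrier L"
    using assms(1) assms(2)[unfolded totally_ordered_def] by blast+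
  have "x \<squnion> y = y \<or> x \<squnion> y = x" "x \<sqinter> y = x \<or> x \<sqinter> y = y"
    using cmp C join_absorb_right[of x y] join_absorb_left[of y x]
      meet_absorb_left[of x y] meet_absorb_right[of y x] by blast+
  with xy show "x \<squnion> y \<in> S" "x \<sqinter> y \<in> S" by auto
qed

text \<open>The isomorphism sends an element to the number of elements strictly below it.\<close>

lemma (in finite_lattice) totally_ordered_isomorphic_chain:
  assumes S: "S \<subseteq> carrier L" and total: "totally_ordered L S"
  shows "L\<lparr>carrier := S\<rparr> \<cong>\<^sub>L chain (card S)"
proof -
  define rank where "rank x = card {z \<in> S. z \<sqsubseteq> x \<and> z \<noteq> x}" for x
  have fin: "finite S" using S finite_carrier finite_subset by blast
  have less: "rank x < rank y" if xy: "x \<in> S" "y \<in> S" "x \<sqsubseteq> y" "x \<noteq> y" for x y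
    unfolding rank_def
  proof (rule psubset_card_mono)
    have C: "x \<in> carrier L" "y \<in> carrier L" using xy S by auto
    have "\<not> y \<sqsubseteq> x" using xy(3,4) C le_antisym by blast
    moreover have "z \<sqsubseteq> y" if "z \<in> S" "z \<sqsubseteq> x" for z
      using le_trans[of z x y] that xy(3) C S by auto
    ultimately have "{z \<in> S. z \<sqsubseteq> x \<and> z \<noteq> x} \<subseteq> {z \<in> S. z \<sqsubseteq> y \<and> z \<noteq> y}" by auto
    moreover have "x \<in> {z \<in> S. z \<sqsubseteq> y \<and> z \<noteq> y}" "x \<notin> {z \<in> S. z \<sqsubseteq> x \<and> z \<noteq> x}" using xy by auto
    ultimately show "{z \<in> S. z \<sqsubseteq> x \<and> z \<noteq> x} \<subset> {z \<in> S. z \<sqsubseteq> y \<and> z \<noteq> y}" by blast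
  qed (use fin in simp)
  have cmp: "x \<sqsubseteq> y \<or> y \<sqsubseteq> x" if "x \<in> S" "y \<in> S" for x y
    using total that by (simp add: totally_ordered_def)
  have inj: "inj_on rank S"
  proof (rule inj_onI)
    fix x y assume "x \<in> S" "y \<in> S" "rank x = rank y"
    then show "x = y" using less[of x y] less[of y x] cmp[of x y] by auto
  qed
  have "rank ` S \<subseteq> {..<card S}"
  proof (rule image_subsetI)
    fix x assume x: "x \<in> S"
    have "{z \<in> S. z \<sqsubseteq> x \<and> z \<noteq> x} \<subset> S" using x by auto
    then show "rank x \<in> {..<card S}" using psubset_card_mono[OF fin] by (simp add: rank_def)
  qed
  then have "rank ` S = {..<card S}"
    using inj by (intro card_subset_eq) (auto simp: card_image)
  with inj have bij: "bij_betw rank (carrier (L\<lparr>carrier := S\<rparr>)) (carrier (chain (card S)))"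
    by (simp add: bij_betw_def carrier_chain)
  show ?thesis
  proof (rule isomorphic_if_order_isomorphic[OF sublattice_totally_ordered[OF S total] bij eq_chain])
    fix x y assume "x \<in> carrier (L\<lparr>carrier := S\<rparr>)" "y \<in> carrier (L\<lparr>carrier := S\<rparr>)"
    then have xy: "x \<in> S" "y \<in> S" by simp_all
    have "x \<sqsubseteq> y \<longleftrightarrow> rank x \<le> rank y"
    proof (cases "x = y")
      case True
      then show ?thesis using xy S by auto
    next
      case False
      have "\<not> (x \<sqsubseteq> y \<and> y \<sqsubseteq> x)" using False xy S le_antisym by blast
      then show ?thesis using False less[of x y] less[of y x] cmp[of x y] xy by force
    qed
    then show "x \<sqsubseteq>\<^bsub>L\<lparr>carrier := S\<rparr>\<^esub> y \<longleftrightarrow> rank x \<sqsubseteq>\<^bsub>chain (card S)\<^esub> rank y"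
      by (simp add: le_chain)
  qed
qed

lemma carrier_grid: "carrier (chain a \<times>\<^sub>L chain b) = {..<a} \<times> {..<b}"
  and le_grid: "u \<sqsubseteq>\<^bsub>chain a \<times>\<^sub>L chain b\<^esub> v \<longleftrightarrow> fst u \<le> fst v \<and> snd u \<le> snd v"
  and eq_grid: "(.=\<^bsub>chain a \<times>\<^sub>L chain b\<^esub>) = (=)"
  by (simp_all add: chain_def lattice_prod_def)

lemma lattice_grid: "lattice (chain a \<times>\<^sub>L chain b)"
proof
  fix u v assume C: "u \<in> carrier (chain a \<times>\<^sub>L chain b)" "v \<in> carrier (chain a \<times>\<^sub>L chain b)"
  have "least (chain a \<times>\<^sub>L chain b) (max (fst u) (fst v), max (snd u) (snd v)) (Upper (chain a \<times>\<^sub>L chain b) {u, v})"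
    using C by (intro least_UpperI) (auto simp: Upper_def carrier_grid le_grid)
  then show "\<exists>s. least (chain a \<times>\<^sub>L chain b) s (Upper (chain a \<times>\<^sub>L chain b) {u, v})" ..
  have "greatest (chain a \<times>\<^sub>L chain b) (min (fst u) (fst v), min (snd u) (snd v)) (Lower (chain a \<times>\<^sub>L chain b) {u, v})"
    using C by (intro greatest_LowerI) (auto simp: Lower_def carrier_grid le_grid)
  then show "\<exists>s. greatest (chain a \<times>\<^sub>L chain b) s (Lower (chain a \<times>\<^sub>L chain b) {u, v})" ..
qed (auto simp: carrier_grid le_grid eq_grid prod_eq_iff)

lemma finite_lattice_grid:
  "a \<ge> 1 \<Longrightarrow> b \<ge> 1 \<Longrightarrow> finite_lattice (chain a \<times>\<^sub>L chain b)"
  using lattice_grid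
  by (auto simp: finite_lattice_def finite_lattice_axioms_def carrier_grid lessThan_empty_iff)

text \<open>The join-irreducible elements of a grid are those on its two lower edges, and all of them are
  join-prime.\<close>

lemma card_Con_grid:
  assumes "a \<ge> 1" "b \<ge> 1"
  shows "num_con (chain a \<times>\<^sub>L chain b) = 2 ^ (a * b - 1 - (a - 1) * (b - 1))"
proof -
  let ?G = "chain a \<times>\<^sub>L chain b"
  interpret G: finite_lattice ?G using finite_lattice_grid[OF assms] .
  have join: "u \<squnion>\<^bsub>?G\<^esub> v = (max (fst u) (fst v), max (snd u) (snd v))"
    if "u \<in> carrier ?G" "v \<in> carrier ?G" for u v
    using that by (intro G.join_eqI) (auto simp: carrier_grid le_grid)
  have reducible: "join_reducibles ?G = {1..<a} \<times> {1..<b}"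
  proof
    show "join_reducibles ?G \<subseteq> {1..<a} \<times> {1..<b}"
    proof
      fix w assume w: "w \<in> join_reducibles ?G"
      then obtain u v where uv: "u \<in> carrier ?G" "v \<in> carrier ?G" "w = u \<squnion>\<^bsub>?G\<^esub> v"
        "\<not> u \<sqsubseteq>\<^bsub>?G\<^esub> v" "\<not> v \<sqsubseteq>\<^bsub>?G\<^esub> u"
        by (elim G.join_reducibleE) blast
      then show "w \<in> {1..<a} \<times> {1..<b}"
        unfolding join[OF uv(1,2)] by (auto simp: carrier_grid le_grid)
    qed
    show "{1..<a} \<times> {1..<b} \<subseteq> join_reducibles ?G"
    proof
      fix w assume w: "w \<in> {1..<a} \<times> {1..<b}"
      let ?u = "(fst w, 0)" and ?v = "(0, snd w)"
      have "?u \<in> carrier ?G" "?v \<in> carrier ?G" "\<not> ?u \<sqsubseteq>\<^bsub>?G\<^esub> ?v" "\<not> ?v \<sqsubseteq>\<^bsub>?G\<^esub> ?u"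
        using w by (auto simp: carrier_grid le_grid)
      then show "w \<in> join_reducibles ?G"
        using G.join_reducibleI[of ?u ?v] join[of ?u ?v] by simp
    qed
  qed
  have "join_prime ?G j" if j: "j \<in> join_irreducibles ?G" for j
  proof -
    have jC: "j \<in> carrier ?G" "j \<notin> join_reducibles ?G"
      using j by (auto simp: join_irreducibles_def)
    then have "fst j = 0 \<or> snd j = 0" by (auto simp: reducible carrier_grid)
    then show ?thesis
      by (auto simp: join_prime_def join le_grid le_max_iff_disj)
  qed
  then have "card (carrier (Con ?G)) = 2 ^ card (join_irreducibles ?G)"
    by (rule G.card_Con_if_all_join_prime)
  moreover have "card (join_irreducibles ?G) = a * b - 1 - (a - 1) * (b - 1)"
    using G.card_carrier by (simp add: reducible carrier_grid)
  ultimately show ?thesis by simp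
qed

lemma carrier_N5: "carrier N5 = UNIV"
  and le_N5: "x \<sqsubseteq>\<^bsub>N5\<^esub> y \<longleftrightarrow> x = y \<or> x = N5_0 \<or> y = N5_1 \<or> x = N5_b \<and> y = N5_c"
  and eq_N5: "(.=\<^bsub>N5\<^esub>) = (=)"
  by (simp_all add: N5_def)

lemma UNIV_pentagon: "(UNIV :: pentagon set) = {N5_0, N5_a, N5_b, N5_c, N5_1}"
  using pentagon.exhaust by auto

lemma finite_lattice_N5: "finite_lattice N5"
proof -
  interpret partial_order N5
    by unfold_locales (auto simp: carrier_N5 le_N5 eq_N5)
  have "lattice N5"
  proof
    fix x y
    have "least N5 (if x \<sqsubseteq>\<^bsub>N5\<^esub> y then y else if y \<sqsubseteq>\<^bsub>N5\<^esub> x then x else N5_1) (Upper N5 {x, y})"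
      by (cases x; cases y) (auto simp: least_def Upper_def carrier_N5 le_N5)
    then show "\<exists>s. least N5 s (Upper N5 {x, y})" ..
    have "greatest N5 (if x \<sqsubseteq>\<^bsub>N5\<^esub> y then x else if y \<sqsubseteq>\<^bsub>N5\<^esub> x then y else N5_0) (Lower N5 {x, y})"
      by (cases x; cases y) (auto simp: greatest_def Lower_def carrier_N5 le_N5)
    then show "\<exists>s. greatest N5 s (Lower N5 {x, y})" ..
  qed
  then show ?thesis
    by (simp add: finite_lattice_def finite_lattice_axioms_def carrier_N5 UNIV_pentagon)
qed

text \<open>The elements \<open>a\<close> and \<open>b\<close> are join-prime and \<open>c\<close> is not, which accounts for four congruences
  and the identity.\<close>

lemma card_Con_N5: "num_con N5 = 5"
proof -
  interpret N: finite_lattice N5 by (rule finite_lattice_N5)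
  have top: "x \<squnion>\<^bsub>N5\<^esub> y = N5_1" if "\<not> x \<sqsubseteq>\<^bsub>N5\<^esub> y" "\<not> y \<sqsubseteq>\<^bsub>N5\<^esub> x" for x y
    using that by (intro N.join_eqI) (cases x; cases y; auto simp: carrier_N5 le_N5)+
  have reducible: "join_reducibles N5 = {N5_1}"
  proof
    show "join_reducibles N5 \<subseteq> {N5_1}"
    proof
      fix r assume "r \<in> join_reducibles N5"
      then show "r \<in> {N5_1}" using top by (elim N.join_reducibleE) simp
    qed
    have "\<not> N5_a \<sqsubseteq>\<^bsub>N5\<^esub> N5_b" "\<not> N5_b \<sqsubseteq>\<^bsub>N5\<^esub> N5_a" by (simp_all add: le_N5)
    then show "{N5_1} \<subseteq> join_reducibles N5"
      using N.join_reducibleI[of N5_a N5_b] top[of N5_a N5_b] by (simp add: carrier_N5)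
  qed
  interpret O: one_join_reducible N5 N5_1
    using reducible by unfold_locales
  have bot: "\<bottom>\<^bsub>N5\<^esub> = N5_0"
    using N.bottom_eq[of N5_0] by (simp add: carrier_N5 le_N5)
  have irreducible: "join_irreducibles N5 = {N5_a, N5_b, N5_c}"
    by (auto simp: join_irreducibles_def reducible bot carrier_N5 UNIV_pentagon)
  have "join_prime N5 N5_a" "join_prime N5 N5_b"
    by (rule N.join_primeI; (cases; cases)?; auto simp: carrier_N5 le_N5 intro: pentagon.exhaust)+
  then have "2 ^ card {N5_a, N5_b} < num_con N5"
    by (intro N.power_card_join_primes_less_card_Con) (auto simp: irreducible)
  moreover have "\<not> join_prime N5 N5_c"
    using top[of N5_a N5_b] by (auto simp: join_prime_def carrier_N5 le_N5)
  then have "num_con N5 \<le> 5"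
    using O.not_join_prime_cases[of N5_c] by (auto simp: irreducible)
  ultimately show ?thesis by simp
qed

section \<open>Recognising the three families\<close>

abbreviation (input) square :: "(nat \<times> nat) gorder" where "square \<equiv> chain 2 \<times>\<^sub>L chain 2"
abbreviation (input) ladder :: "(nat \<times> nat) gorder" where "ladder \<equiv> chain 2 \<times>\<^sub>L chain 3"

definition pentagon_sum :: "('a, 'r) gorder_scheme \<Rightarrow> bool"
  where "pentagon_sum L \<longleftrightarrow> (\<exists>k l. 1 \<le> k \<and> 1 \<le> l \<and> card (carrier L) = k + l + 3 \<and>
    L \<cong>\<^sub>L chain k \<^bold>+ N5 \<^bold>+ chain l)"

definition ladder_sum :: "('a, 'r) gorder_scheme \<Rightarrow> bool"
  where "ladder_sum L \<longleftrightarrow> (\<exists>k l. 1 \<le> k \<and> 1 \<le> l \<and> card (carrier L) = k + l + 4 \<and>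
    L \<cong>\<^sub>L chain k \<^bold>+ ladder \<^bold>+ chain l)"

definition two_squares_sum :: "('a, 'r) gorder_scheme \<Rightarrow> bool"
  where "two_squares_sum L \<longleftrightarrow> (\<exists>k m l. 1 \<le> k \<and> 1 \<le> m \<and> 1 \<le> l \<and> card (carrier L) = k + m + l + 4 \<and>
    L \<cong>\<^sub>L chain k \<^bold>+ square \<^bold>+ chain m \<^bold>+ square \<^bold>+ chain l)"

text \<open>If \<open>c \<sqsubseteq> u\<close> and \<open>v \<sqsubseteq> d\<close>, then \<open>f u \<sqsubseteq> f v\<close> would imply \<open>f c \<sqsubseteq> f d\<close>. So it is enough to check
  a few pairs \<open>(c, d)\<close> between which every failure of the order in \<open>M\<close> is located.\<close>

lemma (in lattice) isomorphic_if_witnessed: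
  assumes M: "lattice M" and S: "f ` carrier M = S" "S \<subseteq> carrier L"
    and mono: "\<And>u v. u \<in> carrier M \<Longrightarrow> v \<in> carrier M \<Longrightarrow> u \<sqsubseteq>\<^bsub>M\<^esub> v \<Longrightarrow> f u \<sqsubseteq> f v"
    and N: "N \<subseteq> carrier M \<times> carrier M" "\<And>c d. (c, d) \<in> N \<Longrightarrow> \<not> f c \<sqsubseteq> f d"
    and witness: "\<And>u v. u \<in> carrier M \<Longrightarrow> v \<in> carrier M \<Longrightarrow> \<not> u \<sqsubseteq>\<^bsub>M\<^esub> v \<Longrightarrow>
      \<exists>(c, d)\<in>N. c \<sqsubseteq>\<^bsub>M\<^esub> u \<and> v \<sqsubseteq>\<^bsub>M\<^esub> d"
  shows "L\<lparr>carrier := S\<rparr> \<cong>\<^sub>L M"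
proof -
  interpret M: lattice M by fact
  have fC: "f u \<in> carrier L" if "u \<in> carrier M" for u using that S by blast
  have reflect: "u \<sqsubseteq>\<^bsub>M\<^esub> v" if C: "u \<in> carrier M" "v \<in> carrier M" and le: "f u \<sqsubseteq> f v" for u v
  proof (rule ccontr)
    assume "\<not> u \<sqsubseteq>\<^bsub>M\<^esub> v"
    then obtain c d where cd: "(c, d) \<in> N" "c \<sqsubseteq>\<^bsub>M\<^esub> u" "v \<sqsubseteq>\<^bsub>M\<^esub> d" using witness[OF C] by blast
    then have cdC: "c \<in> carrier M" "d \<in> carrier M" using N(1) by auto
    have "f c \<sqsubseteq> f u" "f v \<sqsubseteq> f d" using mono cd cdC C by auto
    then have "f c \<sqsubseteq> f d"
      using le le_trans[of "f c" "f u" "f v"] le_trans[of "f c" "f v" "f d"] fC C cdC by simp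
    then show False using N(2) cd(1) by blast
  qed
  have "inj_on f (carrier M)"
  proof (rule inj_onI)
    fix u v assume uv: "u \<in> carrier M" "v \<in> carrier M" "f u = f v"
    have "u \<sqsubseteq>\<^bsub>M\<^esub> v" "v \<sqsubseteq>\<^bsub>M\<^esub> u" using reflect uv fC by auto
    then show "u = v" using uv M.le_antisym by blast
  qed
  then have "bij_betw f (carrier M) (carrier (L\<lparr>carrier := S\<rparr>))" using S(1) by (simp add: bij_betw_def)
  then have "M \<cong>\<^sub>L L\<lparr>carrier := S\<rparr>"
    using mono reflect eq_is_equal by (intro isomorphic_if_order_isomorphic[OF M]) auto
  then show ?thesis by (rule isomorphic_sym)
qed

lemma (in lattice) isomorphic_N5:
  assumes C: "p \<in> carrier L" "x \<in> carrier L" "y \<in> carrier L" "z \<in> carrier L" "r \<in> carrier L"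
    and le: "p \<sqsubseteq> x" "p \<sqsubseteq> y" "y \<sqsubseteq> z" "x \<sqsubseteq> r" "z \<sqsubseteq> r"
    and nle: "\<not> x \<sqsubseteq> z" "\<not> y \<sqsubseteq> x" "\<not> z \<sqsubseteq> y"
  shows "L\<lparr>carrier := {p, x, y, z, r}\<rparr> \<cong>\<^sub>L N5"
proof -
  let ?f = "case_pentagon p x y z r" and ?N = "{(N5_a, N5_c), (N5_b, N5_a), (N5_c, N5_b)}"
  have "p \<sqsubseteq> z" "p \<sqsubseteq> r" "y \<sqsubseteq> r"
    using le_trans[of p y z] le_trans[of p x r] le_trans[of y z r] C le by simp_all
  then have mono: "?f u \<sqsubseteq> ?f v" if "u \<sqsubseteq>\<^bsub>N5\<^esub> v" for u v
    using that le C by (cases u; cases v) (simp_all add: le_N5)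
  have witness: "\<exists>(c, d)\<in>?N. c \<sqsubseteq>\<^bsub>N5\<^esub> u \<and> v \<sqsubseteq>\<^bsub>N5\<^esub> d" if "\<not> u \<sqsubseteq>\<^bsub>N5\<^esub> v" for u v
    using that by (cases u; cases v) (auto simp: le_N5)
  show ?thesis
  proof (rule isomorphic_if_witnessed[where f = ?f and N = ?N])
    show "lattice N5" using finite_lattice_N5 by (simp add: finite_lattice_def)
    show "?f ` carrier N5 = {p, x, y, z, r}" by (simp add: carrier_N5 UNIV_pentagon)
    show "\<not> ?f c \<sqsubseteq> ?f d" if "(c, d) \<in> ?N" for c d using that nle by auto
    show "{p, x, y, z, r} \<subseteq> carrier L" using C by simp
  qed (erule mono, simp add: carrier_N5, erule witness)
qed

lemma (in lattice) isomorphic_grid_2_3: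
  assumes C: "p \<in> carrier L" "x \<in> carrier L" "w \<in> carrier L" "y \<in> carrier L" "r \<in> carrier L" "s \<in> carrier L"
    and le: "p \<sqsubseteq> x" "x \<sqsubseteq> w" "w \<sqsubseteq> s" "p \<sqsubseteq> y" "y \<sqsubseteq> r" "r \<sqsubseteq> s" "x \<sqsubseteq> r"
    and nle: "\<not> w \<sqsubseteq> r" "\<not> x \<sqsubseteq> y" "\<not> y \<sqsubseteq> w"
  shows "L\<lparr>carrier := {p, x, w, y, r, s}\<rparr> \<cong>\<^sub>L ladder"
proof -
  let ?f = "\<lambda>(i, j). if i = (0::nat) then if j = (0::nat) then p else if j = 1 then x else w
    else if j = 0 then y else if j = 1 then r else s"
  let ?N = "{((0, 1), (1, 0)), ((0, 2), (1, 1)), ((1, 0), (0, 2))}"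
  have car: "carrier ladder = {(0, 0), (0, 1), (0, 2), (1, 0), (1, 1), (1, 2)}"
    by (auto simp: carrier_grid)
  have "p \<sqsubseteq> w" "p \<sqsubseteq> r" "x \<sqsubseteq> s" "y \<sqsubseteq> s"
    using le_trans[of p x w] le_trans[of p x r] le_trans[of x w s] le_trans[of y r s] C le by simp_all
  moreover from this have "p \<sqsubseteq> s" using le_trans[of p x s] C le by simp
  ultimately have mono: "?f u \<sqsubseteq> ?f v" if "u \<in> carrier ladder"
    "v \<in> carrier ladder" "u \<sqsubseteq>\<^bsub>ladder\<^esub> v" for u v
    using that le C unfolding car le_grid by (elim insertE emptyE) simp_all
  have witness: "\<exists>(c, d)\<in>?N. c \<sqsubseteq>\<^bsub>ladder\<^esub> u \<and> v \<sqsubseteq>\<^bsub>ladder\<^esub> d"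
    if "u \<in> carrier ladder" "v \<in> carrier ladder"
      "\<not> u \<sqsubseteq>\<^bsub>ladder\<^esub> v" for u v
    using that unfolding car le_grid by (elim insertE emptyE) auto
  show ?thesis
  proof (rule isomorphic_if_witnessed[where f = ?f and N = ?N, OF lattice_grid])
    show "?f ` carrier ladder = {p, x, w, y, r, s}"
      unfolding car by auto
    show "?N \<subseteq> carrier ladder \<times> carrier ladder" unfolding car by simp
    show "\<not> ?f c \<sqsubseteq> ?f d" if "(c, d) \<in> ?N" for c d using that nle by auto
    show "{p, x, w, y, r, s} \<subseteq> carrier L" using C by simp
  qed (fact mono, fact witness)
qed

lemma (in lattice) isomorphic_square:
  assumes C: "p \<in> carrier L" "x \<in> carrier L" "y \<in> carrier L" "r \<in> carrier L"
    and le: "p \<sqsubseteq> x" "p \<sqsubseteq> y" "x \<sqsubseteq> r" "y \<sqsubseteq> r"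
    and nle: "\<not> x \<sqsubseteq> y" "\<not> y \<sqsubseteq> x"
  shows "L\<lparr>carrier := {p, x, y, r}\<rparr> \<cong>\<^sub>L square"
proof -
  let ?f = "\<lambda>(i, j). if i = (0::nat) then if j = (0::nat) then p else x else if j = 0 then y else r"
  let ?N = "{((0, 1), (1, 0)), ((1, 0), (0, 1))}"
  have car: "carrier square = {(0, 0), (0, 1), (1, 0), (1, 1)}"
    by (auto simp: carrier_grid)
  have "p \<sqsubseteq> r" using le_trans[of p x r] C le by simp
  then have mono: "?f u \<sqsubseteq> ?f v" if "u \<in> carrier square"
    "v \<in> carrier square" "u \<sqsubseteq>\<^bsub>square\<^esub> v" for u v
    using that le C unfolding car le_grid by (elim insertE emptyE) simp_all
  have witness: "\<exists>(c, d)\<in>?N. c \<sqsubseteq>\<^bsub>square\<^esub> u \<and> v \<sqsubseteq>\<^bsub>square\<^esub> d"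
    if "u \<in> carrier square" "v \<in> carrier square"
      "\<not> u \<sqsubseteq>\<^bsub>square\<^esub> v" for u v
    using that unfolding car le_grid by (elim insertE emptyE) auto
  show ?thesis
  proof (rule isomorphic_if_witnessed[where f = ?f and N = ?N, OF lattice_grid])
    show "?f ` carrier square = {p, x, y, r}"
      unfolding car by auto
    show "?N \<subseteq> carrier square \<times> carrier square" unfolding car by simp
    show "\<not> ?f c \<sqsubseteq> ?f d" if "(c, d) \<in> ?N" for c d using that nle by auto
    show "{p, x, y, r} \<subseteq> carrier L" using C by simp
  qed (fact mono, fact witness)
qed

text \<open>Cutting the part below \<open>c\<close> once more, at \<open>p\<close>; repeated use produces left-nested ordinal sums.\<close>

lemma (in cut_lattice) lower_isomorphic_sum:
  assumes p: "p \<in> carrier L" "p \<sqsubseteq> c" "\<And>x. x \<in> carrier L \<Longrightarrow> x \<sqsubseteq> p \<or> p \<sqsubseteq> x"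
    and A: "L\<lparr>carrier := down L p\<rparr> \<cong>\<^sub>L A"
    and B: "L\<lparr>carrier := up L p \<inter> down L c\<rparr> \<cong>\<^sub>L B"
  shows "lower \<cong>\<^sub>L A \<^bold>+ B"
proof -
  interpret D: cut_lattice lower p
  proof (intro cut_lattice.intro cut_lattice_axioms.intro finite_lattice_lower)
    show "p \<in> carrier lower" using p by (simp add: down_def)
    show "x \<sqsubseteq>\<^bsub>lower\<^esub> p \<or> p \<sqsubseteq>\<^bsub>lower\<^esub> x" if "x \<in> carrier lower" for x
      using p(3) that by (simp add: down_def)
  qed
  have "down lower p = down L p"
    using le_trans[OF _ p(2) _ p(1) cut_carrier] by (auto simp: down_def)
  moreover have "up lower p = up L p \<inter> down L c"
    by (auto simp: up_def down_def)
  ultimately show ?thesis using D.ordinal_sum_if_parts_isomorphic A B by simp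
qed

context finite_lattice
begin

lemma cut_latticeI:
  "c \<in> carrier L \<Longrightarrow> (\<And>x. x \<in> carrier L \<Longrightarrow> x \<sqsubseteq> c \<or> c \<sqsubseteq> x) \<Longrightarrow> cut_lattice L c"
  by (intro cut_lattice.intro cut_lattice_axioms.intro finite_lattice_axioms)

lemma down_isomorphic_chain:
  "totally_ordered L (down L p) \<Longrightarrow> L\<lparr>carrier := down L p\<rparr> \<cong>\<^sub>L chain (card (down L p))"
  by (intro totally_ordered_isomorphic_chain) (auto simp: down_def)

lemma card_down: "p \<in> carrier L \<Longrightarrow> 1 \<le> card (down L p)"
  using finite_carrier by (auto simp: down_def Suc_le_eq card_gt_0_iff)

lemma card_up: "p \<in> carrier L \<Longrightarrow> 1 \<le> card (up L p)"
  using finite_carrier by (auto simp: up_def Suc_le_eq card_gt_0_iff)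

lemma finite_down_up: "finite (down L p)" "finite (up L p)"
  using finite_carrier by (simp_all add: down_def up_def)

text \<open>A layer \<open>M\<close> strictly between \<open>p\<close> and \<open>r\<close> splits the lattice at \<open>p\<close> and at \<open>r\<close> if it contains
  everything that is neither below \<open>p\<close> nor above \<open>r\<close>.\<close>

lemma isomorphic_sum_of_layers:
  assumes C: "p \<in> carrier L" "r \<in> carrier L" and pr: "p \<sqsubseteq> r" "p \<noteq> r"
    and M: "\<And>t. t \<in> M \<Longrightarrow> p \<sqsubseteq> t \<and> t \<sqsubseteq> r \<and> t \<noteq> p \<and> t \<noteq> r"
    and car: "carrier L = down L p \<union> M \<union> up L r"
    and total: "totally_ordered L (up L r)"
    and A: "L\<lparr>carrier := down L p\<rparr> \<cong>\<^sub>L A"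
    and X: "L\<lparr>carrier := insert p (insert r M)\<rparr> \<cong>\<^sub>L X"
  shows "L \<cong>\<^sub>L A \<^bold>+ X \<^bold>+ chain (card (up L r))"
    and "card (carrier L) = card (down L p) + card M + card (up L r)"
proof -
  have elements: "t \<sqsubseteq> p \<or> t \<in> M \<or> r \<sqsubseteq> t" if "t \<in> carrier L" for t
    using that unfolding car by (auto simp: down_def up_def)
  have MC: "t \<in> carrier L" if "t \<in> M" for t using that car by blast
  have compare_p: "t \<sqsubseteq> p \<or> p \<sqsubseteq> t" if "t \<in> carrier L" for t
    using elements[OF that] M[of t] le_trans[of p r t] C pr(1) that by blast
  have compare_r: "t \<sqsubseteq> r \<or> r \<sqsubseteq> t" if "t \<in> carrier L" for t
    using elements[OF that] M[of t] le_trans[of t p r] C pr(1) that by blast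
  interpret R: cut_lattice L r using cut_latticeI C(2) compare_r .
  have mid: "up L p \<inter> down L r = insert p (insert r M)"
  proof
    show "up L p \<inter> down L r \<subseteq> insert p (insert r M)"
    proof
      fix t assume "t \<in> up L p \<inter> down L r"
      then have t: "t \<in> carrier L" "p \<sqsubseteq> t" "t \<sqsubseteq> r" by (simp_all add: up_def down_def)
      then show "t \<in> insert p (insert r M)"
        using elements[OF t(1)] le_antisym[of t p] le_antisym[of t r] C by blast
    qed
  qed (use C pr M MC in \<open>auto simp: up_def down_def\<close>)
  have "up L r \<subseteq> carrier L" by (auto simp: up_def)
  then have "R.upper \<cong>\<^sub>L chain (card (up L r))"
    using total by (rule totally_ordered_isomorphic_chain)
  moreover have "R.lower \<cong>\<^sub>L A \<^bold>+ X"
    using R.lower_isomorphic_sum[OF C(1) pr(1) compare_p A] X by (simp add: mid)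
  ultimately show "L \<cong>\<^sub>L A \<^bold>+ X \<^bold>+ chain (card (up L r))"
    by (intro R.ordinal_sum_if_parts_isomorphic)
  have "t \<notin> down L p \<and> t \<notin> up L r" if "t \<in> M" for t
    using M[OF that] MC[OF that] le_antisym[of t p] le_antisym[of t r] C
    by (auto simp: up_def down_def)
  moreover have "t \<notin> up L r" if "t \<in> down L p" for t
    using that le_trans[of r t p] le_antisym[of p r] C pr by (auto simp: up_def down_def)
  ultimately have "down L p \<inter> M = {}" "(down L p \<union> M) \<inter> up L r = {}" by blast+
  moreover have "finite M" by (rule finite_subset[OF _ finite_carrier]) (use MC in blast)
  ultimately show "card (carrier L) = card (down L p) + card M + card (up L r)"
    unfolding car by (simp add: card_Un_disjoint finite_down_up)
qed

lemma isomorphic_sum_of_pentagon: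
  assumes "pentagon_between_chains L p x y z r"
  shows "pentagon_sum L"
proof -
  have C: "p \<in> carrier L" "x \<in> carrier L" "y \<in> carrier L" "z \<in> carrier L" "r \<in> carrier L"
    and le: "p \<sqsubseteq> x" "p \<sqsubseteq> y" "y \<sqsubseteq> z" "x \<sqsubseteq> r" "z \<sqsubseteq> r"
    and nle: "\<not> x \<sqsubseteq> z" "\<not> y \<sqsubseteq> x" and yz: "y \<noteq> z"
    and car: "carrier L = down L p \<union> {x, y, z} \<union> up L r"
    and total: "totally_ordered L (down L p)" "totally_ordered L (up L r)"
    using assms unfolding pentagon_between_chains_def by auto
  have nzy: "\<not> z \<sqsubseteq> y" using yz le C le_antisym by blast
  have le': "p \<sqsubseteq> z" "p \<sqsubseteq> r" "y \<sqsubseteq> r"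
    using le_trans[of p y z] le_trans[of p x r] le_trans[of y z r] C le by simp_all
  note down = down_isomorphic_chain[OF total(1)]
  have "insert p (insert r {x, y, z}) = {p, x, y, z, r}" by auto
  with isomorphic_N5[OF C le nle nzy]
  have mid: "L\<lparr>carrier := insert p (insert r {x, y, z})\<rparr> \<cong>\<^sub>L N5" by (simp only:)
  have between: "p \<sqsubseteq> t \<and> t \<sqsubseteq> r \<and> t \<noteq> p \<and> t \<noteq> r" if "t \<in> {x, y, z}" for t
    using that le le' nle yz nzy by auto
  have "p \<noteq> r" using le_trans[of x p z] le le' nle C by auto
  note L = isomorphic_sum_of_layers[OF C(1,5) le'(2) this between car total(2) down mid]
  have "x \<noteq> y" "x \<noteq> z" using nle C by auto
  then have "card {x, y, z} = 3" using yz by simp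
  with L card_down[OF C(1)] card_up[OF C(5)] show ?thesis
    unfolding pentagon_sum_def
    by (intro exI[of _ "card (down L p)"] exI[of _ "card (up L r)"]) simp
qed

lemma isomorphic_sum_of_grid:
  assumes "grid_between_chains L p x w y r s"
  shows "ladder_sum L"
proof -
  have C: "p \<in> carrier L" "x \<in> carrier L" "w \<in> carrier L" "y \<in> carrier L" "r \<in> carrier L" "s \<in> carrier L"
    and le: "p \<sqsubseteq> x" "x \<sqsubseteq> w" "w \<sqsubseteq> s" "p \<sqsubseteq> y" "y \<sqsubseteq> r" "r \<sqsubseteq> s" "x \<sqsubseteq> r"
    and nle: "\<not> w \<sqsubseteq> r" "\<not> x \<sqsubseteq> y" "\<not> y \<sqsubseteq> w"
    and car: "carrier L = down L p \<union> {x, w, y, r} \<union> up L s"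
    and total: "totally_ordered L (down L p)" "totally_ordered L (up L s)"
    using assms unfolding grid_between_chains_def by auto
  have le': "p \<sqsubseteq> w" "p \<sqsubseteq> r" "x \<sqsubseteq> s" "y \<sqsubseteq> s"
    using le_trans[of p x w] le_trans[of p x r] le_trans[of x w s] le_trans[of y r s] C le by simp_all
  then have ps: "p \<sqsubseteq> s" using le_trans[of p x s] C le by simp
  note down = down_isomorphic_chain[OF total(1)]
  have "insert p (insert s {x, w, y, r}) = {p, x, w, y, r, s}" by auto
  with isomorphic_grid_2_3[OF C le nle]
  have mid: "L\<lparr>carrier := insert p (insert s {x, w, y, r})\<rparr> \<cong>\<^sub>L ladder" by (simp only:)
  have ne: "x \<noteq> w" "x \<noteq> y" "x \<noteq> r" "w \<noteq> y" "w \<noteq> r" "y \<noteq> r"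
    using nle le C le_trans[of y r w] by auto
  have between: "p \<sqsubseteq> t \<and> t \<sqsubseteq> s \<and> t \<noteq> p \<and> t \<noteq> s" if "t \<in> {x, w, y, r}" for t
    using that le le' nle le_trans[of y s w] le_trans[of y x w] C ne by auto
  have "p \<noteq> s" using le_trans[of w p r] le le' nle C by auto
  note L = isomorphic_sum_of_layers[OF C(1,6) ps this between car total(2) down mid]
  have "card {x, w, y, r} = 4" using ne by simp
  with L card_down[OF C(1)] card_up[OF C(6)] show ?thesis
    unfolding ladder_sum_def
    by (intro exI[of _ "card (down L p)"] exI[of _ "card (up L s)"]) simp
qed

lemma isomorphic_sum_of_two_squares:
  assumes "two_squares_between_chains L p x y r q u v s"
  shows "two_squares_sum L"
proof -
  let ?I = "up L r \<inter> down L q"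
  have C: "p \<in> carrier L" "x \<in> carrier L" "y \<in> carrier L" "r \<in> carrier L"
      "q \<in> carrier L" "u \<in> carrier L" "v \<in> carrier L" "s \<in> carrier L"
    and le: "p \<sqsubseteq> x" "p \<sqsubseteq> y" "x \<sqsubseteq> r" "y \<sqsubseteq> r" "r \<sqsubseteq> q" "q \<sqsubseteq> u" "q \<sqsubseteq> v" "u \<sqsubseteq> s" "v \<sqsubseteq> s"
    and nle: "\<not> x \<sqsubseteq> y" "\<not> y \<sqsubseteq> x" "\<not> u \<sqsubseteq> v" "\<not> v \<sqsubseteq> u"
    and car: "carrier L = down L p \<union> {x, y} \<union> ?I \<union> {u, v} \<union> up L s"
    and total: "totally_ordered L (down L p)" "totally_ordered L ?I" "totally_ordered L (up L s)"
    using assms unfolding two_squares_between_chains_def by auto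
  have le': "p \<sqsubseteq> r" "q \<sqsubseteq> s" "x \<sqsubseteq> q" "y \<sqsubseteq> q"
    using le_trans[of p x r] le_trans[of q u s] le_trans[of x r q] le_trans[of y r q] C le by simp_all
  have pq: "p \<sqsubseteq> q" using le_trans[of p r q] le' C le by simp
  have sq: "\<not> u \<sqsubseteq> q" "\<not> v \<sqsubseteq> q" "\<not> s \<sqsubseteq> q"
    using le_trans[of u q v] le_trans[of v q u] le_trans[of u s q] C le nle by auto
  \<comment> \<open>The part below \<open>q\<close> has the single layer \<open>{x, y}\<close>; on top of that part, \<open>{u, v}\<close> is the only layer.\<close>
  have down_q: "down L q = down L p \<union> {x, y} \<union> ?I"
  proof
    show "down L q \<subseteq> down L p \<union> {x, y} \<union> ?I"
    proof
      fix t assume t: "t \<in> down L q"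
      then have tC: "t \<in> carrier L" "t \<sqsubseteq> q" by (simp_all add: down_def)
      then have "\<not> s \<sqsubseteq> t" using le_trans[of s t q] C sq by auto
      then have "t \<notin> up L s \<and> t \<noteq> u \<and> t \<noteq> v" using tC(2) sq by (auto simp: up_def)
      then show "t \<in> down L p \<union> {x, y} \<union> ?I" using tC(1) unfolding car by blast
    qed
    show "down L p \<union> {x, y} \<union> ?I \<subseteq> down L q"
    proof -
      have "t \<sqsubseteq> q" if "t \<in> down L p" for t
        using that le_trans[of t p q] pq C by (simp add: down_def)
      then show ?thesis using C le' by (auto simp: down_def)
    qed
  qed
  have car_q: "carrier L = down L q \<union> {u, v} \<union> up L s" by (subst down_q) (rule car)
  have "t \<sqsubseteq> q \<or> q \<sqsubseteq> t" if "t \<in> carrier L" for t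
  proof -
    have "t \<sqsubseteq> q \<or> t = u \<or> t = v \<or> s \<sqsubseteq> t"
      using that unfolding car_q by (auto simp: down_def up_def)
    then show ?thesis using that le le' le_trans[of q s t] C by blast
  qed
  then interpret Q: cut_lattice L q using cut_latticeI C(5) by blast
  interpret D: finite_lattice Q.lower by (rule Q.finite_lattice_lower)
  have sets: "down Q.lower p = down L p" "up Q.lower r = ?I"
  proof -
    have "t \<sqsubseteq> q" if "t \<in> carrier L" "t \<sqsubseteq> p" for t
      using that le_trans[of t p q] pq C by simp
    then show "down Q.lower p = down L p" "up Q.lower r = ?I"
      by (auto simp: down_def up_def)
  qed
  note down = down_isomorphic_chain[OF total(1)]
  have ins: "insert p (insert r {x, y}) = {p, x, y, r}" "insert q (insert s {u, v}) = {q, u, v, s}"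
    by auto
  have mid: "L\<lparr>carrier := insert p (insert r {x, y})\<rparr> \<cong>\<^sub>L square"
    "L\<lparr>carrier := insert q (insert s {u, v})\<rparr> \<cong>\<^sub>L square"
    using isomorphic_square[OF C(1-4) le(1-4) nle(1,2)] isomorphic_square[OF C(5-8) le(6-9) nle(3,4)]
    by (simp_all only: ins)
  have below_q: "p \<in> carrier Q.lower" "r \<in> carrier Q.lower" using C pq le by (simp_all add: down_def)
  have car_lower: "carrier Q.lower = down Q.lower p \<union> {x, y} \<union> up Q.lower r"
  proof -
    have "carrier Q.lower = down L q" by simp
    also have "\<dots> = down L p \<union> {x, y} \<union> ?I" by (rule down_q)
    finally show ?thesis unfolding sets .
  qed
  have lower: "Q.lower \<cong>\<^sub>L chain (card (down L p)) \<^bold>+ square \<^bold>+ chain (card ?I)"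
    and card_q: "card (down L q) = card (down L p) + card {x, y} + card ?I"
  proof -
    have prem: "p \<sqsubseteq>\<^bsub>Q.lower\<^esub> r" "p \<noteq> r" "totally_ordered Q.lower (up Q.lower r)"
      "t \<in> {x, y} \<Longrightarrow> p \<sqsubseteq>\<^bsub>Q.lower\<^esub> t \<and> t \<sqsubseteq>\<^bsub>Q.lower\<^esub> r \<and> t \<noteq> p \<and> t \<noteq> r" for t
      using le le' nle total(2) le_trans[of x p y] C unfolding sets by (auto simp: totally_ordered_def)
    note D = D.isomorphic_sum_of_layers[OF below_q prem(1,2,4) car_lower prem(3), unfolded sets]
    have "Q.lower\<lparr>carrier := S\<rparr> = L\<lparr>carrier := S\<rparr>" for S by simp
    note D = D[unfolded this, OF _ down mid(1)]
    show "Q.lower \<cong>\<^sub>L chain (card (down L p)) \<^bold>+ square \<^bold>+ chain (card ?I)"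
      "card (down L q) = card (down L p) + card {x, y} + card ?I"
      using D by simp_all
  qed
  have "q \<noteq> s" using sq C by auto
  moreover have "q \<sqsubseteq> t \<and> t \<sqsubseteq> s \<and> t \<noteq> q \<and> t \<noteq> s" if "t \<in> {u, v}" for t
    using that le nle sq C by auto
  ultimately have "L \<cong>\<^sub>L chain (card (down L p)) \<^bold>+ square \<^bold>+ chain (card ?I)
      \<^bold>+ square \<^bold>+ chain (card (up L s))"
    and "card (carrier L) = card (down L q) + card {u, v} + card (up L s)"
    using isomorphic_sum_of_layers[OF C(5,8) le'(2) _ _ car_q total(3) lower mid(2)] by blast+
  moreover have "x \<noteq> y" "u \<noteq> v" using nle C by auto
  moreover have "1 \<le> card ?I"
  proof -
    have "r \<in> ?I" using C le by (simp add: up_def down_def)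
    then show ?thesis using finite_down_up by (auto simp: Suc_le_eq card_gt_0_iff)
  qed
  ultimately show ?thesis
    unfolding two_squares_sum_def
    using card_q card_down[OF C(1)] card_up[OF C(8)]
    by (intro exI[of _ "card (down L p)"] exI[of _ "card ?I"] exI[of _ "card (up L s)"]) simp
qed

end

section \<open>The largest numbers of congruences\<close>

lemma card_Con_pentagon_sum:
  assumes L: "finite_lattice L" and sum: "pentagon_sum L"
  shows "64 * num_con L = 10 * 2 ^ card (carrier L)"
proof -
  obtain k l where kl: "1 \<le> k" "1 \<le> l" and n: "card (carrier L) = k + l + 3"
    and iso: "L \<cong>\<^sub>L chain k \<^bold>+ N5 \<^bold>+ chain l"
    using sum unfolding pentagon_sum_def by blast
  interpret S: two_finite_lattices "chain k" N5
    using kl(1) finite_lattice_chain finite_lattice_N5 by (simp add: two_finite_lattices_def)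
  interpret T: two_finite_lattices "chain k \<^bold>+ N5" "chain l"
    using kl(2) finite_lattice_chain S.finite_lattice_sum by (simp add: two_finite_lattices_def)
  have "num_con L = 2 ^ (k - 1) * 5 * 2 ^ (l - 1)"
    using card_Con_isomorphic[OF L iso] T.card_Con_sum S.card_Con_sum card_Con_chain kl
      card_Con_N5 by simp
  moreover obtain k' l' where "k = Suc k'" "l = Suc l'"
    using kl by (metis Suc_le_D One_nat_def)
  ultimately show ?thesis unfolding n by (simp add: power_add)
qed

lemma card_Con_ladder_sum:
  assumes L: "finite_lattice L" and sum: "ladder_sum L"
  shows "64 * num_con L = 8 * 2 ^ card (carrier L)"
proof -
  obtain k l where kl: "1 \<le> k" "1 \<le> l" and n: "card (carrier L) = k + l + 4"
    and iso: "L \<cong>\<^sub>L chain k \<^bold>+ ladder \<^bold>+ chain l"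
    using sum unfolding ladder_sum_def by blast
  interpret S: two_finite_lattices "chain k" "ladder"
    using kl(1) finite_lattice_chain finite_lattice_grid by (simp add: two_finite_lattices_def)
  interpret T: two_finite_lattices "chain k \<^bold>+ ladder" "chain l"
    using kl(2) finite_lattice_chain S.finite_lattice_sum by (simp add: two_finite_lattices_def)
  have "num_con ladder = 8" using card_Con_grid[of 2 3] by simp
  then have "num_con L = 2 ^ (k - 1) * 8 * 2 ^ (l - 1)"
    using card_Con_isomorphic[OF L iso] T.card_Con_sum S.card_Con_sum card_Con_chain kl by simp
  moreover obtain k' l' where "k = Suc k'" "l = Suc l'"
    using kl by (metis Suc_le_D One_nat_def)
  ultimately show ?thesis unfolding n by (simp add: power_add)
qed

lemma card_Con_two_squares_sum:
  assumes L: "finite_lattice L" and sum: "two_squares_sum L"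
  shows "64 * num_con L = 8 * 2 ^ card (carrier L)"
proof -
  obtain k m l where kl: "1 \<le> k" "1 \<le> m" "1 \<le> l" and n: "card (carrier L) = k + m + l + 4"
    and iso: "L \<cong>\<^sub>L chain k \<^bold>+ square \<^bold>+ chain m \<^bold>+ square \<^bold>+ chain l"
    using sum unfolding two_squares_sum_def by blast
  interpret S: two_finite_lattices "chain k" "square"
    using kl(1) finite_lattice_chain finite_lattice_grid by (simp add: two_finite_lattices_def)
  interpret T: two_finite_lattices "chain k \<^bold>+ square" "chain m"
    using kl(2) finite_lattice_chain S.finite_lattice_sum by (simp add: two_finite_lattices_def)
  interpret U: two_finite_lattices "chain k \<^bold>+ square \<^bold>+ chain m" "square"
    using finite_lattice_grid T.finite_lattice_sum by (simp add: two_finite_lattices_def)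
  interpret V: two_finite_lattices
    "chain k \<^bold>+ square \<^bold>+ chain m \<^bold>+ square" "chain l"
    using kl(3) finite_lattice_chain U.finite_lattice_sum by (simp add: two_finite_lattices_def)
  have "num_con square = 4" using card_Con_grid[of 2 2] by simp
  then have "num_con L = 2 ^ (k - 1) * 4 * 2 ^ (m - 1) * 4 * 2 ^ (l - 1)"
    using card_Con_isomorphic[OF L iso] V.card_Con_sum U.card_Con_sum T.card_Con_sum S.card_Con_sum
      card_Con_chain kl by simp
  moreover obtain k' m' l' where "k = Suc k'" "m = Suc m'" "l = Suc l'"
    using kl by (metis Suc_le_D One_nat_def)
  ultimately show ?thesis unfolding n by (simp add: power_add)
qed

text \<open>Two incomparable elements have a join different from both of them, so the two proper joins are
  comparable and can be named \<open>r\<close> and \<open>s\<close> with \<open>r \<sqsubseteq> s\<close>.\<close>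

lemma (in finite_lattice) two_join_reducibles_structure:
  assumes d: "card (join_reducibles L) = 2"
    and prime: "\<And>j. j \<in> join_irreducibles L \<Longrightarrow> join_prime L j"
  shows "ladder_sum L \<or> two_squares_sum L"
proof -
  have main: ?thesis if rs: "join_reducibles L = {r, s}" "r \<noteq> s" "r \<sqsubseteq> s" for r s
  proof -
    interpret T: two_join_reducibles L r s
      using rs prime by unfold_locales
    show ?thesis
    proof (cases "\<forall>w\<in>carrier L. w \<sqsubseteq> r \<or> r \<sqsubseteq> w")
      case True
      then show ?thesis
        using T.two_squares_if_comparable isomorphic_sum_of_two_squares by blast
    next
      case False
      then show ?thesis
        using T.grid_if_incomparable isomorphic_sum_of_grid by blast
    qed
  qed
  obtain r s where rs: "join_reducibles L = {r, s}" "r \<noteq> s" using d by (auto simp: card_2_iff)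
  have C: "r \<in> carrier L" "s \<in> carrier L" using rs by (auto simp: join_reducibles_def)
  have "r \<sqsubseteq> s \<or> s \<sqsubseteq> r"
  proof (rule ccontr)
    assume n: "\<not> ?thesis"
    then have "r \<squnion> s = r \<or> r \<squnion> s = s" using join_reducibleI[of r s] C rs by auto
    then show False using join_left[OF C] join_right[OF C] n by auto
  qed
  then show ?thesis using main[of r s] main[of s r] rs by (auto simp: insert_commute)
qed

text \<open>All bounds are scaled by 64 to avoid fractional powers of two: the values
  \<open>2 ^ (n - 2)\<close>, \<open>5 * 2 ^ (n - 5)\<close>, \<open>2 ^ (n - 3)\<close> and \<open>7 * 2 ^ (n - 6)\<close> become
  the multiples of \<open>2 ^ n\<close> by 16, 10, 8 and 7.\<close>

lemma (in finite_lattice) card_Con_classification: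
  assumes few: "64 * num_con L < 16 * 2 ^ card (carrier L)"
  shows "5 \<le> card (carrier L) \<and>
    (64 * num_con L \<le> 10 * 2 ^ card (carrier L) \<and> pentagon_sum L \<or>
    64 * num_con L = 8 * 2 ^ card (carrier L) \<and> (ladder_sum L \<or> two_squares_sum L) \<or>
    64 * num_con L \<le> 7 * 2 ^ card (carrier L))"
proof -
  let ?N = "num_con L" and ?n = "card (carrier L)"
  let ?m = "card (join_irreducibles L)" and ?d = "card (join_reducibles L)"
  have n: "?n = 1 + ?m + ?d" by (rule card_carrier)
  have N: "?N \<le> 2 ^ ?m" by (rule card_Con_le_power)
  have primes: "?N = 2 ^ ?m" if "\<And>j. j \<in> join_irreducibles L \<Longrightarrow> join_prime L j"
    using card_Con_if_all_join_prime that by blast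
  consider "?d = 0" | "?d = 1" | "?d = 2" | "?d \<ge> 3" by linarith
  then show ?thesis
  proof cases
    case 1
    then have "join_reducibles L = {}" using finite_join_reducibles by simp
    then have "x \<sqsubseteq> y \<or> y \<sqsubseteq> x" if "x \<in> carrier L" "y \<in> carrier L" for x y
      using join_reducibleI[OF that] by blast
    then have "join_prime L j" if "j \<in> join_irreducibles L" for j
      using join_primeI[OF join_irreducible_carrier[OF that]] by blast
    then have "?N = 2 ^ ?m" by (rule primes)
    then show ?thesis using few n 1 by simp
  next
    case 2
    then obtain r where r: "join_reducibles L = {r}" by (auto simp: card_1_singleton_iff)
    interpret O: one_join_reducible L r using r by unfold_locales
    have pow: "(2::nat) ^ ?n = 4 * 2 ^ ?m" using n 2 by simp
    have "\<exists>j\<in>join_irreducibles L. \<not> join_prime L j"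
    proof (rule ccontr)
      assume "\<not> ?thesis"
      then have "?N = 2 ^ ?m" using primes by blast
      then show False using few pow by simp
    qed
    then obtain j where j: "j \<in> join_irreducibles L" "\<not> join_prime L j" by blast
    from O.not_join_prime_cases[OF j] show ?thesis
    proof (elim disjE conjE exE)
      assume a: "?N \<le> 7 * 2 ^ (?m - 4)" "4 \<le> ?m"
      then obtain i where "?m = 4 + i" using le_Suc_ex by blast
      then show ?thesis using a n 2 by (simp add: power_add)
    next
      assume a: "?N \<le> 2 * 2 ^ (?m - 3)" "3 \<le> ?m"
      then obtain i where "?m = 3 + i" using le_Suc_ex by blast
      then show ?thesis using a n 2 by (simp add: power_add)
    next
      fix p x y z
      assume a: "pentagon_between_chains L p x y z r" "?N \<le> 5 * 2 ^ (?m - 3)" "3 \<le> ?m"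
      then obtain i where i: "?m = 3 + i" using le_Suc_ex by blast
      have "64 * ?N \<le> 10 * 2 ^ ?n" using a i n 2 by (simp add: power_add)
      moreover have "5 \<le> ?n" using i n 2 by simp
      ultimately show ?thesis using isomorphic_sum_of_pentagon[OF a(1)] by blast
    qed
  next
    case 3
    have pow: "(2::nat) ^ ?n = 8 * 2 ^ ?m" using n 3 by (simp add: numeral_3_eq_3)
    show ?thesis
    proof (cases "\<forall>j\<in>join_irreducibles L. join_prime L j")
      case True
      then have "64 * ?N = 8 * 2 ^ ?n" using primes pow by simp
      moreover have S: "ladder_sum L \<or> two_squares_sum L"
        using two_join_reducibles_structure[OF 3] True by blast
      moreover have "5 \<le> ?n" using S unfolding ladder_sum_def two_squares_sum_def by auto
      ultimately show ?thesis by blast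
    next
      case False
      then obtain j where j: "j \<in> join_irreducibles L" "\<not> join_prime L j" by blast
      obtain i where "?m = 2 + i" using card_Con_le_if_not_join_prime(2)[OF j] le_Suc_ex by blast
      then show ?thesis using card_Con_le_if_not_join_prime(1)[OF j] n 3 by (simp add: power_add)
    qed
  next
    case 4
    then obtain i where i: "?d = 3 + i" using le_Suc_ex by blast
    have "(2::nat) ^ ?m * 16 \<le> 2 ^ ?n"
      unfolding n i by (simp add: power_add)
    then have "64 * ?N \<le> 7 * 2 ^ ?n" using N by linarith
    moreover have "1 \<le> ?m"
    proof -
      obtain r where "r \<in> join_reducibles L" using 4 by fastforce
      then obtain u v where "u \<in> carrier L" "v \<in> carrier L" "\<not> u \<sqsubseteq> v"
        using join_reducibleE by metis
      then obtain j where "j \<in> join_irreducibles L" using join_irreducible_separator by metis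
      then show ?thesis
        using finite_join_irreducibles by (auto simp: Suc_le_eq card_gt_0_iff)
    qed
    ultimately show ?thesis using n 4 by simp
  qed
qed

lemma scaled_power_iff:
  fixes N n c :: nat
  defines "P \<equiv> (2 :: rat) powi (int n - 6)"
  shows "of_nat N < of_nat c * P \<longleftrightarrow> 64 * N < c * 2 ^ n"
    and "of_nat N \<le> of_nat c * P \<longleftrightarrow> 64 * N \<le> c * 2 ^ n"
    and "of_nat N = of_nat c * P \<longleftrightarrow> 64 * N = c * 2 ^ n"
proof -
  have "P = 2 ^ n / 64" by (simp add: P_def power_int_diff)
  then have P: "of_nat c * P = of_nat (c * 2 ^ n) / 64" by simp
  have N: "of_nat N = (of_nat (64 * N) :: rat) / 64" by simp
  show "of_nat N < of_nat c * P \<longleftrightarrow> 64 * N < c * 2 ^ n"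
    unfolding P N by (simp only: divide_less_cancel of_nat_less_iff) simp
  show "of_nat N \<le> of_nat c * P \<longleftrightarrow> 64 * N \<le> c * 2 ^ n"
    unfolding P N by (simp only: divide_le_cancel of_nat_le_iff) simp
  show "of_nat N = of_nat c * P \<longleftrightarrow> 64 * N = c * 2 ^ n"
    unfolding P N by (simp only: divide_cancel_right of_nat_eq_iff) simp
qed

theorem theorem5p6:
  fixes L :: "('a, 'r) gorder_scheme" and n :: nat
  assumes "n \<ge> 1"
    and "lattice L"
    and "card (carrier L) = n"
    and "of_nat (card (carrier (Con L))) < (2 :: rat) powi (int n - 2)"
  shows "n \<ge> 5 \<and>
    (of_nat (card (carrier (Con L))) \<le> 5 * (2 :: rat) powi (int n - 5) \<and>
     5 * (2 :: rat) powi (int n - 5) = 2 powi (int n - 3) + 2 powi (int n - 5) \<and>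
     (of_nat (card (carrier (Con L))) = 5 * (2 :: rat) powi (int n - 5) \<longleftrightarrow>
       (\<exists>k. 1 \<le> k \<and> k \<le> n - 4 \<and> L \<cong>\<^sub>L chain k \<^bold>+ N5 \<^bold>+ chain (n - k - 3)))) \<and>
    (of_nat (card (carrier (Con L))) < 5 * (2 :: rat) powi (int n - 5) \<longrightarrow>
     of_nat (card (carrier (Con L))) \<le> (2 :: rat) powi (int n - 3) \<and>
     (of_nat (card (carrier (Con L))) = (2 :: rat) powi (int n - 3) \<longleftrightarrow>
       (n \<ge> 6 \<and> (\<exists>k. 1 \<le> k \<and> k \<le> n - 5 \<and>
          L \<cong>\<^sub>L chain k \<^bold>+ (chain 2 \<times>\<^sub>L chain 3) \<^bold>+ chain (n - k - 4))) \<or>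
       (n \<ge> 7 \<and> (\<exists>k m. 1 \<le> k \<and> 1 \<le> m \<and> k + m \<le> n - 5 \<and>
          L \<cong>\<^sub>L chain k \<^bold>+ (chain 2 \<times>\<^sub>L chain 2) \<^bold>+ chain m
             \<^bold>+ (chain 2 \<times>\<^sub>L chain 2) \<^bold>+ chain (n - k - m - 4))))) \<and>
    (of_nat (card (carrier (Con L))) < (2 :: rat) powi (int n - 3) \<longrightarrow>
     of_nat (card (carrier (Con L))) \<le> 7 * (2 :: rat) powi (int n - 6) \<and>
     7 * (2 :: rat) powi (int n - 6)
       = 2 powi (int n - 4) + 2 powi (int n - 5) + 2 powi (int n - 6))"
proof -
  let ?N = "num_con L" and ?P = "(2 :: rat) powi (int n - 6)"
  interpret L: finite_lattice L
    using assms(1-3) card.infinite card.empty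
    by (intro finite_lattice.intro finite_lattice_axioms.intro) (fastforce+)
  note n = assms(3)
  have pow: "(2 :: rat) powi (int n - 2) = of_nat 16 * ?P" "5 * (2 :: rat) powi (int n - 5) = of_nat 10 * ?P"
    "(2 :: rat) powi (int n - 3) = of_nat 8 * ?P" "7 * ?P = of_nat 7 * ?P"
    by (simp_all add: power_int_diff)
  have sums: "5 * (2 :: rat) powi (int n - 5) = 2 powi (int n - 3) + 2 powi (int n - 5)"
    "7 * ?P = 2 powi (int n - 4) + 2 powi (int n - 5) + 2 powi (int n - 6)"
    by (simp_all add: power_int_diff)
  have few: "64 * ?N < 16 * 2 ^ card (carrier L)"
    using assms(4) unfolding pow scaled_power_iff n .
  note classified = L.card_Con_classification[OF few, unfolded n]
  have n5: "5 \<le> n" using classified by blast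
  \<comment> \<open>In the families of the statement the last chain is determined by \<open>n\<close> and the other parameters.\<close>
  have pent: "pentagon_sum L \<longleftrightarrow>
    (\<exists>k. 1 \<le> k \<and> k \<le> n - 4 \<and> L \<cong>\<^sub>L chain k \<^bold>+ N5 \<^bold>+ chain (n - k - 3))"
  proof -
    have "1 \<le> l \<and> n = k + l + 3 \<longleftrightarrow> k \<le> n - 4 \<and> l = n - k - 3" if "1 \<le> k" for k l
      using that n5 by auto
    then show ?thesis unfolding pentagon_sum_def n by metis
  qed
  have ladder: "ladder_sum L \<longleftrightarrow>
    n \<ge> 6 \<and> (\<exists>k. 1 \<le> k \<and> k \<le> n - 5 \<and> L \<cong>\<^sub>L chain k \<^bold>+ ladder \<^bold>+ chain (n - k - 4))"
  proof -
    have "1 \<le> l \<and> n = k + l + 4 \<longleftrightarrow> n \<ge> 6 \<and> k \<le> n - 5 \<and> l = n - k - 4" if "1 \<le> k" for k l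
      using that by auto
    then show ?thesis unfolding ladder_sum_def n by metis
  qed
  have squares: "two_squares_sum L \<longleftrightarrow> n \<ge> 7 \<and> (\<exists>k m. 1 \<le> k \<and> 1 \<le> m \<and> k + m \<le> n - 5 \<and>
    L \<cong>\<^sub>L chain k \<^bold>+ square \<^bold>+ chain m \<^bold>+ square \<^bold>+ chain (n - k - m - 4))"
  proof -
    have "1 \<le> l \<and> n = k + m + l + 4 \<longleftrightarrow> n \<ge> 7 \<and> k + m \<le> n - 5 \<and> l = n - k - m - 4"
      if "1 \<le> k" "1 \<le> m" for k m l
      using that by auto
    then show ?thesis unfolding two_squares_sum_def n by metis
  qed
  define Q :: nat where "Q = 2 ^ n"
  have "0 < Q" by (simp add: Q_def)
  note counts = card_Con_pentagon_sum[OF L.finite_lattice_axioms]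
    card_Con_ladder_sum[OF L.finite_lattice_axioms] card_Con_two_squares_sum[OF L.finite_lattice_axioms]
  \<comment> \<open>With \<open>2 ^ n\<close> replaced by a positive variable the remaining case distinction is linear.\<close>
  note facts = classified counts[unfolded n] \<open>0 < Q\<close>
  have 1: "64 * ?N \<le> 10 * 2 ^ n" "64 * ?N = 10 * 2 ^ n \<longleftrightarrow> pentagon_sum L"
    using facts unfolding Q_def[symmetric] by linarith+
  have 2: "64 * ?N \<le> 8 * 2 ^ n" "64 * ?N = 8 * 2 ^ n \<longleftrightarrow> ladder_sum L \<or> two_squares_sum L"
    if "64 * ?N < 10 * 2 ^ n"
    using that facts unfolding Q_def[symmetric] by linarith+
  have 3: "64 * ?N \<le> 7 * 2 ^ n" if "64 * ?N < 8 * 2 ^ n"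
    using that facts unfolding Q_def[symmetric] by linarith
  show ?thesis
    unfolding sums(2)[symmetric] pent[symmetric] ladder[symmetric] squares[symmetric]
    using n5 sums(1) 1 2 3 unfolding pow scaled_power_iff by simp
qed

end
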